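(* Let $r\geqslant2$ be a fixed integer and let $\mathcal F_{\mathrm{II},0}$ be the class of equations $$u_t+uu_x=\sum_{j=2}^{r}a_jx^ju_j+a_{00}u+b_0x,$$ whose arbitrary elements $(a_2,\dots,a_r,a_{00},b_0)$ are real constants with $a_r\neq0$. The class $\mathcal F_{\mathrm{II},0}$ is normalized in the usual sense. Its usual equivalence group is constituted by the point transformations of the form $$\tilde t=c_1t+c_2,\quad \tilde x=c_4e^{c_3t}x,\quad \tilde u=\frac{c_4e^{c_3t}}{c_1}(u+c_3x),$$ $$\tilde a_j=\frac{a_j}{c_1}\ (j=2,\dots,r),\quad \tilde a_{00}=\frac{a_{00}+2c_3}{c_1},\quad \tilde b_0=\frac{b_0-c_3^2}{c_1^2},$$ where $c_1,c_2,c_3,c_4$ are arbitrary constants with $c_1c_4\neq0$.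
   Context: Here $u=u(t,x)$ and $u_j=\partial^j u/\partial x^j$. Point transformations are (local) diffeomorphisms. For a class of differential equations $\{\mathcal L_\theta:\theta\in\mathcal S\}$, an admissible transformation is a triple $(\theta,\tilde\theta,\varphi)$ where $\theta,\tilde\theta\in\mathcal S$ and $\varphi$ is a point transformation in the space of $(t,x,u)$ mapping $\mathcal L_\theta$ to $\mathcal L_{\tilde\theta}$; these triples form the equivalence groupoid. A usual equivalence transformation is a point transformation in the joint space of $(t,x,u)$ (prolonged to derivatives) and the arbitrary elements, whose $(t,x,u)$-components do not depend on the arbitrary elements, and which maps every equation of the class to an equation of the class; all of them form the usual equivalence group. Each such transformation $\mathcal T$ generates the admissible transformations $(\theta,\mathcal T\theta,\varphi)$, $\theta\in\mathcal S$, where $\varphi$ is the restriction of $\mathcal T$ to the space of $(t,x,u)$. The class is normalized in the usual sense if the admissible transformations generated by its usual equivalence group exhaust the entire equivalence groupoid.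
   Formalization: The printed formula for b̃_0 is false when a_00 c_3 ≠ 0 (e.g. u=x, c_1=c_4=c_3=a_00=1, c_2=b_0=0 gives b̃_0=-2, not -1); the formal statement uses b̃_0=(b_0-a_00 c_3-c_3^2)/c_1^2 instead. *)

theory Defs
  imports "HOL-Analysis.Analysis"
begin

text \<open>On an open set in finite dimension the two definitions below are the usual classes
  $C^k$ and $C^\infty$: the derivatives in every fixed direction are taken repeatedly.\<close>

primrec Ck_on :: "nat \<Rightarrow> 'a set \<Rightarrow> ('a::real_normed_vector \<Rightarrow> 'b::real_normed_vector) \<Rightarrow> bool" where
  "Ck_on 0 S f \<longleftrightarrow> continuous_on S f"
| "Ck_on (Suc k) S f \<longleftrightarrow>
     (\<forall>x\<in>S. f differentiable (at x)) \<and> (\<forall>v. Ck_on k S (\<lambda>x. frechet_derivative f (at x) v))"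

definition smooth_on :: "'a set \<Rightarrow> ('a::real_normed_vector \<Rightarrow> 'b::real_normed_vector) \<Rightarrow> bool" where
  "smooth_on S f \<longleftrightarrow> (\<forall>k. Ck_on k S f)"

definition diffeo_on :: "'a set \<Rightarrow> ('a::euclidean_space \<Rightarrow> 'a) \<Rightarrow> bool" where
  "diffeo_on D f \<longleftrightarrow> open D \<and> inj_on f D \<and> smooth_on D f \<and>
     open (f ` D) \<and> smooth_on (f ` D) (the_inv_into D f)"

text \<open>Points \<open>(t, x, u)\<close> of the space of the independent and dependent variables.\<close>

type_synonym txu = "real \<times> real \<times> real"

definition domain_txu :: "txu set \<Rightarrow> bool" where
  "domain_txu D \<longleftrightarrow> open D \<and> connected D \<and> D \<noteq> {}"

definition point_transformation :: "txu set \<Rightarrow> (txu \<Rightarrow> txu) \<Rightarrow> bool" where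
  "point_transformation D \<phi> \<longleftrightarrow> domain_txu D \<and> diffeo_on D \<phi>"

text \<open>A differential equation is represented by the predicate \<open>E u p\<close>: the jet of \<open>u\<close> at the
  point \<open>p = (t, x)\<close> satisfies the equation.\<close>

type_synonym pde = "(real \<times> real \<Rightarrow> real) \<Rightarrow> real \<times> real \<Rightarrow> bool"

definition smooth_near :: "real \<times> real \<Rightarrow> (real \<times> real \<Rightarrow> real) \<Rightarrow> bool" where
  "smooth_near p u \<longleftrightarrow> (\<exists>N. open N \<and> p \<in> N \<and> smooth_on N u)"

text \<open>Near \<open>p\<close> the point transformation \<open>\<phi>\<close> sends the graph of \<open>u\<close> into the graph of \<open>v\<close>, and the
  point of the former over \<open>p\<close> to the point of the latter over \<open>q\<close>. As \<open>\<phi>\<close> is a diffeomorphism,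
  the two graphs then correspond locally, and the jet of \<open>v\<close> at \<open>q\<close> is the image of the jet of \<open>u\<close>
  at \<open>p\<close> under the prolongation of \<open>\<phi>\<close>; every jet is the jet of some smooth function.\<close>

definition maps_graph ::
  "txu set \<Rightarrow> (txu \<Rightarrow> txu) \<Rightarrow> (real \<times> real \<Rightarrow> real) \<Rightarrow> real \<times> real \<Rightarrow>
   (real \<times> real \<Rightarrow> real) \<Rightarrow> real \<times> real \<Rightarrow> bool" where
  "maps_graph D \<phi> u p v q \<longleftrightarrow>
     smooth_near p u \<and> smooth_near q v \<and>
     (fst p, snd p, u p) \<in> D \<and> \<phi> (fst p, snd p, u p) = (fst q, snd q, v q) \<and>
     (\<forall>\<^sub>F (t, x) in nhds p. case \<phi> (t, x, u (t, x)) of (t', x', u') \<Rightarrow> u' = v (t', x'))"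

text \<open>The prolongation of \<open>\<phi>\<close> maps the set of jets defined by \<open>E\<close> to the one defined by \<open>E'\<close>.\<close>

definition maps_equation :: "txu set \<Rightarrow> (txu \<Rightarrow> txu) \<Rightarrow> pde \<Rightarrow> pde \<Rightarrow> bool" where
  "maps_equation D \<phi> E E' \<longleftrightarrow> (\<forall>u p v q. maps_graph D \<phi> u p v q \<longrightarrow> (E u p \<longleftrightarrow> E' v q))"

text \<open>A class of equations is given by the set \<open>S\<close> of values of its arbitrary elements, which are
  constants here, and by the equations \<open>L \<theta>\<close> for \<open>\<theta>\<close> in \<open>S\<close>. A point transformation is listed
  together with its domain.\<close>

definition equivalence_groupoid ::
  "'p set \<Rightarrow> ('p \<Rightarrow> pde) \<Rightarrow> ('p \<times> 'p \<times> txu set \<times> (txu \<Rightarrow> txu)) set" where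
  "equivalence_groupoid S L =
     {(\<theta>, \<theta>', D, \<phi>). \<theta> \<in> S \<and> \<theta>' \<in> S \<and> point_transformation D \<phi> \<and> maps_equation D \<phi> (L \<theta>) (L \<theta>')}"

text \<open>\<open>T\<close> acts on the joint space of \<open>(t, x, u)\<close> and the arbitrary elements. A priori its
  \<open>\<theta>\<close>-components may depend on \<open>(t, x, u)\<close>; since the transformed equation has to belong to the
  class, their values must be constants.\<close>

definition usual_equivalence_transformation ::
  "('p::euclidean_space) set \<Rightarrow> ('p \<Rightarrow> pde) \<Rightarrow> txu set \<Rightarrow> (txu \<times> 'p \<Rightarrow> txu \<times> 'p) \<Rightarrow> bool" where
  "usual_equivalence_transformation S L D T \<longleftrightarrow>
     domain_txu D \<and> diffeo_on (D \<times> S) T \<and>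
     (\<exists>\<phi>. (\<forall>z\<in>D. \<forall>\<theta>\<in>S. fst (T (z, \<theta>)) = \<phi> z) \<and>
          (\<forall>\<theta>\<in>S. \<exists>\<theta>'\<in>S. (\<forall>z\<in>D. snd (T (z, \<theta>)) = \<theta>') \<and> maps_equation D \<phi> (L \<theta>) (L \<theta>')))"

definition generated_admissible ::
  "('p::euclidean_space) set \<Rightarrow> ('p \<Rightarrow> pde) \<Rightarrow> ('p \<times> 'p \<times> txu set \<times> (txu \<Rightarrow> txu)) set" where
  "generated_admissible S L =
     {(\<theta>, \<theta>', D, \<phi>). \<theta> \<in> S \<and>
        (\<exists>T. usual_equivalence_transformation S L D T \<and> (\<forall>z\<in>D. T (z, \<theta>) = (\<phi> z, \<theta>')))}"

definition normalized_usual :: "('p::euclidean_space) set \<Rightarrow> ('p \<Rightarrow> pde) \<Rightarrow> bool" where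
  "normalized_usual S L \<longleftrightarrow> generated_admissible S L = equivalence_groupoid S L"

text \<open>The arbitrary elements \<open>((a\<^sub>2, \<dots>, a\<^sub>r), a\<^sub>0\<^sub>0, b\<^sub>0)\<close>. The coefficients \<open>a\<^sub>j\<close> form a vector
  over a finite index type \<open>'n\<close>, which is enumerated by a bijection \<open>idx\<close> from \<open>'n\<close> onto
  \<open>{2..r}\<close>: the component \<open>a $ i\<close> is the coefficient with the number \<open>idx i\<close>.\<close>

type_synonym 'n arb = "(real ^ 'n) \<times> real \<times> real"

definition F_II0_arb :: "('n::finite \<Rightarrow> nat) \<Rightarrow> nat \<Rightarrow> 'n arb set" where
  "F_II0_arb idx r = {(a, a00, b0). \<forall>i. idx i = r \<longrightarrow> a $ i \<noteq> 0}"

definition F_II0 :: "('n::finite \<Rightarrow> nat) \<Rightarrow> 'n arb \<Rightarrow> pde" where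
  "F_II0 idx = (\<lambda>(a, a00, b0) u (t, x).
     deriv (\<lambda>s. u (s, x)) t + u (t, x) * deriv (\<lambda>y. u (t, y)) x =
     (\<Sum>i\<in>UNIV. a $ i * x ^ idx i * (deriv ^^ idx i) (\<lambda>y. u (t, y)) x) + a00 * u (t, x) + b0 * x)"

text \<open>The source of the statement has \<open>(b0 - c3\<^sup>2) / c1\<^sup>2\<close> as the last component, without the term
  \<open>- a00 * c3\<close>. That term is indispensable: on functions
  \<open>u = p(t) x\<close> the equation reads \<open>p' + p\<^sup>2 = a00 p + b0\<close>, the new function corresponds to
  \<open>q = (p + c3) / c1\<close> as a function of \<open>c1 t + c2\<close>, and then
  \<open>q' + q\<^sup>2 = (p' + p\<^sup>2 + 2 c3 p + c3\<^sup>2) / c1\<^sup>2 = ((a00 + 2 c3) / c1) q + (b0 - a00 c3 - c3\<^sup>2) / c1\<^sup>2\<close>.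
  Without this term the target equation would be wrong whenever \<open>a00 c3 \<noteq> 0\<close>, and the family
  would not be closed under composition.\<close>

definition F_II0_transf ::
  "real \<Rightarrow> real \<Rightarrow> real \<Rightarrow> real \<Rightarrow> txu \<times> ('n::finite) arb \<Rightarrow> txu \<times> 'n arb" where
  "F_II0_transf c1 c2 c3 c4 = (\<lambda>((t, x, u), (a, a00, b0)).
     ((c1 * t + c2,
       c4 * exp (c3 * t) * x,
       c4 * exp (c3 * t) / c1 * (u + c3 * x)),
      (\<chi> i. a $ i / c1,
       (a00 + 2 * c3) / c1,
       (b0 - a00 * c3 - c3\<^sup>2) / c1\<^sup>2)))"

end

theory Submission
  imports Defs
begin

text \<open>Let \<open>\<phi> = (T, X, U)\<close> map one equation of the class to another, and restrict it to the dense open set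
  where \<open>x\<close> and \<open>X\<close> do not vanish. The images of two functions are compared that have the same jet of
  order \<open>r - 1\<close> at a point, or a combination of images that vanishes to high order: by Taylor's
  theorem only the leading term \<open>a\<^sub>r x\<^sup>r u\<^sub>r\<close> then sees the difference, so that no formula for higher
  derivatives of compositions is needed. For two functions whose difference is \<open>(t - t\<^sub>0)\<^sup>r\<close> this gives
  \<open>T\<^sub>x = T\<^sub>u = 0\<close>, for the difference \<open>(x - x\<^sub>0)\<^sup>r\<close> it gives \<open>X\<^sub>u = 0\<close> and
  \<open>a'\<^sub>r T\<^sub>t X\<^sup>r = a\<^sub>r x\<^sup>r X\<^sub>x\<^sup>r\<close>, and for the mixed difference in the coefficients of \<open>x - x\<^sub>0\<close> and
  \<open>(x - x\<^sub>0)\<^bsup>r - 1\<^esup>\<close> it gives \<open>U\<^sub>u\<^sub>u = 0\<close>. After that, functions affine in \<open>x\<close> suffice. The terms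
  \<open>u u\<^sub>x\<close> and \<open>u\<^sup>2\<close> yield \<open>T\<^sub>t U\<^sub>u = X\<^sub>x\<close> and \<open>U\<^sub>x\<^sub>u = 0\<close>, hence \<open>X = x X\<^sub>x\<close> and \<open>T\<^sub>t = a\<^sub>r / a'\<^sub>r\<close>. The terms \<open>u\<^sub>x\<close>
  and \<open>u\<close> yield \<open>T\<^sub>t U = X\<^sub>t + X\<^sub>x u\<close> and \<open>X\<^sub>t = c\<^sub>3 X\<close> with a constant \<open>c\<^sub>3\<close> that depends on the two equations
  only. These identities extend to the whole domain by continuity and are integrated there.\<close>

subsection \<open>Calculus of smooth maps\<close>

text \<open>That one equation is mapped to another is known only through pairs of functions with
  corresponding graphs. To exploit it, the image of each test function has to be exhibited; this
  calls for a smooth local inverse of the induced map of the (t, x)-plane, and test slopes must be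
  chosen so that this map is regular. The factors x and X have to be nonzero because they occur in
  the leading coefficients a_r x^r and a'_r X^r. Removing x = 0 may disconnect the domain, and
  integration on the pieces could produce different constants; this is why the first-order
  identities are extended to the whole connected domain before anything is integrated. The constants
  c1 = a_r / a'_r and c3 = (c1 a'_00 - a_00) / 2 are read off from the two equations. The
  transformation law of the coefficients is not extracted from the determining equations: it is
  verified directly for the family, and since an equation of the class is determined by its jets
  over one point x with two values of u, the target is then unique.\<close>

lemma Ck_on_cong:
  assumes "open S" "\<And>x. x \<in> S \<Longrightarrow> f x = g x" "Ck_on k S f"
  shows "Ck_on k S g"
  using assms(2,3)
proof (induction k arbitrary: f g)
  case 0
  then show ?case using continuous_on_cong[of S S f g] by auto
next
  case (Suc k)
  have fd: "(f has_derivative frechet_derivative f (at x)) (at x)" if "x \<in> S" for x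
    using Suc.prems(2) that frechet_derivative_works by auto
  have gd: "(g has_derivative frechet_derivative f (at x)) (at x)" if "x \<in> S" for x
    using has_derivative_transform_within_open[OF fd[OF that] \<open>open S\<close> that] Suc.prems(1) by auto
  have eq: "frechet_derivative f (at x) = frechet_derivative g (at x)" if "x \<in> S" for x
    using frechet_derivative_at[OF gd[OF that]] .
  show ?case
    using Suc.prems(2) Suc.IH[of "\<lambda>x. frechet_derivative f (at x) v" "\<lambda>x. frechet_derivative g (at x) v" for v]
      eq gd unfolding Ck_on.simps differentiable_def by fastforce
qed

text \<open>\<open>Ck_on\<close> speaks of \<open>frechet_derivative\<close>; here any explicitly
  given derivative may take its place. Most closure properties below descend one order at a time
  through this rule.\<close>

lemma Ck_on_SucI:
  assumes "open S" "\<And>x. x \<in> S \<Longrightarrow> (f has_derivative f' x) (at x)" "\<And>v. Ck_on k S (\<lambda>x. f' x v)"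
  shows "Ck_on (Suc k) S f"
  unfolding Ck_on.simps
proof (intro conjI ballI allI)
  show "f differentiable at x" if "x \<in> S" for x
    using assms(2)[OF that] differentiable_def by blast
  show "Ck_on k S (\<lambda>x. frechet_derivative f (at x) v)" for v
    by (rule Ck_on_cong[OF assms(1) _ assms(3)]) (simp add: frechet_derivative_at[OF assms(2), symmetric])
qed

lemma Ck_on_SucD:
  assumes "Ck_on (Suc k) S f"
  shows "x \<in> S \<Longrightarrow> (f has_derivative frechet_derivative f (at x)) (at x)"
    "Ck_on k S (\<lambda>x. frechet_derivative f (at x) v)"
  using assms frechet_derivative_works by auto

lemma Ck_on_Suc_imp: "Ck_on (Suc k) S f \<Longrightarrow> Ck_on k S f"
proof (induction k arbitrary: f)
  case 0
  then show ?case
    by (auto intro!: differentiable_imp_continuous_on simp: differentiable_on_def differentiable_at_withinI)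
next
  case (Suc k)
  then show ?case by (metis Ck_on.simps(2))
qed

lemma Ck_on_const: "Ck_on k S (\<lambda>x. c)"
  by (induction k arbitrary: c) auto

lemma Ck_on_bounded_linear:
  assumes "bounded_linear h" "open S" "Ck_on k S f"
  shows "Ck_on k S (\<lambda>x. h (f x))"
  using assms(3)
proof (induction k arbitrary: f)
  case 0
  then show ?case using bounded_linear.continuous_on[OF assms(1)] by auto
next
  case (Suc k)
  note d = Ck_on_SucD[OF Suc.prems]
  show ?case
    by (rule Ck_on_SucI[OF assms(2) bounded_linear.has_derivative[OF assms(1) d(1)] Suc.IH[OF d(2)]])
qed

lemma Ck_on_add:
  assumes "open S" "Ck_on k S f" "Ck_on k S g"
  shows "Ck_on k S (\<lambda>x. f x + g x)"
  using assms(2,3)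
proof (induction k arbitrary: f g)
  case 0
  then show ?case by (auto intro: continuous_on_add)
next
  case (Suc k)
  note d = Ck_on_SucD[OF Suc.prems(1)] and e = Ck_on_SucD[OF Suc.prems(2)]
  show ?case
    by (rule Ck_on_SucI[OF assms(1) has_derivative_add[OF d(1) e(1)] Suc.IH[OF d(2) e(2)]])
qed

lemma Ck_on_sum:
  assumes "open S" "\<And>i. i \<in> I \<Longrightarrow> Ck_on k S (f i)"
  shows "Ck_on k S (\<lambda>x. \<Sum>i\<in>I. f i x)"
proof (cases "finite I")
  case True
  then show ?thesis using assms
    by (induction I rule: finite_induct) (auto intro: Ck_on_add Ck_on_const)
qed (simp add: Ck_on_const)

lemma Ck_on_bilinear:
  assumes "bounded_bilinear h" "open S" "Ck_on k S f" "Ck_on k S g"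
  shows "Ck_on k S (\<lambda>x. h (f x) (g x))"
  using assms(3,4)
proof (induction k arbitrary: f g)
  case 0
  then show ?case using bounded_bilinear.continuous_on[OF assms(1)] by auto
next
  case (Suc k)
  note d = Ck_on_SucD[OF Suc.prems(1)] and e = Ck_on_SucD[OF Suc.prems(2)]
  show ?case
    by (rule Ck_on_SucI[OF assms(2) bounded_bilinear.FDERIV[OF assms(1) d(1) e(1)]
          Ck_on_add[OF assms(2) Suc.IH[OF Ck_on_Suc_imp[OF Suc.prems(1)] e(2)]
            Suc.IH[OF d(2) Ck_on_Suc_imp[OF Suc.prems(2)]]]])
qed

text \<open>The chain rule evaluates the derivative of \<open>f\<close> in the direction
  \<open>g' x v\<close>, which varies with x, while \<open>Ck_on\<close> controls fixed directions
  only. Expanding this direction over \<open>Basis\<close> turns it into a finite sum of products,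
  hence the Euclidean middle space.\<close>

lemma Ck_on_compose:
  fixes g :: "'a::real_normed_vector \<Rightarrow> 'b::euclidean_space"
  assumes "open S" "g ` S \<subseteq> V" "Ck_on k V f" "Ck_on k S g"
  shows "Ck_on k S (\<lambda>x. f (g x))"
  using assms(3,4)
proof (induction k arbitrary: f)
  case 0
  then show ?case using continuous_on_compose2[of V f S g] assms(2) by auto
next
  case (Suc k)
  note d = Ck_on_SucD[OF Suc.prems(1)] and e = Ck_on_SucD[OF Suc.prems(2)]
  let ?f' = "\<lambda>x. frechet_derivative f (at (g x))" and ?g' = "\<lambda>x. frechet_derivative g (at x)"
  have V: "g x \<in> V" if "x \<in> S" for x using that assms(2) by auto
  have "Ck_on (Suc k) S (\<lambda>x. f (g x))"
  proof (rule Ck_on_SucI[OF assms(1)])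
    show "((\<lambda>x. f (g x)) has_derivative (\<lambda>v. ?f' x (?g' x v))) (at x)" if "x \<in> S" for x
      using diff_chain_at[OF e(1)[OF that] d(1)[OF V[OF that]]] by (simp add: o_def)
    fix v
    have "Ck_on k S (\<lambda>x. \<Sum>b\<in>Basis. (?g' x v \<bullet> b) *\<^sub>R ?f' x b)"
      by (intro Ck_on_sum assms(1) Ck_on_bilinear[OF bounded_bilinear_scaleR]
          Ck_on_bounded_linear[OF bounded_linear_inner_left] e(2) Suc.IH[OF d(2)] Ck_on_Suc_imp[OF Suc.prems(2)])
    then show "Ck_on k S (\<lambda>x. ?f' x (?g' x v))"
    proof (rule Ck_on_cong[OF assms(1), rotated])
      fix x assume "x \<in> S"
      have lin: "linear (?f' x)" using d(1)[OF V[OF \<open>x \<in> S\<close>]] has_derivative_linear by blast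
      have "?f' x (?g' x v) = ?f' x (\<Sum>b\<in>Basis. (?g' x v \<bullet> b) *\<^sub>R b)"
        by (simp add: euclidean_representation)
      also have "\<dots> = (\<Sum>b\<in>Basis. (?g' x v \<bullet> b) *\<^sub>R ?f' x b)"
        using lin by (simp add: linear_sum linear_scale)
      finally show "(\<Sum>b\<in>Basis. (?g' x v \<bullet> b) *\<^sub>R ?f' x b) = ?f' x (?g' x v)" by simp
    qed
  qed
  then show ?case .
qed

lemma smooth_onD: "smooth_on S f \<Longrightarrow> Ck_on k S f"
  by (simp add: smooth_on_def)

lemma smooth_on_cong:
  "open S \<Longrightarrow> (\<And>x. x \<in> S \<Longrightarrow> f x = g x) \<Longrightarrow> smooth_on S f \<Longrightarrow> smooth_on S g"
  unfolding smooth_on_def using Ck_on_cong by blast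

lemma Ck_on_subset: "Ck_on k S f \<Longrightarrow> T \<subseteq> S \<Longrightarrow> Ck_on k T f"
  by (induction k arbitrary: f) (auto intro: continuous_on_subset)

lemma smooth_on_subset: "smooth_on S f \<Longrightarrow> T \<subseteq> S \<Longrightarrow> smooth_on T f"
  unfolding smooth_on_def using Ck_on_subset by blast

lemma smooth_on_const: "smooth_on S (\<lambda>x. c)"
  unfolding smooth_on_def by (simp add: Ck_on_const)

lemma smooth_on_bounded_linear:
  "bounded_linear h \<Longrightarrow> open S \<Longrightarrow> smooth_on S f \<Longrightarrow> smooth_on S (\<lambda>x. h (f x))"
  unfolding smooth_on_def using Ck_on_bounded_linear by blast

lemma smooth_on_linear:
  assumes "bounded_linear h"
  shows "smooth_on S h"
proof -
  have "Ck_on k S h" for k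
  proof (cases k)
    case 0
    then show ?thesis using linear_continuous_on[OF assms] by simp
  next
    case (Suc j)
    have "frechet_derivative h (at x) = h" for x
      using bounded_linear_imp_has_derivative[OF assms] frechet_derivative_at by metis
    then show ?thesis
      using Suc bounded_linear_imp_differentiable[OF assms] by (auto simp: Ck_on_const)
  qed
  then show ?thesis by (simp add: smooth_on_def)
qed

lemma smooth_on_id: "smooth_on S (\<lambda>x. x)"
  by (rule smooth_on_linear[OF bounded_linear_ident])

lemma smooth_on_fst: "smooth_on S fst" and smooth_on_snd: "smooth_on S snd"
  by (rule smooth_on_linear[OF bounded_linear_fst] smooth_on_linear[OF bounded_linear_snd])+

lemma smooth_on_add:
  "open S \<Longrightarrow> smooth_on S f \<Longrightarrow> smooth_on S g \<Longrightarrow> smooth_on S (\<lambda>x. f x + g x)"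
  unfolding smooth_on_def using Ck_on_add by blast

lemma smooth_on_scaleR:
  "open S \<Longrightarrow> smooth_on S f \<Longrightarrow> smooth_on S g \<Longrightarrow> smooth_on S (\<lambda>x. f x *\<^sub>R g x)"
  unfolding smooth_on_def using Ck_on_bilinear[OF bounded_bilinear_scaleR] by blast

lemma smooth_on_mult:
  fixes f g :: "'a::real_normed_vector \<Rightarrow> real"
  shows "open S \<Longrightarrow> smooth_on S f \<Longrightarrow> smooth_on S g \<Longrightarrow> smooth_on S (\<lambda>x. f x * g x)"
  using smooth_on_scaleR[of S f g] by simp

lemma smooth_on_uminus: "open S \<Longrightarrow> smooth_on S f \<Longrightarrow> smooth_on S (\<lambda>x. - f x)"
  by (rule smooth_on_bounded_linear[OF bounded_linear_minus[OF bounded_linear_ident]])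

lemma smooth_on_diff:
  "open S \<Longrightarrow> smooth_on S f \<Longrightarrow> smooth_on S g \<Longrightarrow> smooth_on S (\<lambda>x. f x - g x)"
  using smooth_on_add[of S f "\<lambda>x. - g x"] smooth_on_uminus[of S g] by simp

lemma smooth_on_power:
  fixes f :: "'a::real_normed_vector \<Rightarrow> real"
  shows "open S \<Longrightarrow> smooth_on S f \<Longrightarrow> smooth_on S (\<lambda>x. f x ^ n)"
  by (induction n) (auto intro: smooth_on_const smooth_on_mult)

lemma Ck_on_Pair:
  assumes "open S" "Ck_on k S f" "Ck_on k S g"
  shows "Ck_on k S (\<lambda>x. (f x, g x))"
proof -
  have "Ck_on k S (\<lambda>x. (f x, 0) + (0, g x))"
    by (intro Ck_on_add assms Ck_on_bounded_linear[OF _ assms(1,2)]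
        Ck_on_bounded_linear[OF _ assms(1,3)] bounded_linear_Pair bounded_linear_ident bounded_linear_zero)
  then show ?thesis by simp
qed

lemma smooth_on_Pair:
  "open S \<Longrightarrow> smooth_on S f \<Longrightarrow> smooth_on S g \<Longrightarrow> smooth_on S (\<lambda>x. (f x, g x))"
  unfolding smooth_on_def using Ck_on_Pair by blast

lemma smooth_on_compose:
  fixes g :: "'a::real_normed_vector \<Rightarrow> 'b::euclidean_space"
  shows "open S \<Longrightarrow> g ` S \<subseteq> V \<Longrightarrow> smooth_on V f \<Longrightarrow> smooth_on S g \<Longrightarrow> smooth_on S (\<lambda>x. f (g x))"
  unfolding smooth_on_def using Ck_on_compose by blast

lemma smooth_on_exp:
  fixes f :: "'a::real_normed_vector \<Rightarrow> real"
  assumes "open S" "smooth_on S f"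
  shows "smooth_on S (\<lambda>x. exp (f x))"
proof -
  have "Ck_on k UNIV (exp :: real \<Rightarrow> real)" for k
  proof (induction k)
    case (Suc k)
    show ?case
    proof (rule Ck_on_SucI)
      show "(exp has_derivative (\<lambda>v. exp x * v)) (at x)" for x :: real
        using DERIV_exp[of x] by (simp add: has_field_derivative_def)
      show "Ck_on k UNIV (\<lambda>x. exp x * v)" for v :: real
        by (rule Ck_on_bounded_linear[OF bounded_linear_mult_left _ Suc]) simp
    qed simp
  qed (auto intro: continuous_intros)
  then show ?thesis
    using smooth_on_compose[OF assms(1), of f UNIV exp] assms(2) by (simp add: smooth_on_def)
qed

text \<open>The derivative of the reciprocal contains only the reciprocal itself and a derivative of
  \<open>f\<close>, so the induction on \<open>k\<close> can feed on its own conclusion.\<close>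

lemma Ck_on_inverse:
  fixes f :: "'a::real_normed_vector \<Rightarrow> real"
  assumes "open S" "Ck_on k S f" "\<And>x. x \<in> S \<Longrightarrow> f x \<noteq> 0"
  shows "Ck_on k S (\<lambda>x. inverse (f x))"
  using assms(2)
proof (induction k)
  case 0
  then show ?case using assms(3) by (auto intro!: continuous_intros)
next
  case (Suc k)
  note d = Ck_on_SucD[OF Suc.prems]
  note IH = Suc.IH[OF Ck_on_Suc_imp[OF Suc.prems]]
  show ?case
  proof (rule Ck_on_SucI[OF assms(1)])
    show "((\<lambda>x. inverse (f x)) has_derivative
        (\<lambda>v. - (inverse (f x) * frechet_derivative f (at x) v * inverse (f x)))) (at x)" if "x \<in> S" for x
      using Deriv.has_derivative_inverse[OF assms(3)[OF that] d(1)[OF that]] .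
    show "Ck_on k S (\<lambda>x. - (inverse (f x) * frechet_derivative f (at x) v * inverse (f x)))" for v
      by (intro Ck_on_bounded_linear[OF bounded_linear_minus[OF bounded_linear_ident] assms(1)]
          Ck_on_bilinear[OF bounded_bilinear_mult assms(1)] IH d(2))
  qed
qed

lemma smooth_on_has_derivative:
  "smooth_on S f \<Longrightarrow> x \<in> S \<Longrightarrow> (f has_derivative frechet_derivative f (at x)) (at x)"
  using Ck_on_SucD(1)[of 0] smooth_onD by blast

lemma smooth_on_frechet:
  "smooth_on S f \<Longrightarrow> smooth_on S (\<lambda>x. frechet_derivative f (at x) v)"
  using Ck_on_SucD(2) unfolding smooth_on_def by blast

lemma smooth_on_continuous: "smooth_on S f \<Longrightarrow> continuous_on S f"
  using smooth_onD[of S f 0] by simp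

lemmas smooth_intros = smooth_on_const smooth_on_id smooth_on_fst smooth_on_snd smooth_on_add smooth_on_diff
  smooth_on_uminus smooth_on_mult smooth_on_power smooth_on_exp smooth_on_Pair

section \<open>Higher derivatives in one variable and lowest Taylor coefficients\<close>

lemma smooth_on_imp_deriv:
  fixes f :: "real \<Rightarrow> real"
  assumes "open S" "smooth_on S f"
  shows "x \<in> S \<Longrightarrow> (f has_real_derivative deriv f x) (at x)" "smooth_on S (deriv f)"
proof -
  have d: "(f has_real_derivative frechet_derivative f (at x) 1) (at x)" if "x \<in> S" for x
  proof -
    have f: "(f has_derivative frechet_derivative f (at x)) (at x)"
      using smooth_on_has_derivative[OF assms(2) that] .
    have "frechet_derivative f (at x) v = frechet_derivative f (at x) 1 * v" for v
      using linear_scale[OF has_derivative_linear[OF f], of v 1] by (simp add: mult.commute)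
    then have "frechet_derivative f (at x) = (*) (frechet_derivative f (at x) 1)" by blast
    with f show ?thesis by (simp add: has_field_derivative_def)
  qed
  then have e: "deriv f x = frechet_derivative f (at x) 1" if "x \<in> S" for x
    using DERIV_imp_deriv that by blast
  show "x \<in> S \<Longrightarrow> (f has_real_derivative deriv f x) (at x)" using d e by metis
  show "smooth_on S (deriv f)"
    by (rule smooth_on_cong[OF assms(1) _ smooth_on_frechet[OF assms(2), of 1]]) (simp add: e)
qed

lemma smooth_on_higher_deriv:
  fixes f :: "real \<Rightarrow> real"
  assumes "open S" "smooth_on S f"
  shows "smooth_on S ((deriv ^^ n) f)"
    "x \<in> S \<Longrightarrow> ((deriv ^^ n) f has_real_derivative (deriv ^^ Suc n) f x) (at x)"
proof -
  show *: "smooth_on S ((deriv ^^ n) f)" for n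
    by (induction n) (auto intro: assms smooth_on_imp_deriv(2))
  show "x \<in> S \<Longrightarrow> ((deriv ^^ n) f has_real_derivative (deriv ^^ Suc n) f x) (at x)"
    using smooth_on_imp_deriv(1)[OF assms(1) *] by simp
qed

lemma higher_deriv_cong:
  assumes "open S" "\<And>x. x \<in> S \<Longrightarrow> f x = g x" "x \<in> S"
  shows "(deriv ^^ n) f x = (deriv ^^ n) g (x::real)"
  using assms(3)
proof (induction n arbitrary: x)
  case (Suc n)
  have "\<forall>\<^sub>F y in nhds x. (deriv ^^ n) f y = (deriv ^^ n) g y"
    using eventually_nhds_in_open[OF assms(1) Suc.prems] by eventually_elim (rule Suc.IH)
  then show ?case by (simp add: deriv_cong_ev)
qed (simp add: assms)

lemma higher_deriv_add_cmult:
  fixes f g :: "real \<Rightarrow> real"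
  assumes "open S" "smooth_on S f" "smooth_on S g" "x \<in> S"
  shows "(deriv ^^ n) (\<lambda>x. f x + c * g x) x = (deriv ^^ n) f x + c * (deriv ^^ n) g x"
  using assms(4)
proof (induction n arbitrary: x)
  case (Suc n)
  have "\<forall>\<^sub>F y in nhds x. (deriv ^^ n) (\<lambda>x. f x + c * g x) y = (deriv ^^ n) f y + c * (deriv ^^ n) g y"
    using eventually_nhds_in_open[OF assms(1) Suc.prems] by eventually_elim (rule Suc.IH)
  then have "(deriv ^^ Suc n) (\<lambda>x. f x + c * g x) x = deriv (\<lambda>y. (deriv ^^ n) f y + c * (deriv ^^ n) g y) x"
    by (simp add: deriv_cong_ev)
  also have "\<dots> = (deriv ^^ Suc n) f x + c * (deriv ^^ Suc n) g x"
    by (intro DERIV_imp_deriv DERIV_add DERIV_cmult smooth_on_higher_deriv(2)[OF assms(1)] assms Suc.prems)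
  finally show ?case .
qed simp

lemma higher_deriv_monomial:
  "(deriv ^^ j) (\<lambda>x::real. (x - c) ^ k) = (\<lambda>x. if j \<le> k then fact k / fact (k - j) * (x - c) ^ (k - j) else 0)"
proof (induction j)
  case (Suc j)
  show ?case
  proof
    fix x
    consider "Suc j \<le> k" | "j = k" | "j > k" by linarith
    then show "(deriv ^^ Suc j) (\<lambda>x. (x - c) ^ k) x
      = (if Suc j \<le> k then fact k / fact (k - Suc j) * (x - c) ^ (k - Suc j) else 0)"
    proof cases
      case 1
      define l where "l = k - Suc j"
      have l: "k - j = Suc l" using 1 by (simp add: l_def)
      have "((\<lambda>x. fact k / fact (k - j) * (x - c) ^ (k - j)) has_real_derivative
          fact k / fact l * (x - c) ^ l) (at x)"
        unfolding l
        by (rule derivative_eq_intros refl)+ (simp add: fact_Suc divide_simps del: of_nat_Suc)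
      then show ?thesis using 1 Suc by (simp add: l_def DERIV_imp_deriv)
    qed (use Suc in simp_all)
  qed
qed simp

lemma higher_deriv_monomial_at:
  "(deriv ^^ j) (\<lambda>x::real. (x - c) ^ k) c = (if j = k then fact k else 0)"
  by (auto simp: higher_deriv_monomial)

text \<open>The function \<open>\<rho>\<close> need not be onto a neighbourhood of \<open>q\<close>: only the lowest nonvanishing
  Taylor coefficient of \<open>g\<close> matters.\<close>

lemma higher_deriv_of_flat:
  fixes g :: "real \<Rightarrow> real" and F :: "'b filter"
  assumes "open N" "q \<in> N" "smooth_on N g" "F \<noteq> bot" "(\<rho> \<longlongrightarrow> q) F" "\<forall>\<^sub>F s in F. \<rho> s \<noteq> q"
    and lim: "((\<lambda>s. g (\<rho> s) / (\<rho> s - q) ^ r) \<longlongrightarrow> K) F"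
  shows "j < r \<Longrightarrow> (deriv ^^ j) g q = 0" "(deriv ^^ r) g q = fact r * K"
proof -
  have \<rho>: "filterlim \<rho> (at q) F" using assms(5,6) by (simp add: filterlim_at)
  obtain e where e: "e > 0" "cball q e \<subseteq> N" using assms(1,2) open_contains_cball by blast
  \<comment> \<open>With the lower derivatives zero, Taylor's formula consists of its remainder
    alone, and the intermediate point \<open>\<xi> y\<close> is squeezed to q.\<close>
  have taylor: "((\<lambda>y. g y / (y - q) ^ n) \<longlongrightarrow> (deriv ^^ n) g q / fact n) (at q)"
    if z: "\<And>j. j < n \<Longrightarrow> (deriv ^^ j) g q = 0" for n
  proof (cases "n = 0")
    case True
    have "isCont g q" using smooth_on_imp_deriv(1)[OF assms(1,3,2)] DERIV_isCont by blast
    then show ?thesis using True by (simp add: isCont_def)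
  next
    case False
    have "\<exists>t. \<bar>t - q\<bar> \<le> \<bar>y - q\<bar> \<and> g y = (deriv ^^ n) g t / fact n * (y - q) ^ n"
      if y: "y \<in> ball q e" "y \<noteq> q" for y
    proof -
      have "\<exists>t. (if y < q then y < t \<and> t < q else q < t \<and> t < y) \<and>
        g y = (\<Sum>m<n. ((deriv ^^ m) g q / fact m) * (y - q)^m) + ((deriv ^^ n) g t / fact n) * (y - q)^n"
      proof (rule Taylor)
        show "\<forall>m t. m < n \<and> q - e \<le> t \<and> t \<le> q + e \<longrightarrow>
          ((deriv ^^ m) g has_real_derivative (deriv ^^ Suc m) g t) (at t)"
        proof (intro allI impI)
          fix m t assume "m < n \<and> q - e \<le> t \<and> t \<le> q + e"
          then have "t \<in> cball q e" by (auto simp: dist_real_def)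
          then show "((deriv ^^ m) g has_real_derivative (deriv ^^ Suc m) g t) (at t)"
            using smooth_on_higher_deriv(2)[OF assms(1,3)] e by blast
        qed
      qed (use False y e in \<open>auto simp: dist_real_def\<close>)
      then obtain t where "if y < q then y < t \<and> t < q else q < t \<and> t < y"
        "g y = (\<Sum>m<n. ((deriv ^^ m) g q / fact m) * (y - q)^m) + ((deriv ^^ n) g t / fact n) * (y - q)^n"
        by blast
      then show ?thesis using z by (intro exI[of _ t]) (auto split: if_splits)
    qed
    then obtain \<xi> where \<xi>: "\<And>y. y \<in> ball q e \<Longrightarrow> y \<noteq> q \<Longrightarrow>
        \<bar>\<xi> y - q\<bar> \<le> \<bar>y - q\<bar> \<and> g y = (deriv ^^ n) g (\<xi> y) / fact n * (y - q) ^ n"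
      by metis
    have ev: "\<forall>\<^sub>F y in at q. y \<in> ball q e \<and> y \<noteq> q"
      using e by (auto simp: eventually_at_filter intro: eventually_mono[OF eventually_nhds_in_open[of "ball q e"]])
    have "((\<lambda>y. \<xi> y - q) \<longlongrightarrow> 0) (at q)"
    proof (rule Lim_null_comparison)
      show "\<forall>\<^sub>F y in at q. norm (\<xi> y - q) \<le> \<bar>y - q\<bar>"
        using ev by eventually_elim (use \<xi> in auto)
      show "((\<lambda>y. \<bar>y - q\<bar>) \<longlongrightarrow> 0) (at q)"
        by (rule tendsto_eq_intros refl)+ auto
    qed
    then have "(\<xi> \<longlongrightarrow> q) (at q)" by (simp add: LIM_zero_iff)
    moreover have "isCont ((deriv ^^ n) g) q"
      using smooth_on_higher_deriv(2)[OF assms(1,3,2)] DERIV_isCont by blast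
    ultimately have "((\<lambda>y. (deriv ^^ n) g (\<xi> y) / fact n) \<longlongrightarrow> (deriv ^^ n) g q / fact n) (at q)"
      by (intro tendsto_divide isCont_tendsto_compose[where g = "(deriv ^^ n) g"]) auto
    then show ?thesis
    proof (rule Lim_transform_eventually)
      show "\<forall>\<^sub>F y in at q. (deriv ^^ n) g (\<xi> y) / fact n = g y / (y - q) ^ n"
        using ev
      proof eventually_elim
        case (elim y)
        then show ?case using \<xi>[of y] by (auto simp: field_simps)
      qed
    qed
  qed
  \<comment> \<open>One order at a time: the quotient by the n-th power tends to the n-th Taylor
    coefficient, but for n < r also to 0, being the given quotient times a positive power of
    \<open>\<rho> s - q\<close>.\<close>
  have vanish: "\<forall>j<n. (deriv ^^ j) g q = 0" if "n \<le> r" for n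
    using that
  proof (induction n)
    case (Suc n)
    then have IH: "\<And>j. j < n \<Longrightarrow> (deriv ^^ j) g q = 0" by simp
    have "((\<lambda>s. g (\<rho> s) / (\<rho> s - q) ^ n) \<longlongrightarrow> (deriv ^^ n) g q / fact n) F"
      using filterlim_compose[OF taylor[OF IH] \<rho>] .
    moreover have "((\<lambda>s. g (\<rho> s) / (\<rho> s - q) ^ n) \<longlongrightarrow> 0) F"
    proof (rule Lim_transform_eventually)
      have "((\<lambda>s. g (\<rho> s) / (\<rho> s - q) ^ r * (\<rho> s - q) ^ (r - n)) \<longlongrightarrow> K * (q - q) ^ (r - n)) F"
        by (intro tendsto_mult lim tendsto_power tendsto_diff assms(5) tendsto_const)
      then show "((\<lambda>s. g (\<rho> s) / (\<rho> s - q) ^ r * (\<rho> s - q) ^ (r - n)) \<longlongrightarrow> 0) F"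
        using Suc.prems by (simp add: power_0_left del: times_divide_eq_left)
      show "\<forall>\<^sub>F s in F. g (\<rho> s) / (\<rho> s - q) ^ r * (\<rho> s - q) ^ (r - n) = g (\<rho> s) / (\<rho> s - q) ^ n"
        using assms(6)
      proof eventually_elim
        case (elim s)
        have "(\<rho> s - q) ^ r = (\<rho> s - q) ^ n * (\<rho> s - q) ^ (r - n)"
          using Suc.prems by (simp flip: power_add)
        then show ?case using elim by simp
      qed
    qed
    ultimately have "(deriv ^^ n) g q / fact n = 0" using tendsto_unique[OF assms(4)] by blast
    then show ?case using IH less_Suc_eq by auto
  qed simp
  then show "j < r \<Longrightarrow> (deriv ^^ j) g q = 0" by auto
  have "((\<lambda>s. g (\<rho> s) / (\<rho> s - q) ^ r) \<longlongrightarrow> (deriv ^^ r) g q / fact r) F"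
    using filterlim_compose[OF taylor \<rho>] vanish[of r] by blast
  then have "(deriv ^^ r) g q / fact r = K" using tendsto_unique[OF assms(4) _ lim] by blast
  then show "(deriv ^^ r) g q = fact r * K" by (simp add: field_simps)
qed

text \<open>A section of the image is parametrised by the old coordinate x through its new
  coordinate \<open>\<rho> x\<close>. Since \<open>\<rho> x - \<rho> x0\<close> behaves like c (x -
  x0), being flat of order r in x means being flat of order r in the new coordinate, with the
  coefficient divided by \<open>c ^ r\<close>.\<close>

lemma higher_deriv_of_flat_section:
  fixes g :: "real \<Rightarrow> real"
  assumes N: "open N" "\<rho> x0 \<in> N" "smooth_on N g" and \<rho>: "(\<rho> has_real_derivative c) (at x0)" "c \<noteq> 0"
    and eq: "\<forall>\<^sub>F x in at x0. g (\<rho> x) = h x" and lim: "((\<lambda>x. h x / (x - x0) ^ r) \<longlongrightarrow> K) (at x0)"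
  shows "j < r \<Longrightarrow> (deriv ^^ j) g (\<rho> x0) = 0" "(deriv ^^ r) g (\<rho> x0) = fact r * (K / c ^ r)"
proof -
  have lim\<rho>: "((\<lambda>x. (\<rho> x - \<rho> x0) / (x - x0)) \<longlongrightarrow> c) (at x0)"
    using \<rho>(1) by (simp add: has_field_derivative_iff)
  have ev\<rho>: "\<forall>\<^sub>F x in at x0. \<rho> x \<noteq> \<rho> x0"
    using tendsto_imp_eventually_ne[OF lim\<rho> \<rho>(2)] by eventually_elim auto
  have \<rho>c: "(\<rho> \<longlongrightarrow> \<rho> x0) (at x0)"
    using DERIV_isCont[OF \<rho>(1)] by (simp add: isCont_def)
  have ne: "\<forall>\<^sub>F x in at x0. x \<noteq> x0" by (simp add: eventually_at_filter)
  from tendsto_divide[OF lim tendsto_power[OF lim\<rho>, of r]] \<rho>(2)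
  have "((\<lambda>x. h x / (x - x0) ^ r / ((\<rho> x - \<rho> x0) / (x - x0)) ^ r) \<longlongrightarrow> K / c ^ r) (at x0)" by simp
  then have "((\<lambda>x. g (\<rho> x) / (\<rho> x - \<rho> x0) ^ r) \<longlongrightarrow> K / c ^ r) (at x0)"
  proof (rule Lim_transform_eventually)
    show "\<forall>\<^sub>F x in at x0. h x / (x - x0) ^ r / ((\<rho> x - \<rho> x0) / (x - x0)) ^ r = g (\<rho> x) / (\<rho> x - \<rho> x0) ^ r"
      using eq ne ev\<rho> by eventually_elim (simp add: power_divide)
  qed
  note flat = higher_deriv_of_flat[OF N trivial_limit_at \<rho>c ev\<rho> this]
  show "j < r \<Longrightarrow> (deriv ^^ j) g (\<rho> x0) = 0" by (rule flat(1))
  show "(deriv ^^ r) g (\<rho> x0) = fact r * (K / c ^ r)" by (rule flat(2))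
qed

section \<open>Difference quotients with moving base points; smooth local inverses in the
  plane\<close>

text \<open>The base point runs along the graph of one test function and the step is the height of
  another above it. The mean value theorem on the segment inside a ball gives an intermediate point
  that converges to \<open>z0\<close> together with both ends.\<close>

lemma smooth_difference_quotient:
  fixes H :: "'a::euclidean_space \<Rightarrow> real" and F :: "'b filter"
  assumes "open W" "z0 \<in> W" "smooth_on W H" "(z \<longlongrightarrow> z0) F" "(h \<longlongrightarrow> 0) F" "\<forall>\<^sub>F s in F. h s \<noteq> 0"
  shows "((\<lambda>s. (H (z s + h s *\<^sub>R e) - H (z s)) / h s) \<longlongrightarrow> frechet_derivative H (at z0) e) F"
proof -
  obtain d where d: "d > 0" "ball z0 d \<subseteq> W" using assms(1,2) open_contains_ball by blast
  have "\<exists>y. dist (z s) y \<le> norm (h s *\<^sub>R e) \<and> H (z s + h s *\<^sub>R e) - H (z s) = h s * frechet_derivative H (at y) e"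
    if s: "z s \<in> ball z0 d" "z s + h s *\<^sub>R e \<in> ball z0 d" for s
  proof -
    have seg: "z s + t *\<^sub>R (h s *\<^sub>R e) \<in> ball z0 d" if "t \<in> {0..1}" for t
    proof -
      have "(1 - t) *\<^sub>R z s + t *\<^sub>R (z s + h s *\<^sub>R e) \<in> ball z0 d"
        using convexD_alt[OF convex_ball s] that by auto
      then show ?thesis by (simp add: algebra_simps)
    qed
    let ?f' = "\<lambda>t. frechet_derivative H (at (z s + t *\<^sub>R (h s *\<^sub>R e)))"
    have der: "((\<lambda>t. H (z s + t *\<^sub>R (h s *\<^sub>R e))) has_real_derivative h s * ?f' t e) (at t)"
      if "t \<in> {0..1}" for t
    proof -
      have H: "(H has_derivative ?f' t) (at (z s + t *\<^sub>R (h s *\<^sub>R e)))"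
        using smooth_on_has_derivative[OF assms(3)] seg[OF that] d by blast
      have "((\<lambda>t. z s + t *\<^sub>R (h s *\<^sub>R e)) has_derivative (\<lambda>v. v *\<^sub>R (h s *\<^sub>R e))) (at t)"
        by (auto intro!: derivative_eq_intros)
      from diff_chain_at[OF this H]
      have "((\<lambda>t. H (z s + t *\<^sub>R (h s *\<^sub>R e))) has_derivative (\<lambda>v. ?f' t (v *\<^sub>R (h s *\<^sub>R e)))) (at t)"
        by (simp add: o_def)
      moreover have "(\<lambda>v. ?f' t (v *\<^sub>R (h s *\<^sub>R e))) = (*) (h s * ?f' t e)"
        using has_derivative_linear[OF H] by (auto simp: linear_scale)
      ultimately show ?thesis by (simp add: has_field_derivative_def)
    qed
    obtain t where t: "0 < t" "t < 1"
      "H (z s + 1 *\<^sub>R (h s *\<^sub>R e)) - H (z s + 0 *\<^sub>R (h s *\<^sub>R e)) = (1 - 0) * (h s * ?f' t e)"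
      using MVT2[of 0 1 "\<lambda>t. H (z s + t *\<^sub>R (h s *\<^sub>R e))" "\<lambda>t. h s * ?f' t e"] der by auto
    have "dist (z s) (z s + t *\<^sub>R (h s *\<^sub>R e)) \<le> norm (h s *\<^sub>R e)"
      using t by (simp add: dist_norm abs_mult mult_right_mono mult_left_le_one_le)
    then show ?thesis using t by auto
  qed
  then obtain y where y: "\<And>s. z s \<in> ball z0 d \<Longrightarrow> z s + h s *\<^sub>R e \<in> ball z0 d \<Longrightarrow> dist (z s) (y s) \<le> norm (h s *\<^sub>R e)
      \<and> H (z s + h s *\<^sub>R e) - H (z s) = h s * frechet_derivative H (at (y s)) e"
    by metis
  have zh: "((\<lambda>s. z s + h s *\<^sub>R e) \<longlongrightarrow> z0) F"
    using tendsto_add[OF assms(4) tendsto_scaleR[OF assms(5) tendsto_const[of e]]] by simp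
  have ev: "\<forall>\<^sub>F s in F. z s \<in> ball z0 d \<and> z s + h s *\<^sub>R e \<in> ball z0 d"
    using topological_tendstoD[OF assms(4), of "ball z0 d"] topological_tendstoD[OF zh, of "ball z0 d"] d
    by (auto intro: eventually_conj)
  have "((\<lambda>s. y s - z s) \<longlongrightarrow> 0) F"
  proof (rule Lim_null_comparison)
    show "\<forall>\<^sub>F s in F. norm (y s - z s) \<le> norm (h s *\<^sub>R e)"
      using ev
    proof eventually_elim
      case (elim s)
      then show ?case using y[of s] by (simp only: dist_norm norm_minus_commute)
    qed
    show "((\<lambda>s. norm (h s *\<^sub>R e)) \<longlongrightarrow> 0) F"
      using tendsto_norm[OF tendsto_scaleR[OF assms(5) tendsto_const[of e]]] by simp
  qed
  from tendsto_add[OF this assms(4)] have "(y \<longlongrightarrow> z0) F" by simp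
  moreover have "isCont (\<lambda>x. frechet_derivative H (at x) e) z0"
    using smooth_on_continuous[OF smooth_on_frechet[OF assms(3)]] assms(1,2)
    by (simp add: continuous_on_eq_continuous_at)
  ultimately have "((\<lambda>s. frechet_derivative H (at (y s)) e) \<longlongrightarrow> frechet_derivative H (at z0) e) F"
    by (intro isCont_tendsto_compose[where g = "\<lambda>x. frechet_derivative H (at x) e"])
  then show ?thesis
  proof (rule Lim_transform_eventually)
    show "\<forall>\<^sub>F s in F. frechet_derivative H (at (y s)) e = (H (z s + h s *\<^sub>R e) - H (z s)) / h s"
      using ev assms(6)
    proof eventually_elim
      case (elim s)
      then show ?case using y[of s] by (simp add: field_simps)
    qed
  qed
qed

text \<open>The inverse function theorem supplies a differentiable inverse \<open>k\<close>;
  smoothness is bootstrapped. By Cramer's rule the derivative of \<open>k\<close> at y is built from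
  smooth functions evaluated at \<open>k y\<close>, so each order of differentiability of
  \<open>k\<close> yields the next.\<close>

lemma smooth_local_inverse:
  fixes g :: "real \<times> real \<Rightarrow> real \<times> real"
  assumes "open N" "p \<in> N" "smooth_on N g"
    and inj: "\<And>h. frechet_derivative g (at p) h = 0 \<Longrightarrow> h = 0"
  obtains U V k where "open U" "p \<in> U" "U \<subseteq> N" "open V" "g p \<in> V" "smooth_on V k"
    "k ` V = U" "\<And>y. y \<in> V \<Longrightarrow> g (k y) = y" "\<And>x. x \<in> U \<Longrightarrow> k (g x) = x"
proof -
  let ?D = "\<lambda>x. frechet_derivative g (at x)"
  define a where "a x = fst (?D x (1, 0))" for x
  define b where "b x = fst (?D x (0, 1))" for x
  define c where "c x = snd (?D x (1, 0))" for x
  define d where "d x = snd (?D x (0, 1))" for x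
  define \<Delta> where "\<Delta> x = a x * d x - b x * c x" for x
  have sm: "smooth_on N a" "smooth_on N b" "smooth_on N c" "smooth_on N d"
    unfolding a_def b_def c_def d_def
    by (rule smooth_on_bounded_linear[OF bounded_linear_fst assms(1) smooth_on_frechet[OF assms(3)]]
        smooth_on_bounded_linear[OF bounded_linear_snd assms(1) smooth_on_frechet[OF assms(3)]])+
  then have sm\<Delta>: "smooth_on N \<Delta>" unfolding \<Delta>_def by (intro smooth_intros assms(1))
  have D: "?D x = (\<lambda>h. (a x * fst h + b x * snd h, c x * fst h + d x * snd h))" if "x \<in> N" for x
  proof
    fix h
    have l: "linear (?D x)" using has_derivative_linear[OF smooth_on_has_derivative[OF assms(3) that]] .
    have "?D x h = ?D x (fst h *\<^sub>R (1, 0) + snd h *\<^sub>R (0, 1))" by simp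
    also have "\<dots> = fst h *\<^sub>R ?D x (1, 0) + snd h *\<^sub>R ?D x (0, 1)"
      using l by (simp only: linear_add linear_scale)
    finally show "?D x h = (a x * fst h + b x * snd h, c x * fst h + d x * snd h)"
      by (simp add: prod_eq_iff a_def b_def c_def d_def mult.commute)
  qed
  define N' where "N' = {x\<in>N. \<Delta> x \<noteq> 0}"
  have "open (N \<inter> \<Delta> -` (- {0}))"
    by (rule continuous_open_preimage[OF smooth_on_continuous[OF sm\<Delta>] assms(1)]) auto
  then have N': "open N'" by (simp add: N'_def vimage_def Int_def Compl_eq)
  have "\<Delta> p \<noteq> 0"
  proof
    assume 0: "\<Delta> p = 0"
    \<comment> \<open>If the determinant vanishes, the columns of the adjugate matrix lie in the
      kernel. Injectivity makes them zero, so the whole matrix is zero, which is absurd.\<close>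
    have "?D p (d p, - c p) = 0" "?D p (- b p, a p) = 0"
      using 0 by (simp_all add: D[OF assms(2)] \<Delta>_def zero_prod_def algebra_simps)
    then have "(d p, - c p) = 0" "(- b p, a p) = 0" using inj by blast+
    then have "?D p (1, 0) = 0" by (simp add: D[OF assms(2)] zero_prod_def)
    then show False using inj[of "(1, 0)"] by (simp add: zero_prod_def)
  qed
  then have p: "p \<in> N'" using assms(2) by (simp add: N'_def)
  \<comment> \<open>The inverse matrix by Cramer's rule.\<close>
  define I where "I x = (\<lambda>v. ((d x * fst v - b x * snd v) * inverse (\<Delta> x), (a x * snd v - c x * fst v) * inverse (\<Delta> x)))" for x
  have I: "I x (?D x v) = v" "?D x (I x v) = v" if "x \<in> N'" for x v
  proof -
    have "\<Delta> x \<noteq> 0" "x \<in> N" using that by (auto simp: N'_def)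
    then show "I x (?D x v) = v" "?D x (I x v) = v"
      unfolding D[OF \<open>x \<in> N\<close>] I_def by (simp_all add: prod_eq_iff field_simps) (simp_all add: \<Delta>_def algebra_simps)
  qed
  have bl: "bounded_linear (?D x)" if "x \<in> N'" for x
    using has_derivative_bounded_linear[OF smooth_on_has_derivative[OF assms(3)]] that by (auto simp: N'_def)
  have blI: "bounded_linear (I x)" for x
    unfolding I_def
    by (intro bounded_linear_Pair bounded_linear_mult_const bounded_linear_sub
        bounded_linear_const_mult bounded_linear_fst bounded_linear_snd)
  define f' where "f' x = Blinfun (?D x)" for x
  have f': "blinfun_apply (f' x) = ?D x" if "x \<in> N'" for x
    unfolding f'_def using bl[OF that] by (rule bounded_linear_Blinfun_apply)
  have 1: "(g has_derivative blinfun_apply (f' x)) (at x)" if "x \<in> N'" for x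
    using f'[OF that] smooth_on_has_derivative[OF assms(3)] that by (simp add: N'_def)
  have 2: "continuous_on N' f'"
  proof (rule continuous_on_blinfun_componentwise)
    fix i :: "real \<times> real"
    have "continuous_on N' (\<lambda>x. ?D x i)"
      by (rule continuous_on_subset[OF smooth_on_continuous[OF smooth_on_frechet[OF assms(3)]]])
        (simp add: N'_def)
    then show "continuous_on N' (\<lambda>x. blinfun_apply (f' x) i)"
      by (rule continuous_on_cong[THEN iffD1, rotated 2]) (auto simp: f')
  qed
  have 3: "Blinfun (I p) o\<^sub>L f' p = id_blinfun"
    by (rule blinfun_eqI) (simp add: bounded_linear_Blinfun_apply[OF blI] f'[OF p] I(1)[OF p])
  obtain U V k k' where UV: "open U" "U \<subseteq> N'" "p \<in> U" "open V" "g p \<in> V" "homeomorphism U V g k"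
    and k': "\<And>y. y \<in> V \<Longrightarrow> (k has_derivative (k' y)) (at y)"
    "\<And>y. y \<in> V \<Longrightarrow> k' y = inv (blinfun_apply (f' (k y)))"
    using inverse_function_theorem[OF N' 1 2 p 3] by metis
  have kV: "k ` V = U" "\<And>y. y \<in> V \<Longrightarrow> g (k y) = y" "\<And>x. x \<in> U \<Longrightarrow> k (g x) = x"
    using UV(6) by (auto simp: homeomorphism_def)
  have kN: "k y \<in> N'" if "y \<in> V" for y using kV(1) UV(2) that by blast
  have dk: "(k has_derivative I (k y)) (at y)" if "y \<in> V" for y
  proof -
    have "inv (?D (k y)) = I (k y)"
      by (rule inv_equality) (use I[OF kN[OF that]] in auto)
    then show ?thesis using k'[OF that] f'[OF kN[OF that]] by simp
  qed
  have "Ck_on n V k" for n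
  proof (induction n)
    case 0
    show ?case using UV(6) by (simp add: homeomorphism_def)
  next
    case (Suc n)
    have comp: "Ck_on n V (\<lambda>y. f (k y))" if "smooth_on N f" for f :: "real \<times> real \<Rightarrow> real"
      by (rule Ck_on_compose[OF UV(4) _ smooth_onD[OF that] Suc]) (use kV(1) UV(2) in \<open>auto simp: N'_def\<close>)
    have nz: "\<Delta> (k y) \<noteq> 0" if "y \<in> V" for y using kN[OF that] by (simp add: N'_def)
    show ?case
    proof (rule Ck_on_SucI[OF UV(4) dk])
      fix v
      have lin: "Ck_on n V (\<lambda>y. (f (k y) * s - h (k y) * t) * inverse (\<Delta> (k y)))"
        if "smooth_on N f" "smooth_on N h" for f h :: "real \<times> real \<Rightarrow> real" and s t
      proof -
        have "smooth_on N (\<lambda>x. f x * s - h x * t)" using that by (intro smooth_intros assms(1))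
        from Ck_on_bilinear[OF bounded_bilinear_mult UV(4) comp[OF this] Ck_on_inverse[OF UV(4) comp[OF sm\<Delta>] nz]]
        show ?thesis .
      qed
      show "Ck_on n V (\<lambda>y. I (k y) v)"
        unfolding I_def by (rule Ck_on_Pair[OF UV(4) lin lin]) (rule sm)+
    qed
  qed
  then have "smooth_on V k" by (simp add: smooth_on_def)
  with UV kV show thesis by (intro that[of U V k]) (auto simp: N'_def)
qed

subsection \<open>Point transformations and jets\<close>

definition dt :: "(txu \<Rightarrow> real) \<Rightarrow> txu \<Rightarrow> real" where
  "dt f z = frechet_derivative f (at z) (1, 0, 0)"

definition dx :: "(txu \<Rightarrow> real) \<Rightarrow> txu \<Rightarrow> real" where
  "dx f z = frechet_derivative f (at z) (0, 1, 0)"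

definition du :: "(txu \<Rightarrow> real) \<Rightarrow> txu \<Rightarrow> real" where
  "du f z = frechet_derivative f (at z) (0, 0, 1)"

abbreviation differential :: "(txu \<Rightarrow> real) \<Rightarrow> txu \<Rightarrow> txu \<Rightarrow> real" where
  "differential f z h \<equiv> fst h * dt f z + fst (snd h) * dx f z + snd (snd h) * du f z"

lemma has_derivative_partials:
  assumes "smooth_on S f" "z \<in> S"
  shows "(f has_derivative (differential f z)) (at z)"
proof -
  let ?D = "frechet_derivative f (at z)"
  have d: "(f has_derivative ?D) (at z)" using smooth_on_has_derivative[OF assms] .
  have "?D h = fst h * dt f z + fst (snd h) * dx f z + snd (snd h) * du f z" for h
  proof -
    have "?D h = ?D (fst h *\<^sub>R (1, 0, 0) + fst (snd h) *\<^sub>R (0, 1, 0) + snd (snd h) *\<^sub>R (0, 0, 1))"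
      by simp
    also have "\<dots> = fst h *\<^sub>R dt f z + fst (snd h) *\<^sub>R dx f z + snd (snd h) *\<^sub>R du f z"
      unfolding dt_def dx_def du_def using has_derivative_linear[OF d]
      by (simp only: linear_add linear_scale)
    finally show ?thesis by simp
  qed
  then have "?D = (differential f z)" by blast
  with d show ?thesis by simp
qed

lemma smooth_on_partials:
  assumes "smooth_on S f"
  shows "smooth_on S (dt f)" "smooth_on S (dx f)" "smooth_on S (du f)"
  using smooth_on_frechet[OF assms] by (simp_all add: dt_def[abs_def] dx_def[abs_def] du_def[abs_def])

lemma partials_eqI:
  assumes "(f has_derivative f') (at z)"
  shows "dt f z = f' (1, 0, 0)" "dx f z = f' (0, 1, 0)" "du f z = f' (0, 0, 1)"
  using frechet_derivative_at[OF assms] by (simp_all add: dt_def dx_def du_def)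

lemma has_derivative_plane:
  fixes f :: "real \<times> real \<Rightarrow> real"
  assumes "smooth_on S f" "p \<in> S"
  shows "(f has_derivative (\<lambda>h. fst h * frechet_derivative f (at p) (1, 0) +
    snd h * frechet_derivative f (at p) (0, 1))) (at p)"
proof -
  let ?D = "frechet_derivative f (at p)"
  have d: "(f has_derivative ?D) (at p)" using smooth_on_has_derivative[OF assms] .
  have "?D h = fst h * ?D (1, 0) + snd h * ?D (0, 1)" for h
  proof -
    have "?D h = ?D (fst h *\<^sub>R (1, 0) + snd h *\<^sub>R (0, 1))" by simp
    also have "\<dots> = fst h *\<^sub>R ?D (1, 0) + snd h *\<^sub>R ?D (0, 1)"
      using has_derivative_linear[OF d] by (simp only: linear_add linear_scale)
    finally show ?thesis by simp
  qed
  then have "?D = (\<lambda>h. fst h * ?D (1, 0) + snd h * ?D (0, 1))" by blast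
  with d show ?thesis by metis
qed

lemma smooth_on_slice:
  fixes v :: "real \<times> real \<Rightarrow> real"
  assumes "open N" "smooth_on N v"
  shows "open {y. (c, y) \<in> N}" "smooth_on {y. (c, y) \<in> N} (\<lambda>y. v (c, y))"
proof -
  have "open ((\<lambda>y. (c, y)) -` N)"
    by (rule open_vimage[OF assms(1)]) (intro continuous_intros)
  then show o: "open {y. (c, y) \<in> N}" by (simp add: vimage_def)
  show "smooth_on {y. (c, y) \<in> N} (\<lambda>y. v (c, y))"
    by (rule smooth_on_compose[OF o _ assms(2)]) (auto intro: smooth_intros o)
qed

text \<open>The equations are stated with ordinary derivatives of slices, the chain rule produces
  directional derivatives of the function on the plane; this connects the two.\<close>

lemma deriv_slices:
  fixes v :: "real \<times> real \<Rightarrow> real"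
  assumes "smooth_on N v" "(a, b) \<in> N"
  shows "deriv (\<lambda>s. v (s, b)) a = frechet_derivative v (at (a, b)) (1, 0)"
    "deriv (\<lambda>y. v (a, y)) b = frechet_derivative v (at (a, b)) (0, 1)"
proof -
  note d = has_derivative_plane[OF assms]
  have "((\<lambda>s. (s, b)) has_derivative (\<lambda>h. (h, 0))) (at a)" by (auto intro!: derivative_eq_intros)
  from has_derivative_compose[OF this d]
  show "deriv (\<lambda>s. v (s, b)) a = frechet_derivative v (at (a, b)) (1, 0)"
    by (intro DERIV_imp_deriv) (simp add: has_field_derivative_def mult.commute[of _ "frechet_derivative _ _ _"])
  have "((\<lambda>s. (a, s)) has_derivative (\<lambda>h. (0, h))) (at b)" by (auto intro!: derivative_eq_intros)
  from has_derivative_compose[OF this d]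
  show "deriv (\<lambda>y. v (a, y)) b = frechet_derivative v (at (a, b)) (0, 1)"
    by (intro DERIV_imp_deriv) (simp add: has_field_derivative_def mult.commute[of _ "frechet_derivative _ _ _"])
qed

section \<open>Nondegenerate maps and the images of graphs\<close>

text \<open>Purely local data, so that the same analysis serves the members of the groupoid and the
  (t, x, u)-part of an equivalence transformation. For the latter, nondegeneracy is inherited from
  the diffeomorphism of the joint space.\<close>

locale point_map =
  fixes D :: "txu set" and \<phi> :: "txu \<Rightarrow> txu"
  assumes domain: "domain_txu D" and smooth: "smooth_on D \<phi>"
    and nondegenerate: "\<And>z h. z \<in> D \<Longrightarrow> frechet_derivative \<phi> (at z) h = 0 \<Longrightarrow> h = 0"
begin

definition T :: "txu \<Rightarrow> real" where "T z = fst (\<phi> z)"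
definition X :: "txu \<Rightarrow> real" where "X z = fst (snd (\<phi> z))"
definition U :: "txu \<Rightarrow> real" where "U z = snd (snd (\<phi> z))"

lemma open_D: "open D"
  using domain by (simp add: domain_txu_def)

lemma \<phi>_eq: "\<phi> z = (T z, X z, U z)"
  by (simp add: T_def X_def U_def)

lemma smooth_components: "smooth_on D T" "smooth_on D X" "smooth_on D U"
  unfolding T_def[abs_def] X_def[abs_def] U_def[abs_def]
  by (intro smooth_on_bounded_linear[OF _ open_D smooth] bounded_linear_fst bounded_linear_fst_comp
      bounded_linear_snd_comp bounded_linear_snd)+

lemmas derivatives = has_derivative_partials[OF smooth_components(1)]
  has_derivative_partials[OF smooth_components(2)] has_derivative_partials[OF smooth_components(3)]

text \<open>An injective linear map of the three-dimensional space is onto. Working with preimages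
  replaces 3 by 3 determinants throughout.\<close>

lemma ex_preimage:
  assumes "z \<in> D"
  obtains a b c where "a * dt T z + b * dx T z + c * du T z = \<alpha>"
    "a * dt X z + b * dx X z + c * du X z = \<beta>" "a * dt U z + b * dx U z + c * du U z = \<gamma>"
proof -
  let ?L = "frechet_derivative \<phi> (at z)"
  have L: "(\<phi> has_derivative ?L) (at z)" using smooth_on_has_derivative[OF smooth assms] .
  have "((\<lambda>z. (T z, X z, U z)) has_derivative
    (\<lambda>h. (differential T z h,
          differential X z h,
          differential U z h))) (at z)"
    by (intro has_derivative_Pair derivatives assms)
  moreover have "(\<lambda>z. (T z, X z, U z)) = \<phi>" using \<phi>_eq by auto
  ultimately have eq: "?L = (\<lambda>h. (differential T z h,
          differential X z h,
          differential U z h))"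
    using has_derivative_unique[OF L] by simp
  have lin: "linear ?L" using has_derivative_linear[OF L] .
  have "surj ?L"
    by (rule linear_inj_imp_surj[OF lin]) (use nondegenerate[OF assms] lin in \<open>simp add: linear_injective_0\<close>)
  then obtain h where "?L h = (\<alpha>, \<beta>, \<gamma>)" by (metis surjD)
  with eq that[of "fst h" "fst (snd h)" "snd (snd h)"] show thesis by simp
qed

text \<open>A relation between the rows of the Jacobian matrix annihilates the range of the
  differential, which is the whole space; preimages of the unit vectors then give the three
  coefficients.\<close>

lemma rows_independent:
  assumes "z \<in> D" "\<alpha> * dt T z + \<beta> * dt X z + \<gamma> * dt U z = 0" "\<alpha> * dx T z + \<beta> * dx X z + \<gamma> * dx U z = 0"
    "\<alpha> * du T z + \<beta> * du X z + \<gamma> * du U z = 0"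
  shows "\<alpha> = 0" "\<beta> = 0" "\<gamma> = 0"
proof -
  have *: "\<alpha> * p + \<beta> * q + \<gamma> * r = 0" for p q r
  proof -
    obtain a b c where e: "a * dt T z + b * dx T z + c * du T z = p"
      "a * dt X z + b * dx X z + c * du X z = q" "a * dt U z + b * dx U z + c * du U z = r"
      using ex_preimage[OF assms(1)] by blast
    have "\<alpha> * p + \<beta> * q + \<gamma> * r = a * (\<alpha> * dt T z + \<beta> * dt X z + \<gamma> * dt U z)
      + b * (\<alpha> * dx T z + \<beta> * dx X z + \<gamma> * dx U z) + c * (\<alpha> * du T z + \<beta> * du X z + \<gamma> * du U z)"
      unfolding e[symmetric] by (simp add: algebra_simps)
    then show ?thesis using assms by simp
  qed
  show "\<alpha> = 0" "\<beta> = 0" "\<gamma> = 0" using *[of 1 0 0] *[of 0 1 0] *[of 0 0 1] by auto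
qed

text \<open>The determinant of the derivative of \<open>(t, x) \<mapsto> (T, X)(t, x, u(t, x))\<close>, where \<open>s = u\<^sub>x\<close> and \<open>\<tau> = u\<^sub>t\<close>.\<close>

definition jac :: "txu \<Rightarrow> real \<Rightarrow> real \<Rightarrow> real" where
  "jac z s \<tau> = (dt T z + du T z * \<tau>) * (dx X z + du X z * s) - (dx T z + du T z * s) * (dt X z + du X z * \<tau>)"

text \<open>In \<open>jac\<close> the products of \<open>s\<close> and \<open>\<tau>\<close> cancel,
  which leaves an affine function whose coefficients A, B, C are, up to sign, the minors of the rows
  of \<open>T\<close> and \<open>X\<close>. These rows are independent, so some minor is nonzero,
  and an affine function vanishing at (0, 0), (1, 0) and (0, 1) would be zero.\<close>

lemma jac_nonzero:
  assumes "z \<in> D"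
  obtains s \<tau> where "jac z s \<tau> \<noteq> 0"
proof -
  define A where "A = dt T z * dx X z - dx T z * dt X z"
  define B where "B = dt T z * du X z - du T z * dt X z"
  define C where "C = du T z * dx X z - dx T z * du X z"
  have jac: "jac z s \<tau> = A + B * s + C * \<tau>" for s \<tau>
    by (simp add: jac_def A_def B_def C_def algebra_simps)
  obtain a b c where 1: "a * dt T z + b * dx T z + c * du T z = 1" "a * dt X z + b * dx X z + c * du X z = 0"
    using ex_preimage[OF assms] by blast
  obtain a' b' c' where 2: "a' * dt T z + b' * dx T z + c' * du T z = 0" "a' * dt X z + b' * dx X z + c' * du X z = 1"
    using ex_preimage[OF assms] by blast
  \<comment> \<open>The Cauchy-Binet formula for the two rows and two columns whose product is the
    identity matrix.\<close>
  have "A * (a * b' - b * a') + B * (a * c' - c * a') - C * (b * c' - c * b') =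
    (a * dt T z + b * dx T z + c * du T z) * (a' * dt X z + b' * dx X z + c' * du X z)
    - (a * dt X z + b * dx X z + c * du X z) * (a' * dt T z + b' * dx T z + c' * du T z)"
    by (simp add: A_def B_def C_def algebra_simps)
  then have "A \<noteq> 0 \<or> B \<noteq> 0 \<or> C \<noteq> 0" using 1 2 by auto
  then have "jac z 0 0 \<noteq> 0 \<or> jac z 1 0 \<noteq> 0 \<or> jac z 0 1 \<noteq> 0"
    by (auto simp: jac)
  then show thesis using that by blast
qed

lemma jac_affine: "jac z (s + m) \<tau> - jac z s \<tau> = m * (jac z 1 0 - jac z 0 0)"
  by (simp add: jac_def algebra_simps)

lemma graph_derivative:
  assumes "(u has_derivative (\<lambda>h. fst h * \<tau> + snd h * s)) (at p)" "smooth_on D f" "(fst p, snd p, u p) \<in> D"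
  shows "((\<lambda>w. f (fst w, snd w, u w)) has_derivative
    (\<lambda>h. fst h * (dt f (fst p, snd p, u p) + du f (fst p, snd p, u p) * \<tau>)
       + snd h * (dx f (fst p, snd p, u p) + du f (fst p, snd p, u p) * s))) (at p)"
proof -
  have "((\<lambda>w. (fst w, snd w, u w)) has_derivative (\<lambda>h. (fst h, snd h, fst h * \<tau> + snd h * s))) (at p)"
    by (intro has_derivative_Pair assms(1)) (auto intro!: derivative_eq_intros)
  from has_derivative_compose[OF this has_derivative_partials[OF assms(2,3)]]
  show ?thesis by (simp add: algebra_simps)
qed

text \<open>The image function is \<open>U\<close> along the graph, composed with the local inverse
  \<open>k\<close> of the plane map (t, x) to (T, X); \<open>jac\<close> is the determinant of that
  map. The value recorded for \<open>k'\<close> is the rate at which the old t changes when the new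
  x moves with the new t held fixed.\<close>

lemma image_graph:
  assumes "open N" "p \<in> N" "smooth_on N u" "z = (fst p, snd p, u p)" "z \<in> D"
    and u': "(u has_derivative (\<lambda>h. fst h * \<tau> + snd h * s)) (at p)" and jac: "jac z s \<tau> \<noteq> 0"
  obtains v k k' where "maps_graph D \<phi> u p v (T z, X z)" "k (T z, X z) = p"
    "(k has_derivative k') (at (T z, X z))" "fst (k' (0, 1)) = - (dx T z + du T z * s) / jac z s \<tau>"
    "\<forall>\<^sub>F y in nhds (T z, X z). (fst (k y), snd (k y), u (k y)) \<in> D \<and> \<phi> (fst (k y), snd (k y), u (k y)) = (fst y, snd y, v y)"
proof -
  let ?J = "\<lambda>w. (fst w, snd w, u w)"
  define N0 where "N0 = N \<inter> ?J -` D"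
  have smJ: "smooth_on N ?J" using assms(1,3) by (intro smooth_intros)
  have N0: "open N0" unfolding N0_def
    by (rule continuous_open_preimage[OF smooth_on_continuous[OF smJ] assms(1) open_D])
  have p: "p \<in> N0" using assms(2,4,5) by (simp add: N0_def)
  have comp: "smooth_on N0 (\<lambda>w. f (?J w))" if "smooth_on D f" for f :: "txu \<Rightarrow> real"
    by (rule smooth_on_compose[OF N0 _ that smooth_on_subset[OF smJ]]) (auto simp: N0_def)
  let ?g = "\<lambda>w. (T (?J w), X (?J w))"
  have smg: "smooth_on N0 ?g" by (intro smooth_on_Pair N0 comp smooth_components)
  define A B C E where "A = dt T z + du T z * \<tau>" and "B = dx T z + du T z * s"
    and "C = dt X z + du X z * \<tau>" and "E = dx X z + du X z * s"
  have jac': "jac z s \<tau> = A * E - B * C" by (simp add: jac_def A_def B_def C_def E_def)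
  have g': "(?g has_derivative (\<lambda>h. (fst h * A + snd h * B, fst h * C + snd h * E))) (at p)"
    unfolding A_def B_def C_def E_def assms(4)
    by (intro has_derivative_Pair graph_derivative u' smooth_components) (use assms(4,5) in auto)
  have inj: "h = 0" if "frechet_derivative ?g (at p) h = 0" for h
  proof -
    have e: "fst h * A + snd h * B = 0" "fst h * C + snd h * E = 0"
      using that frechet_derivative_at[OF g'] by (auto simp: prod_eq_iff dest!: fun_cong[of _ _ h])
    have "fst h * (A * E - B * C) = E * (fst h * A + snd h * B) - B * (fst h * C + snd h * E)"
      "snd h * (A * E - B * C) = A * (fst h * C + snd h * E) - C * (fst h * A + snd h * B)"
      by (simp_all add: algebra_simps)
    then show ?thesis using jac unfolding e jac' by (simp add: prod_eq_iff)
  qed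
  obtain O' V k where k: "open O'" "p \<in> O'" "O' \<subseteq> N0" "open V" "?g p \<in> V" "smooth_on V k"
    "k ` V = O'" "\<And>y. y \<in> V \<Longrightarrow> ?g (k y) = y" "\<And>x. x \<in> O' \<Longrightarrow> k (?g x) = x"
  proof (rule smooth_local_inverse[OF N0 p smg])
    show "frechet_derivative ?g (at p) h = 0 \<Longrightarrow> h = 0" for h by (rule inj)
  next
    fix O' V k
    assume "open O'" "p \<in> O'" "O' \<subseteq> N0" "open V" "?g p \<in> V" "smooth_on V k"
      "k ` V = O'" "\<And>y. y \<in> V \<Longrightarrow> ?g (k y) = y" "\<And>x. x \<in> O' \<Longrightarrow> k (?g x) = x"
    then show thesis by (rule that)
  qed
  define v where "v y = U (?J (k y))" for y
  have q: "?g p = (T z, X z)" using assms(4) by simp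
  have kq: "k (T z, X z) = p" using k(9)[OF k(2)] q by simp
  have kN0: "k y \<in> N0" if "y \<in> V" for y using k(3,7) that by blast
  have smv: "smooth_on V v" unfolding v_def
    by (rule smooth_on_compose[OF k(4) _ comp[OF smooth_components(3)] k(6)]) (use kN0 in auto)
  have \<phi>k: "?J (k y) \<in> D \<and> \<phi> (?J (k y)) = (fst y, snd y, v y)" if "y \<in> V" for y
    using kN0[OF that] k(8)[OF that] by (auto simp: N0_def \<phi>_eq v_def prod_eq_iff)
  have "maps_graph D \<phi> u p v (T z, X z)"
    unfolding maps_graph_def
  proof (intro conjI)
    show "smooth_near p u" unfolding smooth_near_def using assms(1,2,3) by blast
    show "smooth_near (T z, X z) v" unfolding smooth_near_def using k(4,5) q smv by auto
    show "(fst p, snd p, u p) \<in> D" using assms by simp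
    show "\<phi> (fst p, snd p, u p) = (fst (T z, X z), snd (T z, X z), v (T z, X z))"
      using \<phi>k[OF k(5)] kq q by simp
    have "\<forall>\<^sub>F w in nhds p. w \<in> O'" using eventually_nhds_in_open[OF k(1,2)] .
    then show "\<forall>\<^sub>F (t, x) in nhds p. case \<phi> (t, x, u (t, x)) of (t', x', u') \<Rightarrow> u' = v (t', x')"
    proof eventually_elim
      case (elim w)
      then show ?case using k(9)[OF elim] by (cases w) (simp add: \<phi>_eq v_def)
    qed
  qed
  moreover
  let ?k' = "frechet_derivative k (at (T z, X z))"
  have qV: "(T z, X z) \<in> V" using k(5) q by simp
  have dk: "(k has_derivative ?k') (at (T z, X z))" using smooth_on_has_derivative[OF k(6) qV] .
  have "((\<lambda>y. ?g (k y)) has_derivative (\<lambda>h. (fst (?k' h) * A + snd (?k' h) * B, fst (?k' h) * C + snd (?k' h) * E))) (at (T z, X z))"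
    using has_derivative_compose[OF dk, of ?g] g' kq by simp
  then have "((\<lambda>y. y) has_derivative (\<lambda>h. (fst (?k' h) * A + snd (?k' h) * B, fst (?k' h) * C + snd (?k' h) * E))) (at (T z, X z))"
    by (rule has_derivative_transform_within_open[OF _ k(4) qV]) (rule k(8))
  then have "(\<lambda>h. (fst (?k' h) * A + snd (?k' h) * B, fst (?k' h) * C + snd (?k' h) * E)) = (\<lambda>h. h)"
    using has_derivative_unique[OF _ has_derivative_ident] by blast
  \<comment> \<open>The derivative of the plane map times that of \<open>k\<close> is the identity;
    its second column is solved for the t-component by Cramer's rule.\<close>
  from fun_cong[OF this, of "(0, 1)"]
  have e: "fst (?k' (0, 1)) * A + snd (?k' (0, 1)) * B = 0" "fst (?k' (0, 1)) * C + snd (?k' (0, 1)) * E = 1"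
    by auto
  have "fst (?k' (0, 1)) * (A * E - B * C) = E * (fst (?k' (0, 1)) * A + snd (?k' (0, 1)) * B) - B * (fst (?k' (0, 1)) * C + snd (?k' (0, 1)) * E)"
    by (simp add: algebra_simps)
  then have "fst (?k' (0, 1)) * (A * E - B * C) = - B" unfolding e by simp
  then have "fst (?k' (0, 1)) = - (dx T z + du T z * s) / jac z s \<tau>"
    using jac unfolding jac' by (simp add: B_def field_simps)
  moreover have "\<forall>\<^sub>F y in nhds (T z, X z). ?J (k y) \<in> D \<and> \<phi> (?J (k y)) = (fst y, snd y, v y)"
    using eventually_nhds_in_open[OF k(4) qV] by eventually_elim (rule \<phi>k)
  ultimately show thesis using that kq dk by blast
qed

text \<open>Differentiating v(T, X) = U along the graph of \<open>u\<close> in t and in x gives the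
  first prolongation as a linear system for the two derivatives of v.\<close>

lemma graph_jet:
  assumes "maps_graph D \<phi> u p v q" "z = (fst p, snd p, u p)"
    and u': "(u has_derivative (\<lambda>h. fst h * \<tau> + snd h * s)) (at p)"
  defines "v\<^sub>t \<equiv> frechet_derivative v (at q) (1, 0)" and "v\<^sub>x \<equiv> frechet_derivative v (at q) (0, 1)"
  shows "z \<in> D" "q = (T z, X z)" "v q = U z"
    "\<forall>\<^sub>F w in nhds p. v (T (fst w, snd w, u w), X (fst w, snd w, u w)) = U (fst w, snd w, u w)"
    "(dt T z + du T z * \<tau>) * v\<^sub>t + (dt X z + du X z * \<tau>) * v\<^sub>x = dt U z + du U z * \<tau>"
    "(dx T z + du T z * s) * v\<^sub>t + (dx X z + du X z * s) * v\<^sub>x = dx U z + du U z * s"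
proof -
  let ?J = "\<lambda>w. (fst w, snd w, u w)"
  note mg = assms(1)[unfolded maps_graph_def]
  show zD: "z \<in> D" and q: "q = (T z, X z)" "v q = U z"
    using mg \<phi>_eq[of z] by (simp_all add: assms(2) prod_eq_iff)
  have "\<forall>\<^sub>F (t, x) in nhds p. case \<phi> (t, x, u (t, x)) of (t', x', u') \<Rightarrow> u' = v (t', x')"
    using mg by blast
  then show ev: "\<forall>\<^sub>F w in nhds p. v (T (?J w), X (?J w)) = U (?J w)"
    by eventually_elim (auto simp: \<phi>_eq)
  obtain V where V: "open V" "q \<in> V" "smooth_on V v" using mg by (auto simp: smooth_near_def)
  note dv = has_derivative_plane[OF V(3,2)]
  have g': "((\<lambda>w. (T (?J w), X (?J w))) has_derivative (\<lambda>h. (fst h * (dt T z + du T z * \<tau>) + snd h * (dx T z + du T z * s),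
     fst h * (dt X z + du X z * \<tau>) + snd h * (dx X z + du X z * s)))) (at p)"
    unfolding assms(2) using zD assms(2) by (intro has_derivative_Pair graph_derivative u' smooth_components) auto
  have dv': "(v has_derivative (\<lambda>h. fst h * v\<^sub>t + snd h * v\<^sub>x)) (at (T (?J p), X (?J p)))"
    using dv q(1) assms(2) by (simp add: v\<^sub>t_def v\<^sub>x_def)
  have 1: "((\<lambda>w. v (T (?J w), X (?J w))) has_derivative (\<lambda>h.
      (fst h * (dt T z + du T z * \<tau>) + snd h * (dx T z + du T z * s)) * v\<^sub>t +
      (fst h * (dt X z + du X z * \<tau>) + snd h * (dx X z + du X z * s)) * v\<^sub>x)) (at p)"
    using has_derivative_compose[OF g' dv'] by simp
  have 2: "((\<lambda>w. U (?J w)) has_derivative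
     (\<lambda>h. fst h * (dt U z + du U z * \<tau>) + snd h * (dx U z + du U z * s))) (at p)"
    using graph_derivative[OF u' smooth_components(3)] zD assms(2) by simp
  have "((\<lambda>w. U (?J w)) has_derivative (\<lambda>h.
      (fst h * (dt T z + du T z * \<tau>) + snd h * (dx T z + du T z * s)) * v\<^sub>t +
      (fst h * (dt X z + du X z * \<tau>) + snd h * (dx X z + du X z * s)) * v\<^sub>x)) (at p)"
    by (rule has_derivative_transform_eventually[OF 1 eventually_at_filter[THEN iffD2, OF eventually_mono[OF ev]]])
      (use eventually_nhds_x_imp_x[OF ev] in auto)
  from has_derivative_unique[OF this 2]
  have eq: "(\<lambda>h. (fst h * (dt T z + du T z * \<tau>) + snd h * (dx T z + du T z * s)) * v\<^sub>t +
      (fst h * (dt X z + du X z * \<tau>) + snd h * (dx X z + du X z * s)) * v\<^sub>x)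
    = (\<lambda>h. fst h * (dt U z + du U z * \<tau>) + snd h * (dx U z + du U z * s))" .
  from fun_cong[OF eq, of "(1, 0)"] fun_cong[OF eq, of "(0, 1)"]
  show "(dt T z + du T z * \<tau>) * v\<^sub>t + (dt X z + du X z * \<tau>) * v\<^sub>x = dt U z + du U z * \<tau>"
    "(dx T z + du T z * s) * v\<^sub>t + (dx X z + du X z * s) * v\<^sub>x = dx U z + du U z * s"
    by (simp_all add: mult.commute)
qed

end

subsection \<open>The equations of the class\<close>

definition linear_part :: "('n::finite \<Rightarrow> nat) \<Rightarrow> real ^ 'n \<Rightarrow> (real \<Rightarrow> real) \<Rightarrow> real \<Rightarrow> real" where
  "linear_part idx a f x = (\<Sum>i\<in>UNIV. a $ i * x ^ idx i * (deriv ^^ idx i) f x)"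

text \<open>The right-hand side after solving for u_t. It sees only the section at a fixed t, so any
  section becomes part of a jet on the equation once u_t is given this value.\<close>

definition evolution :: "('n::finite \<Rightarrow> nat) \<Rightarrow> 'n arb \<Rightarrow> (real \<Rightarrow> real) \<Rightarrow> real \<Rightarrow> real" where
  "evolution idx = (\<lambda>(a, a00, b0) f x. linear_part idx a f x + a00 * f x + b0 * x - f x * deriv f x)"

lemma F_II0_iff:
  "F_II0 idx \<theta> u (t, x) \<longleftrightarrow> deriv (\<lambda>s. u (s, x)) t = evolution idx \<theta> (\<lambda>y. u (t, y)) x"
  by (auto simp: F_II0_def evolution_def linear_part_def split: prod.splits)

lemma linear_part_add_cmult:
  assumes "open S" "smooth_on S f" "smooth_on S g" "x \<in> S"
  shows "linear_part idx a (\<lambda>x. f x + c * g x) x = linear_part idx a f x + c * linear_part idx a g x"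
  unfolding linear_part_def higher_deriv_add_cmult[OF assms]
  by (simp add: sum.distrib sum_distrib_left algebra_simps)

locale leading_index =
  fixes r :: nat and idx :: "'n::finite \<Rightarrow> nat" and k :: 'n
  assumes r: "r \<ge> 2" and idx: "bij_betw idx UNIV {2..r}" and k: "idx k = r"
begin

lemma idx_bounds: "2 \<le> idx i" "idx i \<le> r"
  using bij_betwE[OF idx] by auto

lemma idx_less: "i \<noteq> k \<Longrightarrow> idx i < r"
  using idx_bounds(2)[of i] k bij_betw_imp_inj_on[OF idx] by (metis UNIV_I inj_on_def le_neq_implies_less)

text \<open>Only orders 2 to r enter the linear part, so no condition on the value and the slope is
  required.\<close>

lemma linear_part_flat:
  assumes "\<And>j. 2 \<le> j \<Longrightarrow> j < r \<Longrightarrow> (deriv ^^ j) f x = 0"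
  shows "linear_part idx a f x = a $ k * x ^ r * (deriv ^^ r) f x"
proof -
  have "(\<Sum>i\<in>UNIV. a $ i * x ^ idx i * (deriv ^^ idx i) f x)
    = (\<Sum>i\<in>{k}. a $ i * x ^ idx i * (deriv ^^ idx i) f x)"
    by (rule sum.mono_neutral_right) (use idx_bounds idx_less assms in auto)
  then show ?thesis by (simp add: linear_part_def k)
qed

section \<open>Test functions with prescribed jets\<close>

text \<open>Value and slope at \<open>x0\<close> are free, \<open>m\<close> sits one order below the
  leading term and \<open>n\<close> on it. For r = 2 the \<open>m\<close>-term is itself linear and
  adds to the slope, which is the origin of \<open>of_bool (r = 2)\<close> in what follows.\<close>

definition test_poly :: "real \<Rightarrow> real \<Rightarrow> real \<Rightarrow> real \<Rightarrow> real \<Rightarrow> real \<Rightarrow> real" where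
  "test_poly x0 u0 s m n = (\<lambda>x. u0 + s * (x - x0) + m * (x - x0) ^ (r - 1) + n * (x - x0) ^ r)"

lemma smooth_test_poly: "smooth_on S (test_poly x0 u0 s m n)"
proof (rule smooth_on_subset)
  show "smooth_on UNIV (test_poly x0 u0 s m n)"
    unfolding test_poly_def by (intro smooth_intros open_UNIV)
qed simp

lemma test_poly_at [simp]: "test_poly x0 u0 s m n x0 = u0"
  using r by (simp add: test_poly_def power_0_left)

lemma test_poly_has_derivative:
  "(test_poly x0 u0 s m n has_real_derivative s + m * of_bool (r = 2)) (at x0)"
proof -
  have "(test_poly x0 u0 s m n has_real_derivative
      s + m * (of_nat (r - 1) * (x0 - x0) ^ (r - 1 - 1)) + n * (of_nat r * (x0 - x0) ^ (r - 1))) (at x0)"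
    unfolding test_poly_def by (rule derivative_eq_intros refl)+ simp
  moreover have "r - Suc 0 - Suc 0 = 0 \<longleftrightarrow> r = 2" "r - 1 \<noteq> 0" using r by auto
  ultimately show ?thesis by (auto simp: power_0_left split: if_splits)
qed

lemma deriv_test_poly [simp]: "deriv (test_poly x0 u0 s m n) x0 = s + m * of_bool (r = 2)"
  by (rule DERIV_imp_deriv[OF test_poly_has_derivative])

text \<open>The linear part of the power r - 1 is left unevaluated: it involves a_{r-1}, for which
  there is no slot when r = 2, and as a multiple of \<open>m\<close> it cancels from the mixed
  differences.\<close>

lemma linear_part_test_poly:
  "linear_part idx a (test_poly x0 u0 s m n) x0
    = m * linear_part idx a (\<lambda>x. (x - x0) ^ (r - 1)) x0 + n * (a $ k * x0 ^ r * fact r)"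
proof -
  have sm: "smooth_on UNIV (\<lambda>x::real. (x - x0) ^ j)" for j by (intro smooth_intros open_UNIV)
  have sm': "smooth_on UNIV (\<lambda>x. u0 + s * (x - x0))"
    "smooth_on UNIV (\<lambda>x. u0 + s * (x - x0) + m * (x - x0) ^ (r - 1))"
    by (intro smooth_intros open_UNIV)+
  have low: "linear_part idx a (\<lambda>x. (x - x0) ^ j) x0 = 0" if "j < 2" for j
    unfolding linear_part_def higher_deriv_monomial_at
  proof (intro sum.neutral ballI)
    show "a $ i * x0 ^ idx i * (if idx i = j then fact j else 0) = 0" for i
      using idx_bounds(1)[of i] that by auto
  qed
  have const: "linear_part idx a (\<lambda>x. u0) x0 = 0"
    using linear_part_add_cmult[OF open_UNIV sm[of 0] sm[of 0] UNIV_I, of idx a "u0 - 1" x0] low[of 0] by simp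
  have aff: "linear_part idx a (\<lambda>x. u0 + s * (x - x0)) x0 = 0"
    using linear_part_add_cmult[OF open_UNIV smooth_on_const[of UNIV u0] sm[of 1] UNIV_I, of idx a s x0]
      low[of 1] const by simp
  have top: "linear_part idx a (\<lambda>x. (x - x0) ^ r) x0 = a $ k * x0 ^ r * fact r"
    by (subst linear_part_flat) (simp_all add: higher_deriv_monomial_at)
  show ?thesis
    unfolding test_poly_def
    using linear_part_add_cmult[OF open_UNIV sm'(2) sm[of r] UNIV_I, of idx a n x0]
      linear_part_add_cmult[OF open_UNIV sm'(1) sm[of "r - 1"] UNIV_I, of idx a m x0] aff top
    by simp
qed

text \<open>The section \<open>f\<close> is extended linearly in t. Such a function need only
  satisfy the equation at the single point \<open>(t0, x0)\<close>, since mappings of equations are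
  defined jet by jet.\<close>

lemma test_graph:
  assumes f: "f = test_poly x0 u0 s m n" and u: "u = (\<lambda>w::real \<times> real. f (snd w) + \<tau> * (fst w - t0))"
  shows "smooth_on UNIV u" "u (t0, x0) = u0"
    "(u has_derivative (\<lambda>h. fst h * \<tau> + snd h * (s + m * of_bool (r = 2)))) (at (t0, x0))"
    "F_II0 idx \<theta> u (t0, x0) \<longleftrightarrow> \<tau> = evolution idx \<theta> f x0"
proof -
  have "smooth_on UNIV (\<lambda>w::real \<times> real. f (snd w))"
    unfolding f by (rule smooth_on_compose[OF open_UNIV _ smooth_test_poly[of UNIV] smooth_on_snd]) simp
  then show "smooth_on UNIV u" unfolding u by (intro smooth_intros open_UNIV)
  show "u (t0, x0) = u0" by (simp add: u f)
  have "(f has_derivative (*) (s + m * of_bool (r = 2))) (at (snd (t0, x0)))"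
    using test_poly_has_derivative f by (simp add: has_field_derivative_def)
  from has_derivative_compose[OF bounded_linear_imp_has_derivative[OF bounded_linear_snd] this]
  have "((\<lambda>w::real \<times> real. f (snd w)) has_derivative (\<lambda>h. (s + m * of_bool (r = 2)) * snd h)) (at (t0, x0))" .
  then have "(u has_derivative (\<lambda>h. (s + m * of_bool (r = 2)) * snd h + \<tau> * fst h)) (at (t0, x0))"
    unfolding u by (auto intro!: derivative_eq_intros)
  then show "(u has_derivative (\<lambda>h. fst h * \<tau> + snd h * (s + m * of_bool (r = 2)))) (at (t0, x0))"
    by (simp add: algebra_simps)
  have "deriv (\<lambda>s. u (s, x0)) t0 = \<tau>"
    unfolding u by (rule DERIV_imp_deriv) (auto intro!: derivative_eq_intros)
  then show "F_II0 idx \<theta> u (t0, x0) \<longleftrightarrow> \<tau> = evolution idx \<theta> f x0" by (simp add: F_II0_iff u)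
qed

end

locale equation_map = point_map D \<phi> + leading_index r idx k
  for D \<phi> r and idx :: "'n::finite \<Rightarrow> nat" and k +
  fixes a a' :: "real ^ 'n" and a00 a00' b0 b0' :: real
  assumes lead: "a $ k \<noteq> 0" "a' $ k \<noteq> 0"
    and maps: "maps_equation D \<phi> (F_II0 idx (a, a00, b0)) (F_II0 idx (a', a00', b0'))"
begin

section \<open>The new time depends on the old time only\<close>

text \<open>If T_x + T_u s were nonzero, the old t would vary to first order along the line T =
  const of the image. The perturbation (t - t0)^r, invisible to the source equation at the point
  because r is at least 2, would then have order exactly r in the new x on this line. It would
  change the r-th derivative of the image and nothing below it, so the two images could not both
  satisfy the target equation.\<close>

lemma T_not_depending:
  assumes z: "z = (t0, x0, u0)" "z \<in> D" and nz: "x0 \<noteq> 0" "X z \<noteq> 0"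
  shows "dx T z = 0" "du T z = 0"
proof -
  have "\<not> (dx T z \<noteq> 0 \<or> du T z \<noteq> 0)"
  proof
    assume "dx T z \<noteq> 0 \<or> du T z \<noteq> 0"
    obtain s1 \<tau> where j1: "jac z s1 \<tau> \<noteq> 0" using jac_nonzero[OF z(2)] by blast
    \<comment> \<open>\<open>jac\<close> is affine in the slope and nonzero at \<open>s1\<close>,
      hence zero at no more than one of \<open>s1 + 1\<close> and \<open>s1 + 2\<close>. Moving the
      slope by either amount also makes the x-derivative of T along the graph nonzero.\<close>
    obtain s where jac: "jac z s \<tau> \<noteq> 0" and Tx: "dx T z + du T z * s \<noteq> 0"
    proof (cases "dx T z + du T z * s1 = 0")
      case True
      then have "du T z \<noteq> 0" using \<open>dx T z \<noteq> 0 \<or> du T z \<noteq> 0\<close> by auto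
      then have "dx T z + du T z * (s1 + e) \<noteq> 0" if "e \<noteq> 0" for e
        using True that by (simp add: distrib_left flip: add.assoc)
      moreover have "jac z (s1 + 1) \<tau> \<noteq> 0 \<or> jac z (s1 + 2) \<tau> \<noteq> 0"
        using j1 jac_affine[of z s1 1 \<tau>] jac_affine[of z s1 2 \<tau>] by auto
      ultimately show thesis using that[of "s1 + 1"] that[of "s1 + 2"] by auto
    qed (use j1 that in blast)
    \<comment> \<open>The value \<open>\<tau>\<close> was fixed by the regularity of the plane map;
      the coefficient of (x - x0)^r is tuned so that the source equation returns exactly this
      u_t.\<close>
    define n where "n = (\<tau> - (a00 * u0 + b0 * x0 - u0 * s)) / (a $ k * x0 ^ r * fact r)"
    define f where "f = test_poly x0 u0 s 0 n"
    have f: "f x0 = u0" "deriv f x0 = s" by (simp_all add: f_def)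
    have "linear_part idx a f x0 = n * (a $ k * x0 ^ r * fact r)"
      unfolding f_def linear_part_test_poly by simp
    also have "\<dots> = \<tau> - (a00 * u0 + b0 * x0 - u0 * s)"
      unfolding n_def using lead nz by simp
    finally have evo: "evolution idx (a, a00, b0) f x0 = \<tau>"
      by (simp add: evolution_def f)
    define u1 where "u1 = (\<lambda>w::real \<times> real. f (snd w) + \<tau> * (fst w - t0))"
    define u2 where "u2 = (\<lambda>w. u1 w + (fst w - t0) ^ r)"
    let ?p = "(t0, x0)" and ?q = "(T z, X z)"
    note g1 = test_graph[OF f_def u1_def]
    have s1: "smooth_on UNIV u1" by (rule g1(1))
    have s2: "smooth_on UNIV u2" unfolding u2_def by (intro smooth_intros s1 open_UNIV)
    have z1: "z = (fst ?p, snd ?p, u1 ?p)" and z2: "z = (fst ?p, snd ?p, u2 ?p)"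
      using r g1(2) by (simp_all add: z u2_def power_0_left)
    have d1: "(u1 has_derivative (\<lambda>h. fst h * \<tau> + snd h * s)) (at ?p)" using g1(3) by simp
    have d2: "(u2 has_derivative (\<lambda>h. fst h * \<tau> + snd h * s)) (at ?p)"
    proof -
      have "((\<lambda>w::real \<times> real. (fst w - t0) ^ r) has_derivative (\<lambda>h. of_nat r * fst h * (fst ?p - t0) ^ (r - 1))) (at ?p)"
        by (auto intro!: derivative_eq_intros)
      from has_derivative_add[OF d1 this] show ?thesis
        using r by (simp add: u2_def power_0_left split: if_splits)
    qed
    have E1: "F_II0 idx (a, a00, b0) u1 ?p" using g1(4) evo by simp
    have E2: "F_II0 idx (a, a00, b0) u2 ?p"
    proof -
      have "((\<lambda>s. u2 (s, x0)) has_real_derivative \<tau> + of_nat r * (t0 - t0) ^ (r - 1)) (at t0)"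
        unfolding u1_def u2_def by (auto intro!: derivative_eq_intros)
      then have "deriv (\<lambda>s. u2 (s, x0)) t0 = \<tau>"
        using r by (simp add: DERIV_imp_deriv power_0_left split: if_splits)
      moreover have "(\<lambda>y. u2 (t0, y)) = f" using r by (auto simp: u2_def u1_def power_0_left)
      ultimately show ?thesis by (simp add: F_II0_iff evo)
    qed
    obtain v1 where v1: "maps_graph D \<phi> u1 ?p v1 ?q"
      by (rule image_graph[OF open_UNIV UNIV_I s1 z1 z(2) d1 jac]) (rule that)
    obtain v2 k2 k2' where v2: "maps_graph D \<phi> u2 ?p v2 ?q" and k2: "k2 ?q = ?p"
      "(k2 has_derivative k2') (at ?q)" "fst (k2' (0, 1)) = - (dx T z + du T z * s) / jac z s \<tau>"
      and ev2: "\<forall>\<^sub>F y in nhds ?q. (fst (k2 y), snd (k2 y), u2 (k2 y)) \<in> D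
        \<and> \<phi> (fst (k2 y), snd (k2 y), u2 (k2 y)) = (fst y, snd y, v2 y)"
      by (rule image_graph[OF open_UNIV UNIV_I s2 z2 z(2) d2 jac]) (rule that)
    obtain V1 where V1: "open V1" "?q \<in> V1" "smooth_on V1 v1"
      using v1 by (auto simp: maps_graph_def smooth_near_def)
    obtain V2 where V2: "open V2" "?q \<in> V2" "smooth_on V2 v2"
      using v2 by (auto simp: maps_graph_def smooth_near_def)
    define c where "c = fst (k2' (0, 1))"
    have "c \<noteq> 0" using k2(3) Tx jac by (simp add: c_def)
    note g1 = graph_jet[OF v1 z1 d1] and g2 = graph_jet[OF v2 z2 d2]
    define vt vx where "vt = frechet_derivative v1 (at ?q) (1, 0)" and "vx = frechet_derivative v1 (at ?q) (0, 1)"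
    \<comment> \<open>Both images solve the same linear system with determinant \<open>jac\<close>,
      so their first derivatives agree.\<close>
    have same: "frechet_derivative v2 (at ?q) (1, 0) = vt" "frechet_derivative v2 (at ?q) (0, 1) = vx"
    proof -
      define wt where "wt = frechet_derivative v2 (at ?q) (1, 0) - vt"
      define wx where "wx = frechet_derivative v2 (at ?q) (0, 1) - vx"
      have e: "(dt T z + du T z * \<tau>) * wt + (dt X z + du X z * \<tau>) * wx = 0"
        "(dx T z + du T z * s) * wt + (dx X z + du X z * s) * wx = 0"
        using g1(5,6) g2(5,6) by (simp_all add: wt_def wx_def vt_def vx_def algebra_simps)
      have "wt * jac z s \<tau> = (dx X z + du X z * s) * ((dt T z + du T z * \<tau>) * wt + (dt X z + du X z * \<tau>) * wx)
          - (dt X z + du X z * \<tau>) * ((dx T z + du T z * s) * wt + (dx X z + du X z * s) * wx)"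
        "wx * jac z s \<tau> = (dt T z + du T z * \<tau>) * ((dx T z + du T z * s) * wt + (dx X z + du X z * s) * wx)
          - (dx T z + du T z * s) * ((dt T z + du T z * \<tau>) * wt + (dt X z + du X z * \<tau>) * wx)"
        unfolding jac_def by algebra+
      then have "wt = 0" "wx = 0" using jac unfolding e by simp_all
      then show "frechet_derivative v2 (at ?q) (1, 0) = vt" "frechet_derivative v2 (at ?q) (0, 1) = vx"
        by (simp_all add: wt_def wx_def)
    qed
    let ?M = "{y. (T z, y) \<in> V1} \<inter> {y. (T z, y) \<in> V2}"
    note sl1 = smooth_on_slice[OF V1(1,3), of "T z"] and sl2 = smooth_on_slice[OF V2(1,3), of "T z"]
    have M: "open ?M" "X z \<in> ?M" using sl1(1) sl2(1) V1(2) V2(2) by auto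
    let ?g1 = "\<lambda>y. v1 (T z, y)" and ?g2 = "\<lambda>y. v2 (T z, y)"
    have sg: "smooth_on ?M ?g1" "smooth_on ?M ?g2"
      using smooth_on_subset[OF sl1(2)] smooth_on_subset[OF sl2(2)] by auto
    define w where "w = (\<lambda>y. ?g2 y + (-1) * ?g1 y)"
    have sw: "smooth_on ?M w" unfolding w_def by (intro smooth_on_add smooth_on_mult smooth_on_const sg M)
    have "evolution idx (a', a00', b0') ?g1 (X z) = vt"
      using maps[unfolded maps_equation_def, rule_format, OF v1] E1 deriv_slices(1)[OF V1(3,2)]
      by (simp add: F_II0_iff vt_def)
    moreover have "evolution idx (a', a00', b0') ?g2 (X z) = vt"
      using maps[unfolded maps_equation_def, rule_format, OF v2] E2 deriv_slices(1)[OF V2(3,2)]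
      by (simp add: F_II0_iff same)
    moreover have "deriv ?g1 (X z) = vx" "deriv ?g2 (X z) = vx"
      using deriv_slices(2)[OF V1(3,2)] deriv_slices(2)[OF V2(3,2)] by (simp_all add: same vx_def)
    ultimately have "linear_part idx a' ?g1 (X z) = linear_part idx a' ?g2 (X z)"
      using g1(3) g2(3) by (simp add: evolution_def)
    then have "linear_part idx a' w (X z) = 0"
      unfolding w_def using linear_part_add_cmult[OF M(1) sg(2,1) M(2), of idx a' "-1"] by simp

    \<comment> \<open>The height of the image of a point above the graph of \<open>v1\<close>. It
      vanishes on the graph of \<open>u1\<close>, and at points of the graph of \<open>u2\<close>
      lying over the line T = const it equals \<open>w\<close>.\<close>
    define H where "H y = U y - v1 (T y, X y)" for y
    define W where "W = D \<inter> (\<lambda>y. (T y, X y)) -` V1"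
    have smTX: "smooth_on D (\<lambda>y. (T y, X y))" by (intro smooth_on_Pair open_D smooth_components)
    have W: "open W" unfolding W_def
      by (rule continuous_open_preimage[OF smooth_on_continuous[OF smTX] open_D V1(1)])
    have zW: "z \<in> W" using z V1(2) by (simp add: W_def)
    have smH: "smooth_on W H" unfolding H_def
      by (intro smooth_on_diff W smooth_on_subset[OF smooth_components(3)]
          smooth_on_compose[OF W _ V1(3) smooth_on_subset[OF smTX]]) (auto simp: W_def)
    have H': "(H has_derivative (\<lambda>h. differential U z h -
        (differential T z h * vt +
         differential X z h * vx))) (at z)"
      unfolding H_def
      by (rule has_derivative_diff[OF derivatives(3)[OF z(2)]
          has_derivative_compose[OF has_derivative_Pair[OF derivatives(1,2)[OF z(2)]]
            has_derivative_plane[OF V1(3,2)], folded vt_def vx_def, simplified]])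
    \<comment> \<open>\<open>H\<close> is zero along the graph of \<open>u1\<close>; if its
      u-derivative vanished too, its whole differential would, and dU would be a combination of dT
      and dX.\<close>
    have duH: "du H z \<noteq> 0"
    proof
      note p = partials_eqI[OF H', simplified]
      assume 0: "du H z = 0"
      then have 1: "du U z - (du T z * vt + du X z * vx) = 0" using p(3) by simp
      have "dt U z - (dt T z * vt + dt X z * vx) + \<tau> * (du U z - (du T z * vt + du X z * vx)) = 0"
        "dx U z - (dx T z * vt + dx X z * vx) + s * (du U z - (du T z * vt + du X z * vx)) = 0"
        using g1(5,6) by (simp_all add: vt_def vx_def algebra_simps)
      with 1 have "dt U z - (dt T z * vt + dt X z * vx) = 0" "dx U z - (dx T z * vt + dx X z * vx) = 0"
        by simp_all
      then show False
        using rows_independent(3)[OF z(2), of "- vt" "- vx" 1] 1 by (simp add: algebra_simps)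
    qed
    \<comment> \<open>\<open>\<kappa> y\<close> is the old time elapsed at the preimage of
      \<open>(T z, y)\<close>, and \<open>z1' y\<close> is the point of the graph of
      \<open>u1\<close> over that preimage. Raising it by the r-th power of
      \<open>\<kappa> y\<close> reaches the graph of \<open>u2\<close>, so \<open>w\<close> is a
      difference of values of \<open>H\<close> with this step.\<close>
    define \<kappa> where "\<kappa> y = fst (k2 (T z, y)) - t0" for y
    define z1' where "z1' y = (fst (k2 (T z, y)), snd (k2 (T z, y)), u1 (k2 (T z, y)))" for y
    have k2c: "((\<lambda>y. k2 (T z, y)) has_derivative (\<lambda>h. k2' (0, h))) (at (X z))"
    proof -
      have "((\<lambda>s. (T z, s)) has_derivative (\<lambda>h. (0, h))) (at (X z))" by (auto intro!: derivative_eq_intros)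
      from has_derivative_compose[OF this k2(2)] show ?thesis .
    qed
    have "fst (k2' (0, h)) = c * h" for h
      using linear_scale[OF has_derivative_linear[OF k2(2)], of h "(0, 1)"] by (simp add: c_def)
    then have "(\<kappa> has_real_derivative c) (at (X z))"
      unfolding \<kappa>_def has_field_derivative_def
      using has_derivative_diff[OF has_derivative_fst[OF k2c] has_derivative_const[of t0]] by simp
    then have lim\<kappa>: "((\<lambda>y. \<kappa> y / (y - X z)) \<longlongrightarrow> c) (at (X z))"
      using k2(1) by (simp add: has_field_derivative_iff \<kappa>_def)
    have ev\<kappa>: "\<forall>\<^sub>F y in at (X z). \<kappa> y \<noteq> 0"
      using tendsto_imp_eventually_ne[OF lim\<kappa> \<open>c \<noteq> 0\<close>] by eventually_elim auto
    have contk: "((\<lambda>y. k2 (T z, y)) \<longlongrightarrow> ?p) (at (X z))"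
      using has_derivative_continuous[OF k2c] k2(1) by (simp add: continuous_at)
    have \<kappa>0: "((\<lambda>y. \<kappa> y ^ r) \<longlongrightarrow> 0) (at (X z))"
    proof -
      have "((\<lambda>y. (fst (k2 (T z, y)) - t0) ^ r) \<longlongrightarrow> (fst ?p - t0) ^ r) (at (X z))"
        by (intro tendsto_power tendsto_diff tendsto_fst contk tendsto_const)
      then show ?thesis using r by (simp add: \<kappa>_def power_0_left split: if_splits)
    qed
    have zlim: "(z1' \<longlongrightarrow> z) (at (X z))"
    proof -
      have "isCont u1 ?p" using has_derivative_continuous[OF d1] .
      then have "(z1' \<longlongrightarrow> (fst ?p, snd ?p, u1 ?p)) (at (X z))"
        unfolding z1'_def by (intro tendsto_Pair tendsto_fst tendsto_snd contk isCont_tendsto_compose[OF _ contk])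
      then show ?thesis using z1 by simp
    qed
    have quot: "((\<lambda>y. (H (z1' y + \<kappa> y ^ r *\<^sub>R (0, 0, 1)) - H (z1' y)) / \<kappa> y ^ r) \<longlongrightarrow> du H z) (at (X z))"
      unfolding du_def
    proof (rule smooth_difference_quotient[OF W zW smH zlim \<kappa>0])
      show "\<forall>\<^sub>F y in at (X z). \<kappa> y ^ r \<noteq> 0" using ev\<kappa> by eventually_elim simp
    qed
    have "((\<lambda>y. (H (z1' y + \<kappa> y ^ r *\<^sub>R (0, 0, 1)) - H (z1' y)) / \<kappa> y ^ r * (\<kappa> y / (y - X z)) ^ r)
        \<longlongrightarrow> du H z * c ^ r) (at (X z))"
      by (intro tendsto_mult quot tendsto_power lim\<kappa>)
    then have lim: "((\<lambda>y. w y / (y - X z) ^ r) \<longlongrightarrow> du H z * c ^ r) (at (X z))"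
    proof (rule Lim_transform_eventually)
      have "((\<lambda>y. (T z, y)) \<longlongrightarrow> ?q) (at (X z))" by (intro tendsto_intros)
      from eventually_compose_filterlim[OF ev2 this]
      have e2: "\<forall>\<^sub>F y in at (X z). \<phi> (z1' y + \<kappa> y ^ r *\<^sub>R (0, 0, 1)) = (T z, y, v2 (T z, y))"
        by eventually_elim (simp add: z1'_def \<kappa>_def u2_def)
      have e1: "\<forall>\<^sub>F y in at (X z). H (z1' y) = 0"
        using eventually_compose_filterlim[OF g1(4) contk]
        by eventually_elim (simp add: H_def z1'_def)
      show "\<forall>\<^sub>F y in at (X z). (H (z1' y + \<kappa> y ^ r *\<^sub>R (0, 0, 1)) - H (z1' y)) / \<kappa> y ^ r * (\<kappa> y / (y - X z)) ^ r
          = w y / (y - X z) ^ r"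
        using e1 e2 ev\<kappa>
      proof eventually_elim
        case (elim y)
        have "H (z1' y + \<kappa> y ^ r *\<^sub>R (0, 0, 1)) = w y"
          using elim(2) by (simp add: H_def w_def \<phi>_eq)
        then show ?case using elim by (simp add: power_divide)
      qed
    qed
    note flat = higher_deriv_of_flat[OF M sw trivial_limit_at tendsto_ident_at _ lim]
    have ne: "\<forall>\<^sub>F y in at (X z). y \<noteq> X z" by (simp add: eventually_at_filter)
    have "linear_part idx a' w (X z) = a' $ k * X z ^ r * (fact r * (du H z * c ^ r))"
      using linear_part_flat[of w "X z" a'] flat[OF ne] by simp
    then show False using \<open>linear_part idx a' w (X z) = 0\<close> lead nz duH \<open>c \<noteq> 0\<close> by simp
  qed
  then show "dx T z = 0" "du T z = 0" by auto
qed

end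

section \<open>Boxes, sections, and the independence of X from u\<close>

lemma constant_on_segment:
  fixes f :: "'a::real_normed_vector \<Rightarrow> real"
  assumes "convex B" "z \<in> B" "w \<in> B"
    and f: "\<And>y. y \<in> B \<Longrightarrow> (f has_derivative f' y) (at y)" "\<And>y. y \<in> B \<Longrightarrow> f' y (w - z) = 0"
  shows "f w = f z"
proof -
  have seg: "z + l *\<^sub>R (w - z) \<in> B" if "l \<in> {0..1}" for l
    using convexD_alt[OF assms(1-3), of l] that by (simp add: algebra_simps)
  have "((\<lambda>l. f (z + l *\<^sub>R (w - z))) has_derivative (\<lambda>h. 0)) (at l within {0..1})" if "l \<in> {0..1}" for l
  proof -
    note d = f(1)[OF seg[OF that]]
    have "((\<lambda>l. z + l *\<^sub>R (w - z)) has_derivative (\<lambda>h. h *\<^sub>R (w - z))) (at l within {0..1})"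
      by (auto intro!: derivative_eq_intros)
    from has_derivative_compose[OF this d] show ?thesis
      using f(2)[OF seg[OF that]] linear_scale[OF has_derivative_linear[OF d]] by simp
  qed
  from has_derivative_zero_unique[OF convex_real_interval(5) this, of 1 0] show ?thesis by simp
qed

context point_map
begin

text \<open>A product of intervals of equal radius, so that the coordinates of a point can be varied
  independently without leaving it; convexity provides the segments for integration.\<close>

definition box :: "txu \<Rightarrow> real \<Rightarrow> txu set" where
  "box z e = ball (fst z) e \<times> ball (fst (snd z)) e \<times> ball (snd (snd z)) e"

lemma convex_box: "convex (box z e)"
  by (simp add: box_def convex_Times)

lemma open_box: "open (box z e)"
  by (simp add: box_def open_Times)

lemma ex_box:
  assumes "open W" "z \<in> W"
  obtains e where "e > 0" "box z e \<subseteq> W"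
proof -
  obtain d where d: "d > 0" "ball z d \<subseteq> W" using assms open_contains_ball by blast
  have "box z (d / 3) \<subseteq> ball z d"
  proof
    fix y assume y: "y \<in> box z (d / 3)"
    have "dist z y \<le> dist (fst z) (fst y) + dist (snd z) (snd y)"
      unfolding dist_prod_def by (rule sqrt_sum_squares_le_sum) auto
    moreover have "dist (snd z) (snd y) \<le> dist (fst (snd z)) (fst (snd y)) + dist (snd (snd z)) (snd (snd y))"
      unfolding dist_prod_def by (rule sqrt_sum_squares_le_sum) auto
    ultimately show "y \<in> ball z d" using y by (auto simp: box_def mem_Times_iff)
  qed
  then show thesis using that[of "d / 3"] d by auto
qed

end

context equation_map
begin

definition good :: "txu set" where
  "good = {z \<in> D. fst (snd z) \<noteq> 0 \<and> X z \<noteq> 0}"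

lemma open_good: "open good"
proof -
  have "open (D \<inter> (\<lambda>z. fst (snd z) * X z) -` (- {0}))"
    by (rule continuous_open_preimage[OF _ open_D])
      (auto intro!: continuous_intros smooth_on_continuous[OF smooth_components(2)])
  moreover have "D \<inter> (\<lambda>z. fst (snd z) * X z) -` (- {0}) = good" by (auto simp: good_def)
  ultimately show ?thesis by simp
qed

lemma good_D: "z \<in> good \<Longrightarrow> z \<in> D"
  by (simp add: good_def)

lemma T_good:
  assumes "z \<in> good"
  shows "dx T z = 0" "du T z = 0" "dt T z \<noteq> 0"
proof -
  obtain t0 x0 u0 where z: "z = (t0, x0, u0)" by (cases z)
  show 0: "dx T z = 0" "du T z = 0"
    using T_not_depending[OF z] assms by (auto simp: good_def z)
  show "dt T z \<noteq> 0"
    using rows_independent(1)[OF good_D[OF assms], of 1 0 0] 0 by auto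
qed

lemma T_slice:
  assumes "(t0, x0, u0) \<in> good"
  shows "\<forall>\<^sub>F y in nhds (x0, u0). (t0, fst y, snd y) \<in> good \<and> T (t0, fst y, snd y) = T (t0, x0, u0)"
proof -
  obtain e where e: "e > 0" "box (t0, x0, u0) e \<subseteq> good" using ex_box[OF open_good assms] by blast
  have "\<forall>\<^sub>F y in nhds (x0, u0). y \<in> ball x0 e \<times> ball u0 e"
    using e by (intro eventually_nhds_in_open open_Times) auto
  then show ?thesis
  proof eventually_elim
    case (elim y)
    let ?w = "(t0, fst y, snd y)"
    have w: "?w \<in> box (t0, x0, u0) e" "(t0, x0, u0) \<in> box (t0, x0, u0) e"
      using elim e by (auto simp: box_def mem_Times_iff)
    have "T ?w = T (t0, x0, u0)"
    proof (rule constant_on_segment[OF convex_box w(2,1)])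
      fix y assume y: "y \<in> box (t0, x0, u0) e"
      then show "(T has_derivative (differential T y)) (at y)"
        by (intro derivatives good_D subsetD[OF e(2)])
      show "fst (?w - (t0, x0, u0)) * dt T y + fst (snd (?w - (t0, x0, u0))) * dx T y
          + snd (snd (?w - (t0, x0, u0))) * du T y = 0"
        using T_good[of y] y e by auto
    qed
    then show ?case using w e by auto
  qed
qed

text \<open>As T depends on t alone, the slice t = t0 is sent into the slice T = T(z), and the image
  section \<open>g\<close> is tied to \<open>f\<close> by X and U only. The determinant becomes T_t
  times the x-derivative of X along the graph. The last identity is the t-equation of the first
  prolongation with both time derivatives replaced through their equations.\<close>

lemma slice_identity:
  assumes z_def: "z = (t0, x0, u0)" and f_def: "f = test_poly x0 u0 s m n"
    and s'_def: "s' = s + m * of_bool (r = 2)" and \<tau>_def: "\<tau> = evolution idx (a, a00, b0) f x0"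
    and z: "z \<in> good" and DX: "dx X z + du X z * s' \<noteq> 0"
  obtains g N where "open N" "X z \<in> N" "smooth_on N g" "g (X z) = U z"
    "\<forall>\<^sub>F x in nhds x0. X (t0, x, f x) \<in> N \<and> g (X (t0, x, f x)) = U (t0, x, f x)"
    "deriv g (X z) * (dx X z + du X z * s') = dx U z + du U z * s'"
    "dt T z * evolution idx (a', a00', b0') g (X z) + (dt X z + du X z * \<tau>) * deriv g (X z) = dt U z + du U z * \<tau>"
proof -
  define u where "u = (\<lambda>w::real \<times> real. f (snd w) + \<tau> * (fst w - t0))"
  let ?p = "(t0, x0)" and ?q = "(T z, X z)"
  note g = test_graph[OF f_def u_def, folded s'_def]
  have su: "smooth_on UNIV u" by (rule g(1))
  have zu: "z = (fst ?p, snd ?p, u ?p)" by (simp add: z_def g(2))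
  have f0: "f x0 = u0" by (simp add: f_def)
  have f': "(f has_real_derivative s') (at x0)"
    unfolding s'_def f_def by (rule test_poly_has_derivative)
  have d: "(u has_derivative (\<lambda>h. fst h * \<tau> + snd h * s')) (at ?p)" by (rule g(3))
  have E: "F_II0 idx (a, a00, b0) u ?p" using g(4) \<tau>_def by simp
  note T = T_good[OF z]
  have jac: "jac z s' \<tau> \<noteq> 0" using T DX by (simp add: jac_def)
  obtain v where v: "maps_graph D \<phi> u ?p v ?q"
    by (rule image_graph[OF open_UNIV UNIV_I su zu good_D[OF z] d jac]) (rule that)
  obtain V where V: "open V" "?q \<in> V" "smooth_on V v"
    using v by (auto simp: maps_graph_def smooth_near_def)
  note j = graph_jet[OF v zu d]
  note sl = smooth_on_slice[OF V(1,3), of "T z"]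
  define g where "g = (\<lambda>y. v (T z, y))"
  have evo: "evolution idx (a', a00', b0') g (X z) = frechet_derivative v (at ?q) (1, 0)"
    using maps[unfolded maps_equation_def, rule_format, OF v] E deriv_slices(1)[OF V(3,2)]
    by (simp add: F_II0_iff g_def)
  have dg: "deriv g (X z) = frechet_derivative v (at ?q) (0, 1)"
    unfolding g_def using deriv_slices(2)[OF V(3,2)] .
  show thesis
  proof (rule that[of "{y. (T z, y) \<in> V}" g])
    show "smooth_on {y. (T z, y) \<in> V} g" unfolding g_def by (rule sl(2))
    show "g (X z) = U z" using j(3) by (simp add: g_def)
    show "deriv g (X z) * (dx X z + du X z * s') = dx U z + du U z * s'"
      using j(6) T by (simp add: dg mult.commute)
    show "dt T z * evolution idx (a', a00', b0') g (X z) + (dt X z + du X z * \<tau>) * deriv g (X z) = dt U z + du U z * \<tau>"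
      using j(5) T by (simp add: dg evo)
    have lim: "((\<lambda>x. (t0, x)) \<longlongrightarrow> ?p) (nhds x0)" by (intro tendsto_intros filterlim_ident)
    have flim: "(f \<longlongrightarrow> u0) (nhds x0)"
      using DERIV_isCont[OF f'] f0 tendsto_at_iff_tendsto_nhds[of f x0] by (simp add: isCont_def)
    then have lim2: "((\<lambda>x. (x, f x)) \<longlongrightarrow> (x0, u0)) (nhds x0)" by (intro tendsto_intros filterlim_ident)
    have "isCont X z" using has_derivative_continuous[OF derivatives(2)[OF good_D[OF z]]] .
    then have "((\<lambda>x. X (t0, x, f x)) \<longlongrightarrow> X z) (nhds x0)"
      unfolding z_def by (rule isCont_tendsto_compose) (intro tendsto_intros filterlim_ident flim)
    then have "\<forall>\<^sub>F x in nhds x0. X (t0, x, f x) \<in> {y. (T z, y) \<in> V}"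
      by (rule topological_tendstoD) (use sl V in auto)
    moreover have "\<forall>\<^sub>F x in nhds x0. T (t0, x, f x) = T z"
      using eventually_compose_filterlim[OF T_slice[OF z[unfolded z_def]] lim2]
      by eventually_elim (simp add: z_def)
    ultimately show "\<forall>\<^sub>F x in nhds x0. X (t0, x, f x) \<in> {y. (T z, y) \<in> V} \<and> g (X (t0, x, f x)) = U (t0, x, f x)"
      using eventually_compose_filterlim[OF j(4) lim]
    proof eventually_elim
      case (elim x)
      have "u (t0, x) = f x" by (simp add: u_def)
      then show ?case using elim by (simp add: g_def)
    qed
  qed (use sl(1) V(2) in auto)
qed

text \<open>Raising \<open>f1\<close> by (x - x0)^r changes u_t by a_r x0^r r!. Subtracting the two
  slice identities, the left side keeps T_t times the leading terms of the target, the right side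
  this change times the factor \<open>\<omega>\<close>. The leading derivative of the difference of
  images is also proportional to \<open>\<omega>\<close>, which therefore cancels.\<close>

lemma X_power:
  assumes z: "z = (t0, x0, u0)" "z \<in> good" and DX: "dx X z + du X z * s \<noteq> 0"
  shows "a' $ k * dt T z * X z ^ r = a $ k * x0 ^ r * (dx X z + du X z * s) ^ r"
proof -
  let ?DX = "dx X z + du X z * s"
  define f1 where "f1 = test_poly x0 u0 s 0 0"
  define f2 where "f2 = test_poly x0 u0 s 0 1"
  have f12: "f2 x = f1 x + (x - x0) ^ r" for x by (simp add: f1_def f2_def test_poly_def)
  have f1': "(f1 has_real_derivative s) (at x0)" and f2': "(f2 has_real_derivative s) (at x0)"
    using test_poly_has_derivative[of x0 u0 s 0] by (simp_all add: f1_def f2_def)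
  have f0: "f1 x0 = u0" "f2 x0 = u0" by (simp_all add: f1_def f2_def)
  define \<tau>1 where "\<tau>1 = evolution idx (a, a00, b0) f1 x0"
  define \<tau>2 where "\<tau>2 = evolution idx (a, a00, b0) f2 x0"
  have \<tau>12: "\<tau>2 - \<tau>1 = a $ k * x0 ^ r * fact r"
    by (simp add: \<tau>1_def \<tau>2_def evolution_def f1_def f2_def linear_part_test_poly)
  obtain g1 N1 where g1: "open N1" "X z \<in> N1" "smooth_on N1 g1" "g1 (X z) = U z"
    "\<forall>\<^sub>F x in nhds x0. X (t0, x, f1 x) \<in> N1 \<and> g1 (X (t0, x, f1 x)) = U (t0, x, f1 x)"
    "deriv g1 (X z) * ?DX = dx U z + du U z * s"
    "dt T z * evolution idx (a', a00', b0') g1 (X z) + (dt X z + du X z * \<tau>1) * deriv g1 (X z) = dt U z + du U z * \<tau>1"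
    by (rule slice_identity[OF z(1) f1_def _ \<tau>1_def z(2) DX]) (simp, rule that)
  obtain g2 N2 where g2: "open N2" "X z \<in> N2" "smooth_on N2 g2" "g2 (X z) = U z"
    "\<forall>\<^sub>F x in nhds x0. X (t0, x, f2 x) \<in> N2 \<and> g2 (X (t0, x, f2 x)) = U (t0, x, f2 x)"
    "deriv g2 (X z) * ?DX = dx U z + du U z * s"
    "dt T z * evolution idx (a', a00', b0') g2 (X z) + (dt X z + du X z * \<tau>2) * deriv g2 (X z) = dt U z + du U z * \<tau>2"
    by (rule slice_identity[OF z(1) f2_def _ \<tau>2_def z(2) DX]) (simp, rule that)
  define p where "p = deriv g1 (X z)"
  have p2: "deriv g2 (X z) = p" using g1(6) g2(6) DX unfolding p_def by (metis mult_right_cancel)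
  \<comment> \<open>The rate at which the image of a point leaves the graph of \<open>g1\<close>
    when u increases, i.e. the u-derivative of \<open>U - g1 (X)\<close>. Its vanishing would make
    dU a combination of dT and dX.\<close>
  define \<omega> where "\<omega> = du U z - p * du X z"
  note zD = good_D[OF z(2)] and T = T_good[OF z(2)]
  have "\<omega> \<noteq> 0"
  proof
    assume 0: "\<omega> = 0"
    have "dx U z - p * dx X z = - s * \<omega>" using g1(6) by (simp add: \<omega>_def p_def algebra_simps)
    then show False
      using 0 T rows_independent(3)[OF zD, of "- (dt U z - p * dt X z) / dt T z" "- p" 1]
      by (simp add: \<omega>_def)
  qed
  let ?M = "N1 \<inter> N2"
  have M: "open ?M" "X z \<in> ?M" using g1 g2 by auto
  have sg: "smooth_on ?M g1" "smooth_on ?M g2" using smooth_on_subset g1(3) g2(3) by blast+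
  define w where "w = (\<lambda>y. g2 y + (-1) * g1 y)"
  have sw: "smooth_on ?M w" unfolding w_def by (intro smooth_on_add smooth_on_mult smooth_on_const sg M)
  define H where "H y = U y - g1 (X y)" for y
  define W where "W = D \<inter> X -` N1"
  have W: "open W" unfolding W_def
    by (rule continuous_open_preimage[OF smooth_on_continuous[OF smooth_components(2)] open_D g1(1)])
  have zW: "z \<in> W" using zD g1(2) by (simp add: W_def)
  have smH: "smooth_on W H" unfolding H_def
    by (intro smooth_on_diff W smooth_on_subset[OF smooth_components(3)]
        smooth_on_compose[OF W _ g1(3) smooth_on_subset[OF smooth_components(2)]]) (auto simp: W_def)
  have duH: "du H z = \<omega>"
  proof -
    have "(g1 has_derivative (*) p) (at (X z))"
      using smooth_on_imp_deriv(1)[OF g1(1,3,2)] by (simp add: p_def has_field_derivative_def)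
    from has_derivative_diff[OF derivatives(3)[OF zD] has_derivative_compose[OF derivatives(2)[OF zD] this]]
    show ?thesis using partials_eqI(3)[of H _ z] by (simp add: H_def[abs_def] \<omega>_def)
  qed
  define \<rho> where "\<rho> x = X (t0, x, f2 x)" for x
  have \<rho>': "(\<rho> has_real_derivative ?DX) (at x0)"
  proof -
    have "((\<lambda>x. (t0, x, f2 x)) has_derivative (\<lambda>h. (0, h, s * h))) (at x0)"
      using f2' unfolding has_field_derivative_def by (auto intro!: derivative_eq_intros)
    moreover have "(X has_derivative (differential X z)) (at (t0, x0, f2 x0))"
      using derivatives(2)[OF zD] z f0 by simp
    ultimately have "(\<rho> has_derivative (\<lambda>h. h * dx X z + s * h * du X z)) (at x0)"
      unfolding \<rho>_def using has_derivative_compose by fastforce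
    moreover have "(\<lambda>h. h * dx X z + s * h * du X z) = (*) ?DX" by (auto simp: algebra_simps)
    ultimately show ?thesis by (simp add: has_field_derivative_def)
  qed
  have \<rho>0: "\<rho> x0 = X z" by (simp add: \<rho>_def f0 z)
  have ne: "\<forall>\<^sub>F x in at x0. x \<noteq> x0" by (simp add: eventually_at_filter)
  have f1c: "(f1 \<longlongrightarrow> u0) (at x0)" using DERIV_isCont[OF f1'] f0 by (simp add: isCont_def)
  have pw: "((\<lambda>x. (x - x0) ^ r) \<longlongrightarrow> 0) (at x0)"
  proof -
    have "((\<lambda>x. (x - x0) ^ r) \<longlongrightarrow> (x0 - x0) ^ r) (at x0)" by (intro tendsto_intros)
    then show ?thesis using r by (simp add: power_0_left)
  qed
  let ?h = "\<lambda>x. H ((t0, x, f1 x) + (x - x0) ^ r *\<^sub>R (0, 0, 1)) - H (t0, x, f1 x)"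
  have lim: "((\<lambda>x. ?h x / (x - x0) ^ r) \<longlongrightarrow> \<omega>) (at x0)"
    unfolding duH[symmetric] du_def
  proof (rule smooth_difference_quotient[OF W zW smH _ pw])
    show "((\<lambda>x. (t0, x, f1 x)) \<longlongrightarrow> z) (at x0)" unfolding z(1) by (intro tendsto_intros f1c)
    show "\<forall>\<^sub>F x in at x0. (x - x0) ^ r \<noteq> 0" using ne by eventually_elim simp
  qed
  have at: "eventually P (nhds x0) \<Longrightarrow> eventually P (at x0)" for P
    by (auto simp: eventually_at_filter elim: eventually_mono)
  have "\<forall>\<^sub>F x in at x0. w (\<rho> x) = ?h x"
    using at[OF g1(5)] at[OF g2(5)]
  proof eventually_elim
    case (elim x)
    then show ?case using f12[of x] by (simp add: H_def w_def \<rho>_def)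
  qed
  note flat = higher_deriv_of_flat_section[OF M(1) M(2)[folded \<rho>0] sw \<rho>' DX this lim, unfolded \<rho>0]
  have "linear_part idx a' w (X z) = a' $ k * X z ^ r * (fact r * (\<omega> / ?DX ^ r))"
    using linear_part_flat[of w "X z" a'] flat by simp
  moreover have "linear_part idx a' w (X z) = linear_part idx a' g2 (X z) - linear_part idx a' g1 (X z)"
    unfolding w_def using linear_part_add_cmult[OF M(1) sg(2,1) M(2), of idx a' "-1"] by simp
  moreover have "dt T z * (linear_part idx a' g2 (X z) - linear_part idx a' g1 (X z)) = (\<tau>2 - \<tau>1) * \<omega>"
    using g1(7) g2(7) unfolding p2 p_def[symmetric]
    by (simp add: evolution_def g1(4) g2(4) p2 p_def[symmetric] \<omega>_def algebra_simps)
  ultimately have "dt T z * (a' $ k * X z ^ r * (fact r * (\<omega> / ?DX ^ r))) = a $ k * x0 ^ r * fact r * \<omega>"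
    using \<tau>12 by simp
  then have "fact r * \<omega> * (a' $ k * dt T z * X z ^ r) = fact r * \<omega> * (a $ k * x0 ^ r * ?DX ^ r)"
    using DX by (simp add: field_simps)
  then show ?thesis using \<open>\<omega> \<noteq> 0\<close> by simp
qed

text \<open>The left side of \<open>X_power\<close> is free of the slope. If X_u were nonzero,
  slopes could be chosen that make X_x + X_u s equal to 1 and to 2, giving 1^r = 2^r.\<close>

lemma X_good:
  assumes z: "z = (t0, x0, u0)" "z \<in> good"
  shows "du X z = 0" "dx X z \<noteq> 0" "a' $ k * dt T z * X z ^ r = a $ k * x0 ^ r * dx X z ^ r"
proof -
  have nz: "a $ k * x0 ^ r \<noteq> 0" using lead z by (auto simp: good_def)
  show 0: "du X z = 0"
  proof (rule ccontr)
    assume u: "du X z \<noteq> 0"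
    have "a $ k * x0 ^ r * 1 ^ r = a $ k * x0 ^ r * 2 ^ r"
      using X_power[OF z, of "(1 - dx X z) / du X z"] X_power[OF z, of "(2 - dx X z) / du X z"] u by simp
    then have "(1::real) ^ r = 2 ^ r" using mult_left_cancel[OF nz] by blast
    then show False using r one_less_power[of "2::real" r] by simp
  qed
  show nz: "dx X z \<noteq> 0"
  proof
    assume "dx X z = 0"
    then show False
      using rows_independent(2)[OF good_D[OF z(2)], of "- dt X z / dt T z" 1 0] T_good[OF z(2)] 0 by simp
  qed
  show "a' $ k * dt T z * X z ^ r = a $ k * x0 ^ r * dx X z ^ r"
    using X_power[OF z, of 0] 0 nz by simp
qed

end

section \<open>Mixed second differences: U is affine in u\<close>

text \<open>The steps \<open>a\<close> and \<open>b\<close> may tend to zero at unrelated rates,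
  here like x - x0 and its power r - 1. The mean value theorem in the \<open>a\<close>-step leaves
  an ordinary difference quotient in \<open>b\<close> of the directional derivative, taken at a
  moving point.\<close>

lemma smooth_mixed_difference:
  fixes H :: "'a::euclidean_space \<Rightarrow> real" and F :: "'b filter"
  assumes W: "open W" "z0 \<in> W" and H: "smooth_on W H" and z: "(z \<longlongrightarrow> z0) F"
    and a: "(a \<longlongrightarrow> 0) F" "\<forall>\<^sub>F s in F. a s \<noteq> 0" and b: "(b \<longlongrightarrow> 0) F" "\<forall>\<^sub>F s in F. b s \<noteq> 0"
  shows "((\<lambda>s. (H (z s + (a s + b s) *\<^sub>R e) - H (z s + a s *\<^sub>R e) - H (z s + b s *\<^sub>R e) + H (z s)) / (a s * b s))
    \<longlongrightarrow> frechet_derivative (\<lambda>y. frechet_derivative H (at y) e) (at z0) e) F"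
proof -
  let ?H' = "\<lambda>y. frechet_derivative H (at y) e"
  let ?\<Delta> = "\<lambda>s. H (z s + (a s + b s) *\<^sub>R e) - H (z s + a s *\<^sub>R e) - H (z s + b s *\<^sub>R e) + H (z s)"
  obtain d where d: "d > 0" "ball z0 d \<subseteq> W" using W open_contains_ball by blast
  have H': "((\<lambda>t. H (y + t *\<^sub>R e)) has_real_derivative ?H' (y + t *\<^sub>R e)) (at t)" if "y + t *\<^sub>R e \<in> ball z0 d" for y t
  proof -
    have h: "(H has_derivative frechet_derivative H (at (y + t *\<^sub>R e))) (at (y + t *\<^sub>R e))"
      using smooth_on_has_derivative[OF H] that d by blast
    have "((\<lambda>t. y + t *\<^sub>R e) has_derivative (\<lambda>v. v *\<^sub>R e)) (at t)" by (auto intro!: derivative_eq_intros)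
    from has_derivative_compose[OF this h] show ?thesis
      using linear_scale[OF has_derivative_linear[OF h]] by (simp add: has_field_derivative_def mult.commute[of _ "?H' _"])
  qed
  have "\<exists>\<xi>. \<bar>\<xi>\<bar> \<le> \<bar>a s\<bar> \<and> ?\<Delta> s = a s * (?H' (z s + \<xi> *\<^sub>R e + b s *\<^sub>R e) - ?H' (z s + \<xi> *\<^sub>R e))"
    if s: "z s \<in> ball z0 d" "z s + a s *\<^sub>R e \<in> ball z0 d" "z s + b s *\<^sub>R e \<in> ball z0 d"
      "z s + (a s + b s) *\<^sub>R e \<in> ball z0 d" for s
  proof -
    have seg: "z s + (t * a s) *\<^sub>R e \<in> ball z0 d" "z s + b s *\<^sub>R e + (t * a s) *\<^sub>R e \<in> ball z0 d" if "t \<in> {0..1}" for t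
    proof -
      have "(1 - t) *\<^sub>R z s + t *\<^sub>R (z s + a s *\<^sub>R e) \<in> ball z0 d"
        "(1 - t) *\<^sub>R (z s + b s *\<^sub>R e) + t *\<^sub>R (z s + (a s + b s) *\<^sub>R e) \<in> ball z0 d"
        using convexD_alt[OF convex_ball s(1,2)] convexD_alt[OF convex_ball s(3,4)] that by auto
      then show "z s + (t * a s) *\<^sub>R e \<in> ball z0 d" "z s + b s *\<^sub>R e + (t * a s) *\<^sub>R e \<in> ball z0 d"
        by (simp_all add: algebra_simps)
    qed
    let ?q = "\<lambda>t. H (z s + b s *\<^sub>R e + (t * a s) *\<^sub>R e) - H (z s + (t * a s) *\<^sub>R e)"
    let ?q' = "\<lambda>t. (?H' (z s + b s *\<^sub>R e + (t * a s) *\<^sub>R e) - ?H' (z s + (t * a s) *\<^sub>R e)) * a s"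
    have der: "(?q has_real_derivative ?q' t) (at t)" if "t \<in> {0..1}" for t
    proof -
      have m: "((\<lambda>t. t * a s) has_real_derivative a s) (at t)" by (auto intro!: derivative_eq_intros)
      from DERIV_diff[OF DERIV_chain2[OF H'[OF seg(2)[OF that]] m] DERIV_chain2[OF H'[OF seg(1)[OF that]] m]]
      show ?thesis by (simp add: algebra_simps)
    qed
    obtain t where t: "0 < t" "t < 1" "?q 1 - ?q 0 = (1 - 0) * ?q' t"
      using MVT2[of 0 1 ?q ?q'] der by auto
    have "\<bar>t * a s\<bar> \<le> \<bar>a s\<bar>" using t by (simp add: abs_mult mult_left_le_one_le)
    moreover have "?\<Delta> s = a s * (?H' (z s + (t * a s) *\<^sub>R e + b s *\<^sub>R e) - ?H' (z s + (t * a s) *\<^sub>R e))"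
      using t(3) by (simp add: algebra_simps)
    ultimately show ?thesis by blast
  qed
  then obtain \<xi> where \<xi>: "\<And>s. z s \<in> ball z0 d \<Longrightarrow> z s + a s *\<^sub>R e \<in> ball z0 d \<Longrightarrow> z s + b s *\<^sub>R e \<in> ball z0 d \<Longrightarrow>
      z s + (a s + b s) *\<^sub>R e \<in> ball z0 d \<Longrightarrow>
      \<bar>\<xi> s\<bar> \<le> \<bar>a s\<bar> \<and> ?\<Delta> s = a s * (?H' (z s + \<xi> s *\<^sub>R e + b s *\<^sub>R e) - ?H' (z s + \<xi> s *\<^sub>R e))"
    by metis
  have lim: "((\<lambda>s. z s + h s *\<^sub>R e) \<longlongrightarrow> z0) F" if "(h \<longlongrightarrow> 0) F" for h
    using tendsto_add[OF z tendsto_scaleR[OF that tendsto_const[of e]]] by simp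
  have ab: "((\<lambda>s. a s + b s) \<longlongrightarrow> 0) F" using tendsto_add[OF a(1) b(1)] by simp
  note inball = topological_tendstoD[of _ z0 F "ball z0 d"]
  have "\<forall>\<^sub>F s in F. z s \<in> ball z0 d \<and> z s + a s *\<^sub>R e \<in> ball z0 d \<and> z s + b s *\<^sub>R e \<in> ball z0 d \<and>
      z s + (a s + b s) *\<^sub>R e \<in> ball z0 d"
    using d by (intro eventually_conj inball z lim a b ab) auto
  then have ev: "\<forall>\<^sub>F s in F. \<bar>\<xi> s\<bar> \<le> \<bar>a s\<bar> \<and> ?\<Delta> s = a s * (?H' (z s + \<xi> s *\<^sub>R e + b s *\<^sub>R e) - ?H' (z s + \<xi> s *\<^sub>R e))"
    by eventually_elim (use \<xi> in blast)
  have "(\<xi> \<longlongrightarrow> 0) F"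
  proof (rule Lim_null_comparison)
    show "\<forall>\<^sub>F s in F. norm (\<xi> s) \<le> \<bar>a s\<bar>" using ev by eventually_elim auto
    show "((\<lambda>s. \<bar>a s\<bar>) \<longlongrightarrow> 0) F" using tendsto_rabs[OF a(1)] by simp
  qed
  from smooth_difference_quotient[OF W smooth_on_frechet[OF H] lim[OF this] b]
  show ?thesis
  proof (rule Lim_transform_eventually)
    show "\<forall>\<^sub>F s in F. (?H' (z s + \<xi> s *\<^sub>R e + b s *\<^sub>R e) - ?H' (z s + \<xi> s *\<^sub>R e)) / b s = ?\<Delta> s / (a s * b s)"
      using ev a(2) b(2)
    proof eventually_elim
      case (elim s)
      have e: "?\<Delta> s = a s * (?H' (z s + \<xi> s *\<^sub>R e + b s *\<^sub>R e) - ?H' (z s + \<xi> s *\<^sub>R e))"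
        using elim by blast
      show ?case unfolding e using elim by simp
    qed
  qed
qed

text \<open>Identities between values at y and y + d, valid for y near z, become identities between
  partial derivatives at two distinct points.\<close>

lemma has_derivative_shift:
  assumes "(h has_derivative h') (at z)" "\<forall>\<^sub>F y in nhds z. f (y + d) = h y"
  shows "(f has_derivative h') (at (z + d))"
proof -
  have "((\<lambda>y. y - d) has_derivative (\<lambda>v. v)) (at (z + d))" by (auto intro!: derivative_eq_intros)
  from has_derivative_compose[OF this, of h h'] assms(1)
  have h: "((\<lambda>y. h (y - d)) has_derivative h') (at (z + d))" by simp
  have "((\<lambda>y. y - d) \<longlongrightarrow> (z + d) - d) (nhds (z + d))" by (intro tendsto_intros filterlim_ident)
  then have "((\<lambda>y. y - d) \<longlongrightarrow> z) (nhds (z + d))" by simp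
  from eventually_compose_filterlim[OF assms(2) this]
  have ev: "\<forall>\<^sub>F y in nhds (z + d). h (y - d) = f y" by eventually_elim simp
  show ?thesis
    by (rule has_derivative_transform_eventually[OF h eventually_at_filter[THEN iffD2, OF eventually_mono[OF ev]]])
      (use eventually_nhds_x_imp_x[OF ev] in auto)
qed

context equation_map
begin

lemma mem_box:
  "(t, x, u) \<in> box z e \<longleftrightarrow> \<bar>t - fst z\<bar> < e \<and> \<bar>x - fst (snd z)\<bar> < e \<and> \<bar>u - snd (snd z)\<bar> < e"
  by (auto simp: box_def dist_real_def abs_minus_commute)

lemma smooth_good: "smooth_on good T" "smooth_on good X" "smooth_on good U"
  using smooth_components by (auto intro: smooth_on_subset good_D)

text \<open>Each product hypothesis covers two cases at once: either the coordinate is the same at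
  both points or the corresponding partial derivative vanishes.\<close>

lemma box_segment:
  assumes "smooth_on good f" "box z e \<subseteq> good" "y \<in> box z e" "y' \<in> box z e"
    "\<And>w. w \<in> good \<Longrightarrow> (fst y' - fst y) * dt f w = 0"
    "\<And>w. w \<in> good \<Longrightarrow> (fst (snd y') - fst (snd y)) * dx f w = 0"
    "\<And>w. w \<in> good \<Longrightarrow> (snd (snd y') - snd (snd y)) * du f w = 0"
  shows "f y' = f y"
proof (rule constant_on_segment[OF convex_box assms(3,4)])
  fix w assume "w \<in> box z e"
  then have w: "w \<in> good" using assms(2) by blast
  show "(f has_derivative (differential f w)) (at w)"
    using has_derivative_partials[OF assms(1) w] .
  show "fst (y' - y) * dt f w + fst (snd (y' - y)) * dx f w + snd (snd (y' - y)) * du f w = 0"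
    unfolding fst_diff snd_diff assms(5-7)[OF w] by simp
qed

text \<open>\<open>g\<close> is the section over \<open>T = T(t\<^sub>0)\<close> of the image of a function with the section \<open>f\<close> over \<open>t = t\<^sub>0\<close>.\<close>

definition section_image :: "real \<Rightarrow> real \<Rightarrow> real \<Rightarrow> (real \<Rightarrow> real) \<Rightarrow> (real \<Rightarrow> real) \<Rightarrow> bool" where
  "section_image t0 x0 u0 f g \<longleftrightarrow> (\<exists>N. open N \<and> X (t0, x0, u0) \<in> N \<and> smooth_on N g \<and>
     (\<forall>\<^sub>F x in nhds x0. g (X (t0, x, u0)) = U (t0, x, f x)))"

text \<open>X is free of u, so sections through different heights over \<open>x0\<close> have images
  over the same new point and can be combined there.\<close>

lemma section_image_shift:
  assumes "section_image t0 x0 u0' f g" "box (t0, x0, u0) e \<subseteq> good" "\<bar>u0' - u0\<bar> < e"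
  shows "section_image t0 x0 u0 f g"
proof -
  have "e > 0" using assms(3) by linarith
  have X: "X (t0, x, u0') = X (t0, x, u0)" if "\<bar>x - x0\<bar> < e" for x
    by (rule box_segment[OF smooth_good(2) assms(2)]) (use that assms(3) \<open>e > 0\<close> X_good(1) in \<open>auto simp: mem_box\<close>)
  have ev: "\<forall>\<^sub>F x in nhds x0. \<bar>x - x0\<bar> < e"
    using eventually_nhds_in_open[of "ball x0 e" x0] \<open>e > 0\<close> by (simp add: dist_real_def abs_minus_commute)
  obtain N where N: "open N" "X (t0, x0, u0') \<in> N" "smooth_on N g"
    "\<forall>\<^sub>F x in nhds x0. g (X (t0, x, u0')) = U (t0, x, f x)"
    using assms(1) unfolding section_image_def by blast
  have "\<forall>\<^sub>F x in nhds x0. g (X (t0, x, u0)) = U (t0, x, f x)"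
    using N(4) ev by eventually_elim (simp add: X)
  then show ?thesis unfolding section_image_def using N X[of x0] \<open>e > 0\<close> by auto
qed

text \<open>The slice identity for a test function after X_u = 0 and with g' eliminated. The linear
  part of \<open>g\<close> is the only remaining quantity that refers to the unknown image section;
  differences in the parameters are formed in order to dispose of it.\<close>

abbreviation test_identity :: "txu \<Rightarrow> (real \<Rightarrow> real) \<Rightarrow> real \<Rightarrow> real \<Rightarrow> real \<Rightarrow> real \<Rightarrow> bool" where
  "test_identity z g x0 u0 s m \<equiv>
     dt T z * (linear_part idx a' g (X z) + a00' * U z + b0' * X z
        - U z * ((dx U z + du U z * (s + m * of_bool (r = 2))) / dx X z))
       + dt X z * ((dx U z + du U z * (s + m * of_bool (r = 2))) / dx X z)
     = dt U z + du U z * (m * linear_part idx a (\<lambda>x. (x - x0) ^ (r - 1)) x0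
         + a00 * u0 + b0 * x0 - u0 * (s + m * of_bool (r = 2)))"

lemma section_identity:
  assumes z: "z = (t0, x0, u0)" "z \<in> good"
  obtains g where "section_image t0 x0 u0 (test_poly x0 u0 s m 0) g"
    "test_identity z g x0 u0 s m"
proof -
  let ?f = "test_poly x0 u0 s m 0" and ?s = "s + m * of_bool (r = 2)"
  note X = X_good[OF z]
  have "dx X z + du X z * ?s \<noteq> 0" using X by simp
  from slice_identity[OF z(1) refl refl refl z(2) this, of 0]
  obtain g N where g: "open N" "X z \<in> N" "smooth_on N g" "g (X z) = U z"
    "\<forall>\<^sub>F x in nhds x0. X (t0, x, ?f x) \<in> N \<and> g (X (t0, x, ?f x)) = U (t0, x, ?f x)"
    "deriv g (X z) * (dx X z + du X z * ?s) = dx U z + du U z * ?s"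
    "dt T z * evolution idx (a', a00', b0') g (X z) + (dt X z + du X z * evolution idx (a, a00, b0) ?f x0) * deriv g (X z)
      = dt U z + du U z * evolution idx (a, a00, b0) ?f x0"
    by blast
  have p: "deriv g (X z) = (dx U z + du U z * ?s) / dx X z"
    using g(6) X by (simp add: field_simps)
  have \<tau>: "evolution idx (a, a00, b0) ?f x0 = m * linear_part idx a (\<lambda>x. (x - x0) ^ (r - 1)) x0
      + a00 * u0 + b0 * x0 - u0 * ?s"
    by (simp add: evolution_def linear_part_test_poly)
  have ev: "evolution idx (a', a00', b0') g (X z) = linear_part idx a' g (X z) + a00' * U z + b0' * X z
        - U z * ((dx U z + du U z * ?s) / dx X z)"
    using p g(4) by (simp add: evolution_def)
  obtain e where e: "e > 0" "box z e \<subseteq> good" using ex_box[OF open_good z(2)] by blast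
  have fc: "(?f \<longlongrightarrow> u0) (nhds x0)"
    using DERIV_isCont[OF test_poly_has_derivative] tendsto_at_iff_tendsto_nhds[of ?f x0] by (simp add: isCont_def)
  have lim: "((\<lambda>x. (t0, x, ?f x)) \<longlongrightarrow> z) (nhds x0)" "((\<lambda>x. (t0, x, u0)) \<longlongrightarrow> z) (nhds x0)"
    unfolding z(1) by (intro tendsto_intros filterlim_ident fc)+
  have zb: "z \<in> box z e" using e(1) by (simp add: z(1) mem_box)
  have "\<forall>\<^sub>F x in nhds x0. g (X (t0, x, u0)) = U (t0, x, ?f x)"
    using topological_tendstoD[OF lim(1) open_box zb] topological_tendstoD[OF lim(2) open_box zb] g(5)
  proof eventually_elim
    case (elim x)
    have "X (t0, x, u0) = X (t0, x, ?f x)"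
      by (rule box_segment[OF smooth_good(2) e(2) elim(1,2)]) (use X_good(1) in auto)
    then show ?case using elim by simp
  qed
  then have "section_image t0 x0 u0 ?f g" unfolding section_image_def using g(1-3) z(1) by blast
  then show thesis using that g(7) X(1) unfolding ev p \<tau> by simp
qed

lemma section_derivative:
  assumes "z = (t0, x0, u0)" "z \<in> S" "smooth_on S f"
  shows "((\<lambda>x. f (t0, x, u0)) has_real_derivative dx f z) (at x0)"
proof -
  have "((\<lambda>x. (t0, x, u0)) has_derivative (\<lambda>h. (0, h, 0))) (at x0)"
    by (auto intro!: derivative_eq_intros)
  moreover have "(f has_derivative (differential f z)) (at (t0, x0, u0))"
    using has_derivative_partials[OF assms(3,2)] assms(1) by simp
  ultimately have "((\<lambda>x. f (t0, x, u0)) has_derivative (\<lambda>h. h * dx f z)) (at x0)"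
    using has_derivative_compose by fastforce
  then show ?thesis by (simp add: has_field_derivative_def mult.commute[of _ "dx f z"])
qed

text \<open>An affine function of the new x does not contribute to the linear part. If the combined
  images differ from one by something flat of order r in x - x0, only the leading derivative is
  left. Four slots suffice for all differences used; spare ones are filled with coefficient
  0.\<close>

lemma linear_part_combination:
  assumes z: "z = (t0, x0, u0)" "z \<in> good"
    and g: "section_image t0 x0 u0 f1 g1" "section_image t0 x0 u0 f2 g2"
      "section_image t0 x0 u0 f3 g3" "section_image t0 x0 u0 f4 g4"
    and w2: "\<forall>\<^sub>F x in at x0. e1 * U (t0, x, f1 x) + e2 * U (t0, x, f2 x) + e3 * U (t0, x, f3 x) + e4 * U (t0, x, f4 x)
      = d + c * (X (t0, x, u0) - X z) + w2 x"
    and lim: "((\<lambda>x. w2 x / (x - x0) ^ r) \<longlongrightarrow> K) (at x0)"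
  shows "e1 * linear_part idx a' g1 (X z) + e2 * linear_part idx a' g2 (X z)
      + e3 * linear_part idx a' g3 (X z) + e4 * linear_part idx a' g4 (X z)
    = a' $ k * X z ^ r * (fact r * (K / dx X z ^ r))"
proof -
  obtain N1 where N1: "open N1" "X z \<in> N1" "smooth_on N1 g1" "\<forall>\<^sub>F x in nhds x0. g1 (X (t0, x, u0)) = U (t0, x, f1 x)"
    using g(1) z(1) unfolding section_image_def by auto
  obtain N2 where N2: "open N2" "X z \<in> N2" "smooth_on N2 g2" "\<forall>\<^sub>F x in nhds x0. g2 (X (t0, x, u0)) = U (t0, x, f2 x)"
    using g(2) z(1) unfolding section_image_def by auto
  obtain N3 where N3: "open N3" "X z \<in> N3" "smooth_on N3 g3" "\<forall>\<^sub>F x in nhds x0. g3 (X (t0, x, u0)) = U (t0, x, f3 x)"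
    using g(3) z(1) unfolding section_image_def by auto
  obtain N4 where N4: "open N4" "X z \<in> N4" "smooth_on N4 g4" "\<forall>\<^sub>F x in nhds x0. g4 (X (t0, x, u0)) = U (t0, x, f4 x)"
    using g(4) z(1) unfolding section_image_def by auto
  define M where "M = N1 \<inter> N2 \<inter> N3 \<inter> N4"
  have M: "open M" "X z \<in> M" using N1 N2 N3 N4 by (auto simp: M_def)
  have sm: "smooth_on M g1" "smooth_on M g2" "smooth_on M g3" "smooth_on M g4"
    using N1(3) N2(3) N3(3) N4(3) by (auto intro: smooth_on_subset simp: M_def)
  let ?q = "X z"
  \<comment> \<open>The affine part is subtracted so that the whole combination becomes
    flat.\<close>
  let ?h = "test_poly ?q (- d) (- c) 0 0"
  note sh = smooth_test_poly[of M ?q "- d" "- c" 0 0]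
  have s1: "smooth_on M (\<lambda>y. ?h y + e1 * g1 y)" by (intro smooth_on_add smooth_on_mult smooth_on_const sm sh M)
  have s2: "smooth_on M (\<lambda>y. ?h y + e1 * g1 y + e2 * g2 y)" by (intro smooth_on_add smooth_on_mult smooth_on_const sm s1 M)
  have s3: "smooth_on M (\<lambda>y. ?h y + e1 * g1 y + e2 * g2 y + e3 * g3 y)" by (intro smooth_on_add smooth_on_mult smooth_on_const sm s2 M)
  define w where "w = (\<lambda>y. ?h y + e1 * g1 y + e2 * g2 y + e3 * g3 y + e4 * g4 y)"
  have sw: "smooth_on M w" unfolding w_def by (intro smooth_on_add smooth_on_mult smooth_on_const sm s3 M)
  have lpw: "linear_part idx a' w ?q = e1 * linear_part idx a' g1 ?q + e2 * linear_part idx a' g2 ?q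
      + e3 * linear_part idx a' g3 ?q + e4 * linear_part idx a' g4 ?q"
    unfolding w_def linear_part_add_cmult[OF M(1) s3 sm(4) M(2)] linear_part_add_cmult[OF M(1) s2 sm(3) M(2)]
      linear_part_add_cmult[OF M(1) s1 sm(2) M(2)] linear_part_add_cmult[OF M(1) sh sm(1) M(2)]
    by (simp add: linear_part_test_poly)
  define \<rho> where "\<rho> x = X (t0, x, u0)" for x
  have \<rho>': "(\<rho> has_real_derivative dx X z) (at x0)"
    unfolding \<rho>_def by (rule section_derivative[OF z smooth_good(2)])
  have \<rho>0: "\<rho> x0 = ?q" by (simp add: \<rho>_def z(1))
  have nz: "dx X z \<noteq> 0" using X_good[OF z] by simp
  have at: "eventually P (nhds x0) \<Longrightarrow> eventually P (at x0)" for P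
    by (auto simp: eventually_at_filter elim: eventually_mono)
  have "\<forall>\<^sub>F x in at x0. w (\<rho> x) = w2 x"
    using at[OF N1(4)] at[OF N2(4)] at[OF N3(4)] at[OF N4(4)] w2
    by eventually_elim (simp add: w_def \<rho>_def test_poly_def algebra_simps)
  note flat = higher_deriv_of_flat_section[OF M(1) M(2)[folded \<rho>0] sw \<rho>' nz this lim, unfolded \<rho>0]
  show ?thesis using linear_part_flat[of w ?q a'] flat lpw by simp
qed

text \<open>Apart from the linear part of \<open>g\<close>, every term of
  \<open>test_identity\<close> is affine in \<open>s\<close> and \<open>m\<close> without a product
  of the two, so the mixed difference over the values 0 and 1 leaves linear parts alone. The images
  themselves have the mixed difference U_uu (x - x0)(x - x0)^(r - 1) to lowest order, exactly of
  order r, and it must vanish.\<close>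

lemma dudu_U:
  assumes z: "z \<in> good"
  shows "du (du U) z = 0"
proof -
  obtain t0 x0 u0 where z1: "z = (t0, x0, u0)" by (cases z)
  let ?f = "\<lambda>s m. test_poly x0 u0 s m 0"
  obtain g11 where g11: "section_image t0 x0 u0 (?f 1 1) g11"
    and i11: "test_identity z g11 x0 u0 1 1"
    by (rule section_identity[OF z1 z]) (rule that)
  obtain g10 where g10: "section_image t0 x0 u0 (?f 1 0) g10"
    and i10: "test_identity z g10 x0 u0 1 0"
    by (rule section_identity[OF z1 z]) (rule that)
  obtain g01 where g01: "section_image t0 x0 u0 (?f 0 1) g01"
    and i01: "test_identity z g01 x0 u0 0 1"
    by (rule section_identity[OF z1 z]) (rule that)
  obtain g00 where g00: "section_image t0 x0 u0 (?f 0 0) g00"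
    and i00: "test_identity z g00 x0 u0 0 0"
    by (rule section_identity[OF z1 z]) (rule that)
  let ?L = "linear_part idx a' g11 (X z) - linear_part idx a' g10 (X z) - linear_part idx a' g01 (X z) + linear_part idx a' g00 (X z)"
  have "dt T z * ?L = 0"
    using i11 i10 i01 i00 by (simp add: algebra_simps add_divide_distrib)
  then have L: "?L = 0" using T_good(3)[OF z] by simp
  have ne: "\<forall>\<^sub>F x in at x0. x \<noteq> x0" by (simp add: eventually_at_filter)
  let ?w = "\<lambda>x. U ((t0, x, u0) + ((x - x0) + (x - x0) ^ (r - 1)) *\<^sub>R (0, 0, 1)) - U ((t0, x, u0) + (x - x0) *\<^sub>R (0, 0, 1))
      - U ((t0, x, u0) + (x - x0) ^ (r - 1) *\<^sub>R (0, 0, 1)) + U (t0, x, u0)"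
  have "((\<lambda>x. ?w x / ((x - x0) * (x - x0) ^ (r - 1))) \<longlongrightarrow>
     frechet_derivative (\<lambda>y. frechet_derivative U (at y) (0, 0, 1)) (at z) (0, 0, 1)) (at x0)"
  proof (rule smooth_mixed_difference[OF open_good z smooth_good(3)])
    show "((\<lambda>x. (t0, x, u0)) \<longlongrightarrow> z) (at x0)" unfolding z1 by (intro tendsto_intros)
    have "((\<lambda>x. (x - x0) ^ j) \<longlongrightarrow> (x0 - x0) ^ j) (at x0)" for j by (intro tendsto_intros)
    from this[of 1] this[of "r - 1"] show "((\<lambda>x. x - x0) \<longlongrightarrow> 0) (at x0)" "((\<lambda>x. (x - x0) ^ (r - 1)) \<longlongrightarrow> 0) (at x0)"
      using r by (simp_all add: power_0_left)
    show "\<forall>\<^sub>F x in at x0. x - x0 \<noteq> 0" "\<forall>\<^sub>F x in at x0. (x - x0) ^ (r - 1) \<noteq> 0"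
      using ne by (eventually_elim, simp)+
  qed
  moreover have "(x - x0) * (x - x0) ^ (r - 1) = (x - x0) ^ r" for x
    using r by (simp flip: power_Suc)
  ultimately have lim: "((\<lambda>x. ?w x / (x - x0) ^ r) \<longlongrightarrow> du (du U) z) (at x0)"
    by (simp add: du_def[abs_def])
  have "1 * linear_part idx a' g11 (X z) + (-1) * linear_part idx a' g10 (X z)
      + (-1) * linear_part idx a' g01 (X z) + 1 * linear_part idx a' g00 (X z)
    = a' $ k * X z ^ r * (fact r * (du (du U) z / dx X z ^ r))"
    by (rule linear_part_combination[OF z1 z g11 g10 g01 g00 _ lim, of 1 "-1" "-1" 1 0 0])
      (simp add: test_poly_def algebra_simps)
  then have "a' $ k * X z ^ r * (fact r * (du (du U) z / dx X z ^ r)) = 0" using L by simp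
  then show ?thesis using lead X_good(2)[OF z1 z] z by (simp add: good_def)
qed

end

section \<open>Affine test functions and the determining equations\<close>

context equation_map
begin

text \<open>The constant c1 of the family, forced by a'_r = a_r / c1.\<close>

abbreviation lead_quotient :: real where "lead_quotient \<equiv> a $ k / a' $ k"

lemma smooth_du_U: "smooth_on good (du U)"
  by (rule smooth_on_partials(3)[OF smooth_good(3)])

lemma du_U_box:
  assumes "box z e \<subseteq> good" "(t, x, u) \<in> box z e" "(t, x, u') \<in> box z e"
  shows "du U (t, x, u') = du U (t, x, u)"
  by (rule box_segment[OF smooth_du_U assms]) (auto simp: dudu_U)

lemma U_box:
  assumes "box z e \<subseteq> good" "(t, x, u) \<in> box z e" "(t, x, u') \<in> box z e"
  shows "U (t, x, u') = U (t, x, u) + (u' - u) * du U (t, x, u)"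
proof -
  let ?y = "(t, x, u)" and ?y' = "(t, x, u')" and ?c = "du U (t, x, u)"
  have "(\<lambda>w. U w - snd (snd w) * ?c) ?y' = (\<lambda>w. U w - snd (snd w) * ?c) ?y"
  proof (rule constant_on_segment[where B = "closed_segment ?y ?y'"])
    fix w assume w: "w \<in> closed_segment ?y ?y'"
    then have wb: "w \<in> box z e" using closed_segment_subset[OF assms(2,3) convex_box] by blast
    then have wg: "w \<in> good" using assms(1) by blast
    show "((\<lambda>w. U w - snd (snd w) * ?c) has_derivative (\<lambda>h. differential U w h
        - snd (snd h) * ?c)) (at w)"
      by (auto intro!: derivative_eq_intros has_derivative_partials[OF smooth_good(3) wg])
    obtain l where "w = (t, x, l)"
      using w by (auto simp: closed_segment_def algebra_simps)
    then have "du U w = ?c" using du_U_box[OF assms(1,2)] wb by simp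
    then show "(fst (?y' - ?y) * dt U w + fst (snd (?y' - ?y)) * dx U w + snd (snd (?y' - ?y)) * du U w)
        - snd (snd (?y' - ?y)) * ?c = 0" by simp
  qed auto
  then show ?thesis by (simp add: algebra_simps)
qed

lemma near_box:
  assumes "e > 0" "\<bar>\<xi>\<bar> < e" "\<bar>\<delta>\<bar> < e"
  shows "\<forall>\<^sub>F y in nhds z. y \<in> box z e \<and> y + (0, \<xi>, \<delta>) \<in> box z e"
proof -
  obtain t x u where z: "z = (t, x, u)" by (cases z)
  have 1: "z \<in> box z e" "z + (0, \<xi>, \<delta>) \<in> box z e" using assms by (auto simp: z mem_box)
  have "((\<lambda>y. y + (0, \<xi>, \<delta>)) \<longlongrightarrow> z + (0, \<xi>, \<delta>)) (nhds z)" by (intro tendsto_intros filterlim_ident)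
  from topological_tendstoD[OF this open_box 1(2)] eventually_nhds_in_open[OF open_box 1(1)]
  show ?thesis by (rule eventually_conj[rotated])
qed

lemma T_shift:
  assumes "box z e \<subseteq> good" "e > 0" "\<bar>\<xi>\<bar> < e" "\<bar>\<delta>\<bar> < e"
  shows "dt T (z + (0, \<xi>, \<delta>)) = dt T z"
proof -
  have zg: "z \<in> good" using assms eventually_nhds_x_imp_x[OF near_box] by blast
  have "\<forall>\<^sub>F y in nhds z. T (y + (0, \<xi>, \<delta>)) = T y"
    using near_box[OF assms(2-4)]
  proof eventually_elim
    case (elim y)
    show ?case by (rule box_segment[OF smooth_good(1) assms(1)]) (use elim T_good in auto)
  qed
  from partials_eqI(1)[OF has_derivative_shift[OF has_derivative_partials[OF smooth_good(1) zg] this]]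
  show ?thesis by simp
qed

lemma X_shift:
  assumes "box z e \<subseteq> good" "e > 0" "\<bar>\<delta>\<bar> < e"
  shows "X (z + (0, 0, \<delta>)) = X z" "dt X (z + (0, 0, \<delta>)) = dt X z" "dx X (z + (0, 0, \<delta>)) = dx X z"
proof -
  have zg: "z \<in> good" using assms eventually_nhds_x_imp_x[OF near_box] by (metis abs_zero subsetD)
  have ev: "\<forall>\<^sub>F y in nhds z. X (y + (0, 0, \<delta>)) = X y"
    using near_box[OF assms(2) _ assms(3), of 0 z, simplified, OF assms(2)]
  proof eventually_elim
    case (elim y)
    show ?case by (rule box_segment[OF smooth_good(2) assms(1)]) (use elim X_good(1) in auto)
  qed
  show "X (z + (0, 0, \<delta>)) = X z" by (rule eventually_nhds_x_imp_x[OF ev])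
  from partials_eqI(1,2)[OF has_derivative_shift[OF has_derivative_partials[OF smooth_good(2) zg] ev]]
  show "dt X (z + (0, 0, \<delta>)) = dt X z" "dx X (z + (0, 0, \<delta>)) = dx X z" by simp_all
qed

text \<open>The first identity holds near z because U is affine in u; the others are its partial
  derivatives, where U_uu = 0 removes the correction in the u-derivative.\<close>

lemma U_shift:
  assumes "box z e \<subseteq> good" "e > 0" "\<bar>\<delta>\<bar> < e"
  shows "U (z + (0, 0, \<delta>)) = U z + \<delta> * du U z" "du U (z + (0, 0, \<delta>)) = du U z"
    "dt U (z + (0, 0, \<delta>)) = dt U z + \<delta> * dt (du U) z"
    "dx U (z + (0, 0, \<delta>)) = dx U z + \<delta> * dx (du U) z"
proof -
  have zg: "z \<in> good" using assms eventually_nhds_x_imp_x[OF near_box] by (metis abs_zero subsetD)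
  have ev: "\<forall>\<^sub>F y in nhds z. U (y + (0, 0, \<delta>)) = U y + \<delta> * du U y"
    using near_box[OF assms(2) _ assms(3), of 0 z, simplified, OF assms(2)]
  proof eventually_elim
    case (elim y)
    obtain t x u where y: "y = (t, x, u)" by (cases y)
    then show ?case using U_box[OF assms(1), of t x u "u + \<delta>"] elim by simp
  qed
  show "U (z + (0, 0, \<delta>)) = U z + \<delta> * du U z" by (rule eventually_nhds_x_imp_x[OF ev])
  have "((\<lambda>y. U y + \<delta> * du U y) has_derivative (\<lambda>h. differential U z h
     + \<delta> * differential (du U) z h)) (at z)"
    by (intro has_derivative_add has_derivative_mult_right has_derivative_partials[OF smooth_good(3) zg]
        has_derivative_partials[OF smooth_du_U zg])
  from partials_eqI[OF has_derivative_shift[OF this ev]]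
  show "du U (z + (0, 0, \<delta>)) = du U z" "dt U (z + (0, 0, \<delta>)) = dt U z + \<delta> * dt (du U) z"
    "dx U (z + (0, 0, \<delta>)) = dx U z + \<delta> * dx (du U) z" using dudu_U[OF zg] by simp_all
qed

text \<open>With T_x, T_u and X_u zero the Jacobian matrix is triangular, and U_u is one of its
  diagonal entries.\<close>

lemma du_U_nonzero:
  assumes z: "z \<in> good"
  shows "du U z \<noteq> 0"
proof
  assume u: "du U z = 0"
  obtain t0 x0 u0 where z1: "z = (t0, x0, u0)" by (cases z)
  note X = X_good[OF z1 z] and T = T_good[OF z]
  define \<beta> where "\<beta> = - dx U z / dx X z"
  show False
    using rows_independent(3)[OF good_D[OF z], of "- (dt U z + \<beta> * dt X z) / dt T z" \<beta> 1] X T u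
    by (simp add: \<beta>_def)
qed

text \<open>The identity at the point raised by \<open>\<delta>\<close>, rewritten in terms of
  derivatives at z itself. Except for the linear part of \<open>g\<close> it is polynomial in
  \<open>\<delta>\<close> and \<open>s\<close>; its coefficients are isolated by differences in
  these two parameters.\<close>

abbreviation affine_identity :: "txu \<Rightarrow> (real \<Rightarrow> real) \<Rightarrow> real \<Rightarrow> real \<Rightarrow> bool" where
  "affine_identity z g \<delta> s \<equiv>
     dt T z * (linear_part idx a' g (X z) + a00' * (U z + \<delta> * du U z) + b0' * X z
        - (U z + \<delta> * du U z) * (dx U z + \<delta> * dx (du U) z + du U z * s) * inverse (dx X z))
      + dt X z * (dx U z + \<delta> * dx (du U) z + du U z * s) * inverse (dx X z)
     = dt U z + \<delta> * dt (du U) z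
      + du U z * (a00 * (snd (snd z) + \<delta>) + b0 * fst (snd z) - (snd (snd z) + \<delta>) * s)"

lemma affine_section:
  assumes z: "z = (t0, x0, u0)" and e: "box z e \<subseteq> good" "\<bar>\<delta>\<bar> < e"
  obtains g where "section_image t0 x0 u0 (\<lambda>x. u0 + \<delta> + s * (x - x0)) g" "affine_identity z g \<delta> s"
proof -
  let ?z = "z + (0, 0, \<delta>)"
  have e0: "e > 0" "\<bar>0\<bar> < e" using e(2) by auto
  have z': "?z = (t0, x0, u0 + \<delta>)" by (simp add: z)
  have "?z \<in> good" using e e0 by (intro subsetD[OF e(1)]) (simp add: z mem_box)
  from section_identity[OF z' this, of s 0]
  obtain g where g: "section_image t0 x0 (u0 + \<delta>) (test_poly x0 (u0 + \<delta>) s 0 0) g"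
    and i: "test_identity ?z g x0 (u0 + \<delta>) s 0" by blast
  have "section_image t0 x0 u0 (test_poly x0 (u0 + \<delta>) s 0 0) g"
    by (rule section_image_shift[OF g e(1)[unfolded z]]) (use e in simp)
  moreover have "affine_identity z g \<delta> s"
    using i unfolding T_shift[OF e(1) e0 e(2)] X_shift[OF e(1) e0(1) e(2)] U_shift[OF e(1) e0(1) e(2)]
    by (simp add: z divide_inverse mult.assoc)
  ultimately show thesis using that by (simp add: test_poly_def)
qed

lemma zero_tendsto: "((\<lambda>x. 0 / (x - x0) ^ r) \<longlongrightarrow> (0::real)) (at x0)"
  by simp

lemma near_section_nhds: "d > 0 \<Longrightarrow> \<forall>\<^sub>F x in nhds (x0::real). \<bar>x - x0\<bar> < d"
  using eventually_nhds_in_open[of "ball x0 d" x0] by (simp add: dist_real_def abs_minus_commute)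

lemma near_section: "d > 0 \<Longrightarrow> \<forall>\<^sub>F x in at (x0::real). \<bar>x - x0\<bar> < d"
  using near_section_nhds[of d x0] by (auto simp: eventually_at_filter elim: eventually_mono)

text \<open>The mixed difference in \<open>\<delta>\<close> and \<open>s\<close> isolates the
  product u u_x. U is affine in u, so the images of the four affine sections cancel and with them
  the linear parts; what survives is T_t U_u^2 / X_x on one side and U_u on the other.\<close>

lemma dt_T_du_U:
  assumes z: "z \<in> good"
  shows "dt T z * du U z = dx X z"
proof -
  obtain t0 x0 u0 where z1: "z = (t0, x0, u0)" by (cases z)
  obtain e where e: "e > 0" "box z e \<subseteq> good" using ex_box[OF open_good z] by blast
  define \<delta> where "\<delta> = e / 2"
  have \<delta>: "\<bar>\<delta>\<bar> < e" "\<delta> \<noteq> 0" "\<bar>0\<bar> < e" using e by (auto simp: \<delta>_def)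
  obtain g1 where g1: "section_image t0 x0 u0 (\<lambda>x. u0 + 0 + 1 * (x - x0)) g1" "affine_identity z g1 0 1"
    by (rule affine_section[OF z1 e(2) \<delta>(3)])
  obtain g0 where g0: "section_image t0 x0 u0 (\<lambda>x. u0 + 0 + 0 * (x - x0)) g0" "affine_identity z g0 0 0"
    by (rule affine_section[OF z1 e(2) \<delta>(3)])
  obtain h1 where h1: "section_image t0 x0 u0 (\<lambda>x. u0 + \<delta> + 1 * (x - x0)) h1" "affine_identity z h1 \<delta> 1"
    by (rule affine_section[OF z1 e(2) \<delta>(1)])
  obtain h0 where h0: "section_image t0 x0 u0 (\<lambda>x. u0 + \<delta> + 0 * (x - x0)) h0" "affine_identity z h0 \<delta> 0"
    by (rule affine_section[OF z1 e(2) \<delta>(1)])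
  have "\<forall>\<^sub>F x in at x0. 1 * U (t0, x, u0 + 0 + 1 * (x - x0)) + (-1) * U (t0, x, u0 + 0 + 0 * (x - x0))
      + (-1) * U (t0, x, u0 + \<delta> + 1 * (x - x0)) + 1 * U (t0, x, u0 + \<delta> + 0 * (x - x0))
      = 0 + 0 * (X (t0, x, u0) - X z) + 0"
    using near_section[OF half_gt_zero[OF e(1)], of x0]
  proof (rule eventually_mono)
    fix x assume x: "\<bar>x - x0\<bar> < e / 2"
    have U: "U (t0, x, u') = U (t0, x, u0) + (u' - u0) * du U (t0, x, u0)" if "\<bar>u' - u0\<bar> < e" for u'
      by (rule U_box[OF e(2)]) (use that x e(1) in \<open>simp_all add: mem_box z1\<close>)
    have "\<bar>x - x0\<bar> < e" "\<bar>\<delta> + (x - x0)\<bar> < e" using x e(1) unfolding \<delta>_def abs_less_iff by linarith+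
    then show "1 * U (t0, x, u0 + 0 + 1 * (x - x0)) + (-1) * U (t0, x, u0 + 0 + 0 * (x - x0))
      + (-1) * U (t0, x, u0 + \<delta> + 1 * (x - x0)) + 1 * U (t0, x, u0 + \<delta> + 0 * (x - x0))
      = 0 + 0 * (X (t0, x, u0) - X z) + 0"
      using U[of "u0 + (x - x0)"] U[of "u0 + \<delta> + (x - x0)"] U[of "u0 + \<delta>"] \<delta> by (simp add: algebra_simps)
  qed
  from linear_part_combination[OF z1 z g1(1) g0(1) h1(1) h0(1) this zero_tendsto]
  have L: "linear_part idx a' g1 (X z) - linear_part idx a' g0 (X z)
    - linear_part idx a' h1 (X z) + linear_part idx a' h0 (X z) = 0" by simp
  define B q where "B = du U z" and "q = inverse (dx X z)"
  have "dt T z * (\<delta> * B * B * q) = B * \<delta>"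
    using g1(2) g0(2) h1(2) h0(2) L unfolding q_def[symmetric] B_def[symmetric] by algebra
  then have "dt T z * B * q = 1" using du_U_nonzero[OF z] \<delta> by (simp add: B_def)
  then show ?thesis using X_good(2)[OF z1 z] by (simp add: B_def q_def field_simps)
qed

text \<open>The second difference in \<open>\<delta>\<close> at slope 0 isolates the coefficient of
  u^2. The source has no such term, and the target contributes T_t U_u U_xu / X_x through its
  product of function and derivative.\<close>

lemma dxdu_U:
  assumes z: "z \<in> good"
  shows "dx (du U) z = 0"
proof -
  obtain t0 x0 u0 where z1: "z = (t0, x0, u0)" by (cases z)
  obtain e where e: "e > 0" "box z e \<subseteq> good" using ex_box[OF open_good z] by blast
  define \<delta> where "\<delta> = e / 2"
  have \<delta>: "\<bar>\<delta>\<bar> < e" "\<bar>- \<delta>\<bar> < e" "\<delta> \<noteq> 0" "\<bar>0\<bar> < e" using e by (auto simp: \<delta>_def)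
  obtain g where g: "section_image t0 x0 u0 (\<lambda>x. u0 + \<delta> + 0 * (x - x0)) g" "affine_identity z g \<delta> 0"
    by (rule affine_section[OF z1 e(2) \<delta>(1)])
  obtain h where h: "section_image t0 x0 u0 (\<lambda>x. u0 + - \<delta> + 0 * (x - x0)) h" "affine_identity z h (- \<delta>) 0"
    by (rule affine_section[OF z1 e(2) \<delta>(2)])
  obtain f where f: "section_image t0 x0 u0 (\<lambda>x. u0 + 0 + 0 * (x - x0)) f" "affine_identity z f 0 0"
    by (rule affine_section[OF z1 e(2) \<delta>(4)])
  have "\<forall>\<^sub>F x in at x0. 1 * U (t0, x, u0 + \<delta> + 0 * (x - x0)) + 1 * U (t0, x, u0 + - \<delta> + 0 * (x - x0))
      + (-2) * U (t0, x, u0 + 0 + 0 * (x - x0)) + 0 * U (t0, x, u0 + 0 + 0 * (x - x0))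
      = 0 + 0 * (X (t0, x, u0) - X z) + 0"
    using near_section[OF e(1), of x0]
  proof eventually_elim
    case (elim x)
    have U: "U (t0, x, u') = U (t0, x, u0) + (u' - u0) * du U (t0, x, u0)" if "\<bar>u' - u0\<bar> < e" for u'
      by (rule U_box[OF e(2)]) (use that elim e(1) in \<open>simp_all add: mem_box z1\<close>)
    show ?case using U[of "u0 + \<delta>"] U[of "u0 - \<delta>"] \<delta> by simp
  qed
  from linear_part_combination[OF z1 z g(1) h(1) f(1) f(1) this zero_tendsto]
  have L: "linear_part idx a' g (X z) + linear_part idx a' h (X z) - 2 * linear_part idx a' f (X z) = 0" by simp
  have "dt T z * \<delta>\<^sup>2 * (du U z * dx (du U) z * inverse (dx X z)) = 0"
    using g(2) h(2) f(2) L by algebra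
  then show ?thesis
    using T_good(3)[OF z] \<delta> X_good(2)[OF z1 z] du_U_nonzero[OF z] by simp
qed

text \<open>U_xu = 0 freezes U_u along x, and T_t is frozen since T depends on t only. By T_t U_u =
  X_x the same then holds for X_x.\<close>

lemma du_U_section:
  assumes "box (t0, x0, u0) e \<subseteq> good" "\<bar>x - x0\<bar> < e"
  shows "(t0, x, u0) \<in> good" "du U (t0, x, u0) = du U (t0, x0, u0)" "dt T (t0, x, u0) = dt T (t0, x0, u0)"
    "dt (du U) (t0, x, u0) = dt (du U) (t0, x0, u0)"
proof -
  let ?z = "(t0, x0, u0)"
  have e: "e > 0" using assms(2) by linarith
  have zs: "?z + (0, x - x0, 0) = (t0, x, u0)" by simp
  have b: "(t0, x, u0) \<in> box ?z e" "?z \<in> box ?z e" using assms(2) e by (auto simp: mem_box)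
  then show "(t0, x, u0) \<in> good" using assms(1) by blast
  have z: "?z \<in> good" using b assms(1) by blast
  show "dt T (t0, x, u0) = dt T ?z"
    using T_shift[OF assms(1) e assms(2), of 0] zs e by simp
  have ev: "\<forall>\<^sub>F y in nhds ?z. du U (y + (0, x - x0, 0)) = du U y"
    using near_box[OF e assms(2), of 0 ?z, simplified, OF e]
  proof eventually_elim
    case (elim y)
    show ?case
      by (rule box_segment[OF smooth_du_U assms(1)]) (use elim dxdu_U in auto)
  qed
  show "du U (t0, x, u0) = du U ?z" using eventually_nhds_x_imp_x[OF ev] zs by simp
  from partials_eqI(1)[OF has_derivative_shift[OF has_derivative_partials[OF smooth_du_U z] ev]]
  show "dt (du U) (t0, x, u0) = dt (du U) ?z" using zs by simp
qed

text \<open>In a'_r T_t X^r = a_r x^r X_x^r the factors T_t and X_x = T_t U_u are constant along x,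
  so the identity can be differentiated in x. Comparing the result with the identity itself, as for
  a logarithmic derivative, gives X = x X_x; substitution then cancels X^r.\<close>

lemma X_linear:
  assumes z: "z = (t0, x0, u0)" "z \<in> good"
  shows "X z = x0 * dx X z" "dt T z = lead_quotient"
proof -
  obtain e where e: "e > 0" "box z e \<subseteq> good" using ex_box[OF open_good z(2)] by blast
  define V where "V = dt T z"
  define q where "q = du U z"
  let ?p = "\<lambda>x. X (t0, x, u0)"
  have p': "(?p has_real_derivative dx X z) (at x0)"
    by (rule section_derivative[OF z smooth_good(2)])
  have ev: "\<forall>\<^sub>F x in nhds x0. a' $ k * V * ?p x ^ r = a $ k * x ^ r * (V * q) ^ r"
    using near_section_nhds[OF e(1), of x0]
  proof eventually_elim
    case x: (elim x)
    note s = du_U_section[OF e(2)[unfolded z(1)] x, folded z(1)]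
    show ?case using X_good(3)[OF refl s(1)] dt_T_du_U[OF s(1)] s by (simp add: V_def q_def)
  qed
  have "((\<lambda>x. a' $ k * V * ?p x ^ r) has_real_derivative a' $ k * V * (of_nat r * (dx X z * X z ^ (r - 1)))) (at x0)"
    using p' unfolding z(1) by (auto intro!: derivative_eq_intros simp: mult_ac)
  moreover have "((\<lambda>x. a $ k * x ^ r * (V * q) ^ r) has_real_derivative a $ k * (of_nat r * x0 ^ (r - 1)) * (V * q) ^ r) (at x0)"
    by (auto intro!: derivative_eq_intros simp: mult_ac)
  ultimately have eq: "a' $ k * V * (of_nat r * (dx X z * X z ^ (r - 1))) = a $ k * (of_nat r * x0 ^ (r - 1)) * (V * q) ^ r"
    using DERIV_cong_ev[OF refl ev refl] DERIV_unique by blast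
  have rr: "y * y ^ (r - 1) = y ^ r" for y :: real using r by (simp flip: power_Suc)
  have Vq: "V * q = dx X z" using dt_T_du_U[OF z(2)] by (simp add: V_def q_def)
  note X = X_good[OF z]
  have nz: "a $ k \<noteq> 0" "x0 \<noteq> 0" "X z \<noteq> 0" "real r \<noteq> 0" using lead z r by (auto simp: good_def)
  have "real r * dx X z * (a' $ k * V * X z ^ r) = X z * (a' $ k * V * (of_nat r * (dx X z * X z ^ (r - 1))))"
    by (simp add: rr[of "X z", symmetric])
  also have "\<dots> = real r * a $ k * x0 ^ (r - 1) * dx X z ^ r * X z" unfolding eq Vq by simp
  finally have "real r * dx X z * (a $ k * x0 ^ r * dx X z ^ r) = real r * a $ k * x0 ^ (r - 1) * dx X z ^ r * X z"
    unfolding V_def X(3) .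
  moreover have "(real r * a $ k * x0 ^ (r - 1) * dx X z ^ r) * (x0 * dx X z)
      = real r * dx X z * (a $ k * (x0 * x0 ^ (r - 1)) * dx X z ^ r)" by (simp only: mult_ac)
  ultimately have "(real r * a $ k * x0 ^ (r - 1) * dx X z ^ r) * (x0 * dx X z) = (real r * a $ k * x0 ^ (r - 1) * dx X z ^ r) * X z"
    unfolding rr by (metis (no_types))
  then show lin: "X z = x0 * dx X z" using nz X(2) by simp
  have "a' $ k * dt T z * X z ^ r = a $ k * X z ^ r" using X(3) by (simp add: lin power_mult_distrib)
  then show "dt T z = lead_quotient" using nz lead by (simp add: field_simps)
qed

text \<open>The difference in the slope isolates the coefficient of u_x. The images of the two
  sections differ by U_u (x - x0), which is affine in the new x because X = x X_x, so the linear
  parts agree.\<close>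

lemma U_good:
  assumes z: "z = (t0, x0, u0)" "z \<in> good"
  shows "lead_quotient * U z = dt X z + dx X z * u0"
proof -
  obtain e where e: "e > 0" "box z e \<subseteq> good" using ex_box[OF open_good z(2)] by blast
  have "\<bar>0\<bar> < e" using e by simp
  note aff = affine_section[OF z(1) e(2) this]
  obtain g1 where g1: "section_image t0 x0 u0 (\<lambda>x. u0 + 0 + 1 * (x - x0)) g1" "affine_identity z g1 0 1"
    by (rule aff)
  obtain g0 where g0: "section_image t0 x0 u0 (\<lambda>x. u0 + 0 + 0 * (x - x0)) g0" "affine_identity z g0 0 0"
    by (rule aff)
  note X = X_good[OF z]
  have "\<forall>\<^sub>F x in at x0. 1 * U (t0, x, u0 + 0 + 1 * (x - x0)) + (-1) * U (t0, x, u0 + 0 + 0 * (x - x0))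
      + 0 * U (t0, x, u0 + 0 + 0 * (x - x0)) + 0 * U (t0, x, u0 + 0 + 0 * (x - x0))
      = 0 + (du U z / dx X z) * (X (t0, x, u0) - X z) + 0"
    using near_section[OF e(1), of x0]
  proof eventually_elim
    case (elim x)
    note s = du_U_section[OF e(2)[unfolded z(1)] elim, folded z(1)]
    have U: "U (t0, x, u0 + (x - x0)) = U (t0, x, u0) + (u0 + (x - x0) - u0) * du U (t0, x, u0)"
      by (rule U_box[OF e(2)]) (use elim e(1) in \<open>simp_all add: mem_box z\<close>)
    have "X (t0, x, u0) = x * dx X z"
      using X_linear[OF refl s(1)] dt_T_du_U[OF s(1)] dt_T_du_U[OF z(2)] s by simp
    moreover have "X z = x0 * dx X z" by (rule X_linear(1)[OF z])
    ultimately have "X (t0, x, u0) - X z = (x - x0) * dx X z" by (simp add: algebra_simps)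
    then show ?case using U s(2) X(2) by simp
  qed
  from linear_part_combination[OF z g1(1) g0(1) g0(1) g0(1) this zero_tendsto]
  have L: "linear_part idx a' g1 (X z) = linear_part idx a' g0 (X z)" by simp
  define q where "q = inverse (dx X z)"
  have u: "snd (snd z) = u0" by (simp add: z)
  have "dt T z * (U z * du U z * q) - dt X z * du U z * q = du U z * u0"
    using g1(2) g0(2) L unfolding q_def[symmetric] u by algebra
  then have "du U z * ((dt T z * U z - dt X z) * q) = du U z * u0" by (simp add: algebra_simps)
  then have "(dt T z * U z - dt X z) * q = u0" using du_U_nonzero[OF z(2)] by simp
  then show ?thesis using X(2) X_linear(2)[OF z] by (simp add: q_def field_simps)
qed

text \<open>The constant c3 of the family, obtained by solving a'_00 = (a_00 + 2 c3) / c1.\<close>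

abbreviation exponent :: real where "exponent \<equiv> (lead_quotient * a00' - a00) / 2"

text \<open>X = x X_x and X_x = T_t U_u express X through x U_u with a constant factor; this is
  differentiated in t.\<close>

lemma dt_du_U:
  assumes z: "z = (t0, x0, u0)" "z \<in> good"
  shows "lead_quotient * x0 * dt (du U) z = dt X z"
proof -
  have eq: "lead_quotient * fst (snd y) * du U y = X y" if "y \<in> good" for y
  proof -
    have X: "X y = fst (snd y) * dx X y" "dt T y = lead_quotient"
      using X_linear[of y "fst y" "fst (snd y)" "snd (snd y)"] that by simp_all
    show ?thesis unfolding X(1) X(2)[symmetric] dt_T_du_U[OF that, symmetric] by (simp only: mult_ac)
  qed
  have "((\<lambda>y. lead_quotient * fst (snd y) * du U y) has_derivative (\<lambda>h. lead_quotient * fst (snd z) *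
     differential (du U) z h + lead_quotient * fst (snd h) * du U z)) (at z)"
    by (rule has_derivative_mult[OF _ has_derivative_partials[OF smooth_du_U z(2)]])
      (use lead in \<open>auto intro!: derivative_eq_intros\<close>)
  then have "(X has_derivative (\<lambda>h. lead_quotient * fst (snd z) *
     differential (du U) z h + lead_quotient * fst (snd h) * du U z)) (at z)"
    by (rule has_derivative_transform_within_open[OF _ open_good z(2)]) (rule eq)
  from partials_eqI(1)[OF this] show ?thesis by (simp add: z(1))
qed

text \<open>The difference in \<open>\<delta>\<close> at slope 0 isolates the coefficient of u. It
  relates a_00 and a'_00 to U_x and to the t-derivative of U_u, and each of these two can be
  expressed through X_t.\<close>

lemma dt_X_good:
  assumes z: "z \<in> good"
  shows "dt X z = exponent * X z"
proof -
  obtain t0 x0 u0 where z1: "z = (t0, x0, u0)" by (cases z)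
  obtain e where e: "e > 0" "box z e \<subseteq> good" using ex_box[OF open_good z] by blast
  define \<delta> where "\<delta> = e / 2"
  have \<delta>: "\<bar>\<delta>\<bar> < e" "\<delta> \<noteq> 0" "\<bar>0\<bar> < e" using e by (auto simp: \<delta>_def)
  obtain g0 where g0: "section_image t0 x0 u0 (\<lambda>x. u0 + 0 + 0 * (x - x0)) g0" "affine_identity z g0 0 0"
    by (rule affine_section[OF z1 e(2) \<delta>(3)])
  obtain h0 where h0: "section_image t0 x0 u0 (\<lambda>x. u0 + \<delta> + 0 * (x - x0)) h0" "affine_identity z h0 \<delta> 0"
    by (rule affine_section[OF z1 e(2) \<delta>(1)])
  have "\<forall>\<^sub>F x in at x0. 1 * U (t0, x, u0 + \<delta> + 0 * (x - x0)) + (-1) * U (t0, x, u0 + 0 + 0 * (x - x0))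
      + 0 * U (t0, x, u0 + 0 + 0 * (x - x0)) + 0 * U (t0, x, u0 + 0 + 0 * (x - x0))
      = \<delta> * du U z + 0 * (X (t0, x, u0) - X z) + 0"
    using near_section[OF e(1), of x0]
  proof eventually_elim
    case (elim x)
    note s = du_U_section[OF e(2)[unfolded z1] elim, folded z1]
    have "U (t0, x, u0 + \<delta>) = U (t0, x, u0) + (u0 + \<delta> - u0) * du U (t0, x, u0)"
      by (rule U_box[OF e(2)]) (use elim e(1) \<delta> in \<open>simp_all add: mem_box z1\<close>)
    then show ?case using s(2) by simp
  qed
  from linear_part_combination[OF z1 z h0(1) g0(1) g0(1) g0(1) this zero_tendsto]
  have L: "linear_part idx a' h0 (X z) = linear_part idx a' g0 (X z)" by simp
  have x0: "x0 \<noteq> 0" using z by (simp add: good_def z1)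
  have c1: "lead_quotient \<noteq> 0" using lead by simp
  \<comment> \<open>By \<open>dt_du_U\<close> the ratio X_t / x is constant along the section, as is
    X_x; the formula for U is therefore affine in x, and its slope can be read off.\<close>
  have P: "lead_quotient * dx U z = dt X z / x0"
  proof -
    have ev: "\<forall>\<^sub>F x in nhds x0. lead_quotient * U (t0, x, u0) = x * (dt X z / x0) + dx X z * u0"
      using near_section_nhds[OF e(1), of x0]
    proof eventually_elim
      case x: (elim x)
      note s = du_U_section[OF e(2)[unfolded z1] x, folded z1]
      have "dx X (t0, x, u0) = dx X z" using dt_T_du_U[OF s(1)] dt_T_du_U[OF z] s by simp
      moreover have "dt X (t0, x, u0) = x * (lead_quotient * dt (du U) z)" "dt X z = x0 * (lead_quotient * dt (du U) z)"
        unfolding dt_du_U[OF refl s(1), symmetric] dt_du_U[OF z1 z, symmetric] s(4) by (simp_all only: mult_ac)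
      then have "dt X (t0, x, u0) = x * (dt X z / x0)" using x0 by simp
      ultimately show ?case using U_good[OF refl s(1)] by simp
    qed
    have d1: "((\<lambda>x. x * (dt X z / x0) + dx X z * u0) has_real_derivative dt X z / x0) (at x0)"
      using x0 by (auto intro!: derivative_eq_intros)
    have d2: "((\<lambda>x. lead_quotient * U (t0, x, u0)) has_real_derivative lead_quotient * dx U z) (at x0)"
      by (intro DERIV_cmult section_derivative[OF z1 z smooth_good(3)])
    show ?thesis using DERIV_unique[OF d2 DERIV_cong_ev[OF refl ev refl, THEN iffD2, OF d1]] .
  qed
  have V: "dt T z = lead_quotient" "X z = x0 * dx X z" using X_linear[OF z1 z] by auto
  define B where "B = du U z"
  have B: "dx X z = lead_quotient * B" using dt_T_du_U[OF z] V by (simp add: B_def)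
  have nB: "B \<noteq> 0" using du_U_nonzero[OF z] by (simp add: B_def)
  define q where "q = inverse (dx X z)"
  have "dt T z * (a00' * \<delta> * du U z - \<delta> * du U z * dx U z * q) = \<delta> * dt (du U) z + du U z * a00 * \<delta>"
    using g0(2) h0(2) L unfolding dxdu_U[OF z] q_def[symmetric] by algebra
  then have "\<delta> * (lead_quotient * (a00' * B - B * dx U z * q)) = \<delta> * (dt (du U) z + B * a00)"
    by (simp add: V B_def algebra_simps)
  then have "lead_quotient * (a00' * B - B * dx U z * q) = dt (du U) z + B * a00"
    using mult_left_cancel[OF \<delta>(2)] by blast
  then have "lead_quotient * a00' * B - (lead_quotient * B * q) * dx U z = dt (du U) z + B * a00"
    by (simp add: algebra_simps)
  moreover have q1: "lead_quotient * B * q = 1"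
    unfolding B[symmetric] q_def using X_good(2)[OF z1 z] by (rule right_inverse)
  ultimately have main: "lead_quotient * a00' * B - dx U z = dt (du U) z + B * a00"
    by (simp only: q1 mult_1_left)
  have 1: "lead_quotient * x0 * dx U z = dt X z" using P x0 by (simp add: field_simps)
  define l where "l = lead_quotient"
  \<comment> \<open>U_x and the t-derivative of U_u contribute X_t once each. This is the source of
    the factor 2 in a_00 + 2 c3.\<close>
  have "l * x0 * B * (l * a00' - a00) = 2 * dt X z"
    using main 1 dt_du_U[OF z1 z] unfolding l_def[symmetric] by algebra
  moreover have "X z = l * x0 * B" using V(2) unfolding B l_def by (simp only: mult_ac)
  ultimately have "dt X z = (l * a00' - a00) / 2 * X z" by (simp add: mult.commute)
  then show ?thesis by (simp only: l_def)
qed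

section \<open>Extension to the whole domain and integration\<close>

text \<open>The set x = 0 contains no open set, and X cannot vanish on an open set because its
  differential is a nonzero row of the Jacobian matrix.\<close>

lemma good_dense:
  assumes "open W" "W \<subseteq> D" "W \<noteq> {}"
  shows "W \<inter> good \<noteq> {}"
proof
  assume e: "W \<inter> good = {}"
  obtain t0 x0 u0 where w: "(t0, x0, u0) \<in> W" using assms(3) by auto
  obtain e where b: "e > 0" "box (t0, x0, u0) e \<subseteq> W" using ex_box[OF assms(1) w] by blast
  obtain x1 where x1: "\<bar>x1 - x0\<bar> < e" "x1 \<noteq> 0"
    using b(1) that[of "if x0 = 0 then e / 2 else x0"] by (auto split: if_splits)
  let ?z = "(t0, x1, u0)"
  have z: "?z \<in> W" using b x1 by (auto simp: mem_box intro!: subsetD[OF b(2)])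
  define W' where "W' = W \<inter> {y. fst (snd y) \<noteq> 0}"
  have "open {y :: txu. fst (snd y) \<noteq> 0}" by (intro open_Collect_neq continuous_intros)
  then have W': "open W'" "?z \<in> W'" using assms(1) z x1 by (auto simp: W'_def)
  have 0: "X y = 0" if "y \<in> W'" for y
    using that e assms(2) unfolding W'_def good_def by blast
  have zD: "?z \<in> D" using z assms(2) by blast
  have "(X has_derivative (\<lambda>h. 0)) (at ?z)"
    by (rule has_derivative_transform_within_open[OF has_derivative_const[of 0] W']) (use 0 in simp)
  from partials_eqI[OF this] show False
    using rows_independent(2)[OF zD, of 0 1 0] by simp
qed

lemma good_dense_eq:
  assumes "continuous_on D f" "continuous_on D g" "\<And>z. z \<in> good \<Longrightarrow> f z = (g z :: real)" "z \<in> D"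
  shows "f z = g z"
proof (rule ccontr)
  assume ne: "f z \<noteq> g z"
  let ?W = "D \<inter> (\<lambda>z. f z - g z) -` (- {0})"
  have "open ?W"
    by (rule continuous_open_preimage[OF _ open_D]) (auto intro!: continuous_intros assms)
  moreover have "z \<in> ?W" using ne assms(4) by simp
  ultimately have "?W \<inter> good \<noteq> {}" by (intro good_dense) auto
  then show False using assms(3) by auto
qed

text \<open>T - c1 t and X_x exp(- c3 t) have zero derivative on all of D. Connectedness turns them
  into the single constants c2 and c4, valid on both sides of x = 0.\<close>

lemma \<phi>_form:
  obtains c1 c2 c3 c4 where "c1 * c4 \<noteq> 0"
    "\<And>t x u. (t, x, u) \<in> D \<Longrightarrow>
      \<phi> (t, x, u) = (c1 * t + c2, c4 * exp (c3 * t) * x, c4 * exp (c3 * t) / c1 * (u + c3 * x))"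
proof -
  note c = smooth_components
  have cont: "continuous_on D f" if "smooth_on D f" for f :: "txu \<Rightarrow> real"
    using smooth_on_continuous[OF that] .
  note cp = cont[OF smooth_on_partials(1)] cont[OF smooth_on_partials(2)] cont[OF smooth_on_partials(3)]
  note conts = cont[OF c(1)] cont[OF c(2)] cont[OF c(3)] cp[OF c(1)] cp[OF c(2)] cp[OF c(3)]
  have prod_collapse3: "w = (fst w, fst (snd w), snd (snd w))" for w :: txu by simp
  have X: "X z = fst (snd z) * dx X z" if "z \<in> D" for z
    by (rule good_dense_eq[OF _ _ X_linear(1)[OF prod_collapse3] that])
      (use lead in \<open>auto intro!: continuous_intros conts\<close>)
  have Xt: "dt X z = exponent * X z" if "z \<in> D" for z
    by (rule good_dense_eq[OF _ _ dt_X_good that])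
      (use lead in \<open>auto intro!: continuous_intros conts\<close>)
  have U: "lead_quotient * U z = dt X z + dx X z * snd (snd z)" if "z \<in> D" for z
    by (rule good_dense_eq[OF _ _ U_good[OF prod_collapse3] that])
      (use lead in \<open>auto intro!: continuous_intros conts\<close>)
  have T: "dt T z = lead_quotient" "dx T z = 0" "du T z = 0" if "z \<in> D" for z
    by (rule good_dense_eq[OF _ _ X_linear(2)[OF prod_collapse3] that] good_dense_eq[OF _ _ T_good(1) that]
        good_dense_eq[OF _ _ T_good(2) that], auto intro!: continuous_intros conts)+
  have conn: "open D" "connected D" using domain by (auto simp: domain_txu_def)
  have const: "f z = f z'" if f: "smooth_on D f" "\<And>z. z \<in> D \<Longrightarrow> dt f z = 0" "\<And>z. z \<in> D \<Longrightarrow> dx f z = 0"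
    "\<And>z. z \<in> D \<Longrightarrow> du f z = 0" "z \<in> D" "z' \<in> D" for f z z'
    by (rule has_derivative_zero_unique_connected[OF conn _ f(5,6)])
      (use has_derivative_partials[OF f(1)] f(2-4) in auto)
  have ne: "D \<noteq> {}" using domain by (auto simp: domain_txu_def)
  obtain z0 where z0: "z0 \<in> good" using good_dense[OF open_D subset_refl ne] by blast
  have z0D: "z0 \<in> D" using z0 good_D by blast
  define S where "S = (\<lambda>z. T z - lead_quotient * fst z)"
  have S: "smooth_on D S" unfolding S_def by (intro smooth_intros open_D c)
  have S': "(S has_derivative (\<lambda>h. 0)) (at z)" if "z \<in> D" for z
  proof -
    have "(S has_derivative (\<lambda>h. differential T z h - lead_quotient * fst h)) (at z)"
      unfolding S_def using lead by (auto intro!: derivative_eq_intros derivatives(1)[OF that])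
    then show ?thesis using T[OF that] by (simp add: mult.commute)
  qed
  define c2 where "c2 = S z0"
  have Tc: "T z = lead_quotient * fst z + c2" if "z \<in> D" for z
    using has_derivative_zero_unique_connected[OF conn S' that z0D] by (simp add: c2_def S_def)
  define Y where "Y = (\<lambda>z. dx X z * exp (- exponent * fst z))"
  have Y: "smooth_on D Y" unfolding Y_def
    by (intro smooth_intros open_D smooth_on_partials c)
  \<comment> \<open>Differentiating \<open>Y\<close> directly would involve second derivatives of X.
    Instead x Y = X exp(- c3 t) is differentiated, and the factor x is cancelled where it is
    nonzero.\<close>
  have Yg: "dt Y z = 0 \<and> dx Y z = 0 \<and> du Y z = 0" if z: "z \<in> good" for z
  proof -
    obtain t x u where z1: "z = (t, x, u)" by (cases z)
    have zD: "z \<in> D" using z good_D by blast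
    have x: "x \<noteq> 0" using z by (simp add: good_def z1)
    let ?E = "exp (- exponent * t)"
    have "((\<lambda>y. fst (snd y) * Y y) has_derivative (\<lambda>h. fst (snd z) *
        differential Y z h + fst (snd h) * Y z)) (at z)"
      by (rule has_derivative_mult[OF _ has_derivative_partials[OF Y zD]]) (auto intro!: derivative_eq_intros)
    moreover have eq: "fst (snd y) * Y y = X y * exp (- exponent * fst y)" if "y \<in> D" for y
      using X[OF that] by (simp add: Y_def)
    ultimately have "((\<lambda>y. X y * exp (- exponent * fst y)) has_derivative (\<lambda>h. fst (snd z) *
        differential Y z h + fst (snd h) * Y z)) (at z)"
      by (rule has_derivative_transform_within_open[OF _ open_D zD])
    note 1 = partials_eqI[OF this]
    have "((\<lambda>y. exp (- exponent * fst y)) has_derivative (\<lambda>h. ?E * (- exponent * fst h))) (at z)"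
      unfolding z1 by (auto intro!: derivative_eq_intros)
    from partials_eqI[OF has_derivative_mult[OF derivatives(2)[OF zD] this]]
    have 2: "dt (\<lambda>y. X y * exp (- exponent * fst y)) z = X z * (?E * - exponent) + dt X z * ?E"
      "dx (\<lambda>y. X y * exp (- exponent * fst y)) z = dx X z * ?E"
      "du (\<lambda>y. X y * exp (- exponent * fst y)) z = du X z * ?E"
      by (simp_all add: z1)
    have "x * dt Y z = 0" using 1(1) 2(1) Xt[OF zD] by (simp add: z1)
    moreover have "x * dx Y z = 0" using 1(2) 2(2) by (simp add: z1 Y_def)
    moreover have "x * du Y z = 0" using 1(3) 2(3) X_good(1)[OF z1 z] by (simp add: z1)
    ultimately show ?thesis using x by simp
  qed
  have YD: "dt Y z = 0" "dx Y z = 0" "du Y z = 0" if "z \<in> D" for z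
    by (rule good_dense_eq[OF _ _ _ that], use Yg in \<open>auto intro!: cp[OF Y] continuous_intros\<close>)+
  define c4 where "c4 = Y z0"
  have Yc: "dx X z = c4 * exp (exponent * fst z)" if "z \<in> D" for z
  proof -
    have "Y z = c4" unfolding c4_def by (rule const[OF Y YD that z0D])
    then show ?thesis by (simp add: Y_def exp_minus field_simps)
  qed
  have c1: "lead_quotient \<noteq> 0" using lead by simp
  have c4: "c4 \<noteq> 0"
    using Yc[OF z0D] X_good(2)[of z0 "fst z0" "fst (snd z0)" "snd (snd z0)"] z0 by auto
  show thesis
  proof (rule that[of lead_quotient c4 c2 exponent])
    show "lead_quotient * c4 \<noteq> 0" using c1 c4 by simp
    fix t x u assume z: "(t, x, u) \<in> D"
    have X': "X (t, x, u) = c4 * exp (exponent * t) * x" using X[OF z] Yc[OF z] by simp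
    have "lead_quotient * U (t, x, u) = c4 * exp (exponent * t) * (u + exponent * x)"
      using U[OF z] Xt[OF z] Yc[OF z] X' by (simp add: algebra_simps)
    then have "U (t, x, u) = c4 * exp (exponent * t) / lead_quotient * (u + exponent * x)"
      using c1 by (metis nonzero_mult_div_cancel_left times_divide_eq_left)
    then show "\<phi> (t, x, u) = (lead_quotient * t + c2, c4 * exp (exponent * t) * x,
        c4 * exp (exponent * t) / lead_quotient * (u + exponent * x))"
      using Tc[OF z] X' by (simp add: \<phi>_eq)
  qed
qed

end

subsection \<open>The transformations of the family\<close>

definition transf_point :: "real \<Rightarrow> real \<Rightarrow> real \<Rightarrow> real \<Rightarrow> txu \<Rightarrow> txu" where
  "transf_point c1 c2 c3 c4 = (\<lambda>(t, x, u).
     (c1 * t + c2, c4 * exp (c3 * t) * x, c4 * exp (c3 * t) / c1 * (u + c3 * x)))"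

definition transf_arb :: "real \<Rightarrow> real \<Rightarrow> ('n::finite) arb \<Rightarrow> 'n arb" where
  "transf_arb c1 c3 = (\<lambda>(a, a00, b0).
     (\<chi> i. a $ i / c1, (a00 + 2 * c3) / c1, (b0 - a00 * c3 - c3\<^sup>2) / c1\<^sup>2))"

lemma F_II0_transf_eq: "F_II0_transf c1 c2 c3 c4 (z, \<theta>) = (transf_point c1 c2 c3 c4 z, transf_arb c1 c3 \<theta>)"
  by (simp add: F_II0_transf_def transf_point_def transf_arb_def split: prod.splits)

text \<open>Solving the first component for t turns exp(- c3 t) into exp(c3 c2 / c1) times the
  exponential of - c3 / c1 times the new time, which is where the fourth parameter of the inverse
  comes from.\<close>

lemma transf_point_inverse:
  assumes "c1 * c4 \<noteq> 0"
  shows "transf_point (1 / c1) (- c2 / c1) (- c3 / c1) (exp (c3 * c2 / c1) / c4) (transf_point c1 c2 c3 c4 z) = z"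
proof -
  obtain t x u where z: "z = (t, x, u)" by (cases z)
  have "exp (c3 * c2 / c1) * exp (- c3 / c1 * (c1 * t + c2)) * exp (c3 * t) = exp 0"
    using assms unfolding exp_add[symmetric] by (intro arg_cong[of _ _ exp]) (simp add: field_simps)
  then have E: "exp (c3 * c2 / c1) * (exp (- c3 / c1 * (c1 * t + c2)) * exp (c3 * t)) = 1" by simp
  define P Q R where "P = exp (c3 * c2 / c1)" and "Q = exp (- c3 / c1 * (c1 * t + c2))" and "R = exp (c3 * t)"
  have PQR: "P * (Q * R) = 1" using E by (simp add: P_def Q_def R_def)
  have nz: "c1 \<noteq> 0" "c4 \<noteq> 0" using assms by auto
  have "P / c4 * Q * (c4 * R * x) = x * (P * (Q * R))" using nz by simp
  moreover have "P / c4 * Q / (1 / c1) * (c4 * R / c1 * (u + c3 * x) + - c3 / c1 * (c4 * R * x)) = u * (P * (Q * R))"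
    using nz by (simp add: field_simps)
  moreover have "1 / c1 * (c1 * t + c2) + - c2 / c1 = t" using nz by (simp add: field_simps)
  ultimately show ?thesis
    unfolding z transf_point_def split_conv P_def[symmetric] Q_def[symmetric] R_def[symmetric] PQR by simp
qed

lemma transf_arb_inverse:
  assumes "c1 \<noteq> 0"
  shows "transf_arb (1 / c1) (- c3 / c1) (transf_arb c1 c3 \<theta>) = \<theta>"
proof -
  obtain a a00 b0 where \<theta>: "\<theta> = (a, a00, b0)" by (cases \<theta>)
  have "((b0 - a00 * c3 - c3\<^sup>2) / c1\<^sup>2 - (a00 + 2 * c3) / c1 * (- c3 / c1) - (- c3 / c1)\<^sup>2) / (1 / c1)\<^sup>2 = b0"
    using assms by (simp add: field_simps power2_eq_square)
  then show ?thesis using assms by (simp add: \<theta> transf_arb_def vec_eq_iff field_simps)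
qed

text \<open>Inverting the parameters twice restores them, so a left inverse is also a right
  inverse.\<close>

lemma transf_point_inverse':
  assumes "c1 * c4 \<noteq> 0"
  shows "transf_point c1 c2 c3 c4 (transf_point (1 / c1) (- c2 / c1) (- c3 / c1) (exp (c3 * c2 / c1) / c4) z) = z"
proof -
  have nz: "c1 \<noteq> 0" "c4 \<noteq> 0" "1 / c1 * (exp (c3 * c2 / c1) / c4) \<noteq> 0" using assms by auto
  have "- c3 / c1 * (- c2 / c1) / (1 / c1) = c3 * c2 / c1" using nz by simp
  then have "exp (- c3 / c1 * (- c2 / c1) / (1 / c1)) / (exp (c3 * c2 / c1) / c4) = c4" by simp
  then show ?thesis
    using transf_point_inverse[OF nz(3), of "- c2 / c1" "- c3 / c1" z] nz(1,2) by simp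
qed

lemma transf_arb_inverse':
  assumes "c1 \<noteq> 0"
  shows "transf_arb c1 c3 (transf_arb (1 / c1) (- c3 / c1) \<theta>) = \<theta>"
  using transf_arb_inverse[of "1 / c1" "- c3 / c1" \<theta>] assms by simp

lemma F_II0_transf_inverse:
  assumes "c1 * c4 \<noteq> 0"
  shows "F_II0_transf (1 / c1) (- c2 / c1) (- c3 / c1) (exp (c3 * c2 / c1) / c4) (F_II0_transf c1 c2 c3 c4 w) = w"
    "F_II0_transf c1 c2 c3 c4 (F_II0_transf (1 / c1) (- c2 / c1) (- c3 / c1) (exp (c3 * c2 / c1) / c4) w) = w"
proof -
  have "c1 \<noteq> 0" using assms by simp
  note inv = transf_point_inverse[OF assms] transf_point_inverse'[OF assms]
    transf_arb_inverse[OF this] transf_arb_inverse'[OF this]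
  obtain z \<theta> where w: "w = (z, \<theta>)" by (cases w)
  show "F_II0_transf (1 / c1) (- c2 / c1) (- c3 / c1) (exp (c3 * c2 / c1) / c4) (F_II0_transf c1 c2 c3 c4 w) = w"
    "F_II0_transf c1 c2 c3 c4 (F_II0_transf (1 / c1) (- c2 / c1) (- c3 / c1) (exp (c3 * c2 / c1) / c4) w) = w"
    unfolding w F_II0_transf_eq inv by (rule refl)+
qed

lemma smooth_transf_point:
  fixes S :: "'a::real_normed_vector set"
  assumes S: "open S" "smooth_on S f"
  shows "smooth_on S (\<lambda>w. transf_point c1 c2 c3 c4 (f w))"
proof -
  note p = smooth_on_bounded_linear[OF bounded_linear_fst S(1)] smooth_on_bounded_linear[OF bounded_linear_snd S(1)]
  have "smooth_on S (\<lambda>w. (c1 * fst (f w) + c2, c4 * exp (c3 * fst (f w)) * fst (snd (f w)),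
      c4 * exp (c3 * fst (f w)) * inverse c1 * (snd (snd (f w)) + c3 * fst (snd (f w)))))"
    by (intro smooth_on_Pair smooth_on_add smooth_on_mult smooth_on_exp smooth_on_const p S)
  then show ?thesis by (simp add: transf_point_def case_prod_beta divide_inverse)
qed

lemma smooth_transf_arb:
  fixes S :: "'a::real_normed_vector set" and f :: "'a \<Rightarrow> ('n::finite) arb"
  assumes S: "open S" "smooth_on S f"
  shows "smooth_on S (\<lambda>w. transf_arb c1 c3 (f w))"
proof -
  note p = smooth_on_bounded_linear[OF bounded_linear_fst S(1)] smooth_on_bounded_linear[OF bounded_linear_snd S(1)]
  have "smooth_on S (\<lambda>w. (inverse c1 *\<^sub>R fst (f w), (fst (snd (f w)) + 2 * c3) * inverse c1,
      (snd (snd (f w)) - fst (snd (f w)) * c3 - c3\<^sup>2) * inverse (c1\<^sup>2)))"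
    by (intro smooth_on_Pair smooth_on_add smooth_on_diff smooth_on_mult smooth_on_scaleR smooth_on_const p S)
  moreover have "inverse c1 *\<^sub>R b = (\<chi> i. b $ i / c1)" for b :: "real ^ 'n"
    by (simp add: vec_eq_iff divide_inverse mult.commute)
  ultimately show ?thesis by (simp add: transf_arb_def case_prod_beta divide_inverse)
qed

lemma smooth_F_II0_transf: "smooth_on UNIV (F_II0_transf c1 c2 c3 c4 :: txu \<times> ('n::finite) arb \<Rightarrow> _)"
proof -
  have "smooth_on UNIV (\<lambda>w :: txu \<times> 'n arb. (transf_point c1 c2 c3 c4 (fst w), transf_arb c1 c3 (snd w)))"
    by (intro smooth_on_Pair smooth_transf_point smooth_transf_arb smooth_on_fst smooth_on_snd open_UNIV)
  moreover have "F_II0_transf c1 c2 c3 c4 w = (transf_point c1 c2 c3 c4 (fst w), transf_arb c1 c3 (snd w))" for w :: "txu \<times> 'n arb"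
    by (cases w) (simp add: F_II0_transf_eq)
  ultimately show ?thesis by presburger
qed

text \<open>With a globally smooth two-sided inverse, the image of \<open>D\<close> is a preimage
  under that inverse and hence open.\<close>

lemma diffeo_onI:
  assumes "open D" "smooth_on UNIV f" "smooth_on UNIV g" "\<And>x. g (f x) = x" "\<And>y. f (g y) = y"
    "\<And>x. x \<in> D \<Longrightarrow> h x = f x"
  shows "diffeo_on D h"
proof -
  have gh: "g (h x) = x" if "x \<in> D" for x using that assms(4,6) by simp
  have inj: "inj_on h D" using gh by (rule inj_on_inverseI)
  have "h ` D = g -` D"
  proof (intro equalityI subsetI)
    fix y assume "y \<in> g -` D"
    then have "h (g y) = y" "g y \<in> D" using assms(5,6) by simp_all
    then show "y \<in> h ` D" by (metis imageI)
  qed (auto simp: gh)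
  moreover have "open (g -` D)"
    using continuous_open_preimage[OF smooth_on_continuous[OF assms(3)] open_UNIV assms(1)] by simp
  ultimately have o: "open (h ` D)" by simp
  have "smooth_on D h"
    by (rule smooth_on_cong[OF assms(1) _ smooth_on_subset[OF assms(2)]]) (simp_all add: assms(6))
  moreover have "smooth_on (h ` D) (the_inv_into D h)"
  proof (rule smooth_on_cong[OF o _ smooth_on_subset[OF assms(3)]])
    fix y assume "y \<in> h ` D"
    then obtain x where x: "x \<in> D" "y = h x" by blast
    then show "g y = the_inv_into D h y" by (simp add: the_inv_into_f_f[OF inj] gh)
  qed simp
  ultimately show ?thesis using assms(1) inj o by (simp add: diffeo_on_def)
qed

lemma diffeo_on_nondegenerate:
  assumes "diffeo_on D f" "x \<in> D" "frechet_derivative f (at x) h = 0"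
  shows "h = 0"
proof -
  let ?g = "the_inv_into D f"
  have d: "open D" "inj_on f D" "smooth_on D f" "smooth_on (f ` D) ?g"
    using assms(1) by (auto simp: diffeo_on_def)
  have f: "(f has_derivative frechet_derivative f (at x)) (at x)"
    using smooth_on_has_derivative[OF d(3) assms(2)] .
  have g: "(?g has_derivative frechet_derivative ?g (at (f x))) (at (f x))"
    using smooth_on_has_derivative[OF d(4)] assms(2) by blast
  have "((\<lambda>y. y) has_derivative (\<lambda>h. frechet_derivative ?g (at (f x)) (frechet_derivative f (at x) h))) (at x)"
    by (rule has_derivative_transform_within_open[OF has_derivative_compose[OF f g] d(1) assms(2)])
      (rule the_inv_into_f_f[OF d(2)])
  from has_derivative_unique[OF this has_derivative_ident]
  have "h = frechet_derivative ?g (at (f x)) (frechet_derivative f (at x) h)" by metis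
  also have "\<dots> = 0" using assms(3) has_derivative_linear[OF g] linear_0 by metis
  finally show ?thesis .
qed

section \<open>The family maps the class to itself\<close>

text \<open>At fixed t a member of the family only rescales x, so this case of the chain rule covers
  all higher derivatives of the composition.\<close>

lemma higher_deriv_scale:
  fixes g :: "real \<Rightarrow> real"
  assumes "open N" "smooth_on N g" "l * x \<in> N"
  shows "(deriv ^^ j) (\<lambda>x. g (l * x)) x = l ^ j * (deriv ^^ j) g (l * x)"
  using assms(3)
proof (induction j arbitrary: x)
  case (Suc j)
  have "((\<lambda>y. l * y) \<longlongrightarrow> l * x) (nhds x)" by (intro tendsto_intros filterlim_ident)
  from topological_tendstoD[OF this assms(1) Suc.prems]
  have "\<forall>\<^sub>F y in nhds x. (deriv ^^ j) (\<lambda>x. g (l * x)) y = l ^ j * (deriv ^^ j) g (l * y)"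
    by eventually_elim (rule Suc.IH)
  then have "(deriv ^^ Suc j) (\<lambda>x. g (l * x)) x = deriv (\<lambda>y. l ^ j * (deriv ^^ j) g (l * y)) x"
    by (simp add: deriv_cong_ev)
  also have "\<dots> = l ^ j * ((deriv ^^ Suc j) g (l * x) * l)"
  proof (intro DERIV_imp_deriv DERIV_cmult)
    show "((\<lambda>y. (deriv ^^ j) g (l * y)) has_real_derivative (deriv ^^ Suc j) g (l * x) * l) (at x)"
      by (rule DERIV_chain2[where f = "(deriv ^^ j) g" and g = "\<lambda>y. l * y"])
        (rule smooth_on_higher_deriv(2)[OF assms(1,2) Suc.prems], auto intro!: derivative_eq_intros)
  qed
  finally show ?case by simp
qed simp

context leading_index
begin

lemma linear_part_cong:
  assumes "open S" "x \<in> S" "\<And>y. y \<in> S \<Longrightarrow> f y = g y"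
  shows "linear_part idx a f x = linear_part idx a g x"
  unfolding linear_part_def using higher_deriv_cong[OF assms(1,3,2)] by simp

text \<open>The relation of the graphs is solved for u = c1 v(T, X) / (c4 exp(c3 t)) - c3 x. The
  residual of the source equation then comes out as c1^2 / l times that of the target equation,
  where \<open>l\<close> is the scaling factor of x at \<open>t0\<close>.\<close>

lemma transf_equation:
  assumes D: "open D" and \<phi>: "\<And>z. z \<in> D \<Longrightarrow> \<phi> z = transf_point c1 c2 c3 c4 z" and c: "c1 * c4 \<noteq> 0"
    and mg: "maps_graph D \<phi> u p v q"
  shows "F_II0 idx \<theta> u p \<longleftrightarrow> F_II0 idx (transf_arb c1 c3 \<theta>) v q"
proof -
  obtain t0 x0 where p: "p = (t0, x0)" by (cases p)
  obtain a a00 b0 where \<theta>: "\<theta> = (a, a00, b0)" by (cases \<theta>)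
  note m = mg[unfolded maps_graph_def]
  have nz: "c1 \<noteq> 0" "c4 \<noteq> 0" using c by auto
  define l where "l = c4 * exp (c3 * t0)"
  have l: "l \<noteq> 0" using nz by (simp add: l_def)
  have q: "q = (c1 * t0 + c2, l * x0)"
    using m \<phi> by (auto simp: transf_point_def p l_def prod_eq_iff)
  obtain N where N: "open N" "p \<in> N" "smooth_on N u" using m by (auto simp: smooth_near_def)
  obtain M where M: "open M" "q \<in> M" "smooth_on M v" using m by (auto simp: smooth_near_def)
  have "isCont u p" using smooth_on_continuous[OF N(3)] N(1,2) by (simp add: continuous_on_eq_continuous_at)
  then have "((\<lambda>w. (fst w, snd w, u w)) \<longlongrightarrow> (fst p, snd p, u p)) (nhds p)"
    unfolding isCont_def tendsto_at_iff_tendsto_nhds by (intro tendsto_intros filterlim_ident)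
  then have inD: "\<forall>\<^sub>F w in nhds p. (fst w, snd w, u w) \<in> D"
    by (rule topological_tendstoD) (use D m in auto)
  have "\<forall>\<^sub>F (t, x) in nhds p. case \<phi> (t, x, u (t, x)) of (t', x', u') \<Rightarrow> u' = v (t', x')"
    using m by blast
  then have ev: "\<forall>\<^sub>F w in nhds p. u w = c1 / (c4 * exp (c3 * fst w)) * v (c1 * fst w + c2, c4 * exp (c3 * fst w) * snd w) - c3 * snd w"
    using inD
  proof eventually_elim
    case (elim w)
    have "c4 * exp (c3 * fst w) / c1 * (u w + c3 * snd w) = v (c1 * fst w + c2, c4 * exp (c3 * fst w) * snd w)"
      using elim \<phi>[OF elim(2)] by (simp add: transf_point_def case_prod_beta)
    then show ?case using nz by (simp flip: add: field_simps)
  qed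
  then obtain O' where O': "open O'" "p \<in> O'"
    "\<And>w. w \<in> O' \<Longrightarrow> u w = c1 / (c4 * exp (c3 * fst w)) * v (c1 * fst w + c2, c4 * exp (c3 * fst w) * snd w) - c3 * snd w"
    unfolding eventually_nhds by blast

  let ?f = "\<lambda>y. u (t0, y)" and ?g = "\<lambda>y. v (c1 * t0 + c2, y)" and ?g' = "frechet_derivative v (at q) (0, 1)"
    and ?vt = "frechet_derivative v (at q) (1, 0)"
  note slM = smooth_on_slice[OF M(1,3), of "c1 * t0 + c2"]
  let ?M = "{y. (c1 * t0 + c2, y) \<in> M}"
  have xM: "l * x0 \<in> ?M" using M(2) q by simp
  have g': "(?g has_real_derivative ?g') (at (l * x0))"
    using smooth_on_imp_deriv(1)[OF slM xM] deriv_slices(2)[OF M(3)] M(2) q by simp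
  have u0: "u p = c1 / l * v q - c3 * x0" using O'(3)[OF O'(2)] by (simp add: p q l_def)
  let ?S = "{y. (t0, y) \<in> O'} \<inter> {y. l * y \<in> ?M}"
  have "open ((\<lambda>y. (t0, y)) -` O' \<inter> (\<lambda>y. l * y) -` ?M)"
    by (intro open_Int open_vimage O'(1) slM(1) continuous_intros)
  moreover have "(\<lambda>y. (t0, y)) -` O' \<inter> (\<lambda>y. l * y) -` ?M = ?S" by blast
  ultimately have "open ?S" by (rule back_subst[where P = "open"])
  then have S: "open ?S" "x0 \<in> ?S" using O'(2) xM p by auto
  have f: "?f y = test_poly x0 (- c3 * x0) (- c3) 0 0 y + c1 / l * ?g (l * y)" if "y \<in> ?S" for y
    using O'(3)[of "(t0, y)"] that by (simp add: test_poly_def l_def algebra_simps)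
  have sg: "smooth_on ?S (\<lambda>y. ?g (l * y))"
  proof (rule smooth_on_compose[OF S(1) _ slM(2)])
    show "smooth_on ?S (\<lambda>y. l * y)" by (intro smooth_intros S(1))
  qed blast
  have "linear_part idx a ?f x0 = linear_part idx a (\<lambda>y. test_poly x0 (- c3 * x0) (- c3) 0 0 y + c1 / l * ?g (l * y)) x0"
    by (rule linear_part_cong[OF S f])
  also have "\<dots> = c1 / l * linear_part idx a (\<lambda>y. ?g (l * y)) x0"
    unfolding linear_part_add_cmult[OF S(1) smooth_test_poly sg S(2)] linear_part_test_poly by simp
  \<comment> \<open>The operators x^j d^j/dx^j are invariant under scaling: the factor l^j from the
    derivative is absorbed by x0^j.\<close>
  also have "linear_part idx a (\<lambda>y. ?g (l * y)) x0 = linear_part idx a ?g (l * x0)"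
    unfolding linear_part_def higher_deriv_scale[OF slM xM]
    by (intro sum.cong refl) (simp add: power_mult_distrib mult_ac)
  finally have lin: "linear_part idx a ?f x0 = c1 / l * linear_part idx a ?g (l * x0)" .
  have "((\<lambda>y. test_poly x0 (- c3 * x0) (- c3) 0 0 y + c1 / l * ?g (l * y)) has_real_derivative
      - c3 + c1 / l * (?g' * l)) (at x0)"
  proof -
    have "((\<lambda>y. ?g (l * y)) has_real_derivative ?g' * l) (at x0)"
      by (rule DERIV_chain2[where f = ?g and g = "\<lambda>y. l * y"]) (rule g', auto intro!: derivative_eq_intros)
    from DERIV_add[OF test_poly_has_derivative[of x0 "- c3 * x0" "- c3" 0 0] DERIV_cmult[OF this, of "c1 / l"]]
    show ?thesis by simp
  qed
  then have "(?f has_real_derivative - c3 + c1 / l * (?g' * l)) (at x0)"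
    by (rule DERIV_cong_ev[OF refl eventually_mono[OF eventually_nhds_in_open[OF S]] refl, THEN iffD1, rotated])
      (use f in auto)
  then have f': "deriv ?f x0 = c1 * ?g' - c3" using l by (simp add: DERIV_imp_deriv)
  have lin': "linear_part idx (\<chi> i. a $ i / c1) ?g (l * x0) = linear_part idx a ?g (l * x0) / c1"
    by (simp add: linear_part_def sum_divide_distrib)
  have ut: "deriv (\<lambda>s. u (s, x0)) t0 = - c3 * (c1 / l * v q) + c1 / l * (c1 * ?vt + c3 * (l * x0) * ?g')"
  proof -
    have "((\<lambda>s. (c1 * s + c2, c4 * exp (c3 * s) * x0)) has_derivative (\<lambda>h. (c1 * h, c4 * (exp (c3 * t0) * (c3 * h)) * x0))) (at t0)"
      by (auto intro!: derivative_eq_intros)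
    moreover have "(v has_derivative (\<lambda>h. fst h * ?vt + snd h * ?g')) (at (c1 * t0 + c2, c4 * exp (c3 * t0) * x0))"
      using has_derivative_plane[OF M(3,2)] by (simp add: q l_def)
    ultimately have "((\<lambda>s. v (c1 * s + c2, c4 * exp (c3 * s) * x0)) has_derivative
        (\<lambda>h. c1 * h * ?vt + c4 * (exp (c3 * t0) * (c3 * h)) * x0 * ?g')) (at t0)"
      using has_derivative_compose by fastforce
    moreover have "(\<lambda>h. c1 * h * ?vt + c4 * (exp (c3 * t0) * (c3 * h)) * x0 * ?g') = (*) (c1 * ?vt + c3 * (l * x0) * ?g')"
      by (auto simp: l_def algebra_simps)
    ultimately have v': "((\<lambda>s. v (c1 * s + c2, c4 * exp (c3 * s) * x0)) has_real_derivative c1 * ?vt + c3 * (l * x0) * ?g') (at t0)"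
      by (simp add: has_field_derivative_def)
    have "((\<lambda>s. c1 / c4 * exp (- c3 * s)) has_real_derivative c1 / c4 * (exp (- c3 * t0) * - c3)) (at t0)"
      using nz by (auto intro!: derivative_eq_intros)
    from DERIV_diff[OF DERIV_mult[OF this v'] DERIV_const[of "c3 * x0"]]
    have "((\<lambda>s. c1 / c4 * exp (- c3 * s) * v (c1 * s + c2, c4 * exp (c3 * s) * x0) - c3 * x0) has_real_derivative
       c1 / c4 * (exp (- c3 * t0) * - c3) * v q + (c1 * ?vt + c3 * (l * x0) * ?g') * (c1 / c4 * exp (- c3 * t0))) (at t0)"
      by (simp add: q l_def)
    moreover have "open ((\<lambda>s. (s, x0)) -` O')" by (intro open_vimage O'(1) continuous_intros)
    moreover have "t0 \<in> (\<lambda>s. (s, x0)) -` O'" using O'(2) p by simp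
    moreover have "c1 / c4 * exp (- c3 * s) * v (c1 * s + c2, c4 * exp (c3 * s) * x0) - c3 * x0 = u (s, x0)"
      if "s \<in> (\<lambda>s. (s, x0)) -` O'" for s
      using O'(3)[of "(s, x0)"] that by (simp add: exp_minus field_simps)
    ultimately have "((\<lambda>s. u (s, x0)) has_real_derivative
       c1 / c4 * (exp (- c3 * t0) * - c3) * v q + (c1 * ?vt + c3 * (l * x0) * ?g') * (c1 / c4 * exp (- c3 * t0))) (at t0)"
      by (rule has_field_derivative_transform_within_open)
    then have "deriv (\<lambda>s. u (s, x0)) t0 =
       c1 / c4 * (exp (- c3 * t0) * - c3) * v q + (c1 * ?vt + c3 * (l * x0) * ?g') * (c1 / c4 * exp (- c3 * t0))"
      by (rule DERIV_imp_deriv)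
    moreover have "c1 / c4 * exp (- c3 * t0) = c1 / l" by (simp add: l_def exp_minus field_simps)
    moreover have "c1 / c4 * (exp (- c3 * t0) * - c3) = - c3 * (c1 / c4 * exp (- c3 * t0))" by simp
    ultimately show ?thesis by (simp only:) (simp only: algebra_simps)
  qed
  have dv: "deriv (\<lambda>s. v (s, l * x0)) (c1 * t0 + c2) = ?vt" "deriv ?g (l * x0) = ?g'"
    using deriv_slices[OF M(3)] M(2) q by simp_all
  have lhs: "F_II0 idx \<theta> u p \<longleftrightarrow> - c3 * (c1 / l * v q) + c1 / l * (c1 * ?vt + c3 * (l * x0) * ?g')
      = c1 / l * linear_part idx a ?g (l * x0) + a00 * (c1 / l * v q - c3 * x0) + b0 * x0
        - (c1 / l * v q - c3 * x0) * (c1 * ?g' - c3)"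
    using u0 by (simp add: p F_II0_iff \<theta> evolution_def ut lin f')
  have rhs: "F_II0 idx (transf_arb c1 c3 \<theta>) v q \<longleftrightarrow> ?vt = linear_part idx a ?g (l * x0) / c1 + (a00 + 2 * c3) / c1 * v q
      + (b0 - a00 * c3 - c3\<^sup>2) / c1\<^sup>2 * (l * x0) - v q * ?g'"
    by (simp add: q F_II0_iff \<theta> evolution_def transf_arb_def lin' dv[unfolded q])
  \<comment> \<open>The terms in c3 x v_x from u_t and from u u_x cancel. Those in c3 v add up to
    the shift 2 c3 of a_00, and the products of - c3 x with a_00 and - c3 give the shift of
    b_0.\<close>
  have "(- c3 * (c1 / l * v q) + c1 / l * (c1 * ?vt + c3 * (l * x0) * ?g'))
      - (c1 / l * linear_part idx a ?g (l * x0) + a00 * (c1 / l * v q - c3 * x0) + b0 * x0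
        - (c1 / l * v q - c3 * x0) * (c1 * ?g' - c3))
    = c1\<^sup>2 / l * (?vt - (linear_part idx a ?g (l * x0) / c1 + (a00 + 2 * c3) / c1 * v q
      + (b0 - a00 * c3 - c3\<^sup>2) / c1\<^sup>2 * (l * x0) - v q * ?g'))"
    using nz l by (simp add: field_simps power2_eq_square)
  moreover have "c1\<^sup>2 / l \<noteq> 0" using nz l by simp
  ultimately show ?thesis unfolding lhs rhs by (metis eq_iff_diff_eq_0 mult_eq_0_iff)
qed

section \<open>Uniqueness of the target equation\<close>

text \<open>Constant functions with two different values separate a_00 from b_0 at a point with
  nonzero y. Adding the power of x - y with exponent \<open>idx i\<close> then isolates the
  coefficient of that order.\<close>

lemma evolution_determines:
  assumes "y \<noteq> 0" "w1 \<noteq> w2"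
    and "\<And>g w. w = w1 \<or> w = w2 \<Longrightarrow> smooth_on UNIV g \<Longrightarrow> g y = w \<Longrightarrow> evolution idx \<theta>1 g y = evolution idx \<theta>2 g y"
  shows "\<theta>1 = \<theta>2"
proof -
  obtain a1 p1 q1 where 1: "\<theta>1 = (a1, p1, q1)" by (cases \<theta>1)
  obtain a2 p2 q2 where 2: "\<theta>2 = (a2, p2, q2)" by (cases \<theta>2)
  have sm: "smooth_on UNIV (\<lambda>x::real. (x - y) ^ j)" for j by (intro smooth_intros open_UNIV)
  have const: "linear_part idx a (test_poly y w 0 0 0) y = 0" for a w by (simp add: linear_part_test_poly)
  have ev: "p1 * w + q1 * y = p2 * w + q2 * y" if "w = w1 \<or> w = w2" for w
    using assms(3)[OF that smooth_test_poly, of y w 0 0 0] by (simp add: 1 2 evolution_def const)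
  have "(p1 - p2) * (w1 - w2) = 0" using ev[of w1] ev[of w2] by (simp add: algebra_simps)
  then have p: "p1 = p2" using assms(2) by simp
  then have q: "q1 = q2" using ev[of w1] assms(1) by simp
  have "a1 $ i = a2 $ i" for i
  proof -
    let ?g = "\<lambda>x. test_poly y w1 0 0 0 x + 1 * (x - y) ^ idx i"
    have i: "idx i \<ge> 2" using idx_bounds by blast
    have sg: "smooth_on UNIV ?g" by (intro smooth_on_add smooth_on_mult smooth_on_const smooth_test_poly sm open_UNIV)
    have gy: "?g y = w1" using i by (simp add: power_0_left)
    have "linear_part idx a ?g y = a $ i * y ^ idx i * fact (idx i)" for a
    proof -
      have "linear_part idx a (\<lambda>x. (x - y) ^ idx i) y = (\<Sum>j\<in>{i}. a $ j * y ^ idx j * (if idx j = idx i then fact (idx i) else 0))"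
        unfolding linear_part_def higher_deriv_monomial_at
        by (rule sum.mono_neutral_right) (use bij_betw_imp_inj_on[OF idx] in \<open>auto simp: inj_on_def\<close>)
      then show ?thesis
        using linear_part_add_cmult[OF open_UNIV smooth_test_poly sm[of "idx i"] UNIV_I, of idx a y w1 0 0 0 1 y]
        by (simp add: const)
    qed
    then have "a1 $ i * y ^ idx i * fact (idx i) = a2 $ i * y ^ idx i * fact (idx i)"
      using assms(3)[OF _ sg gy] by (simp add: 1 2 evolution_def gy p q)
    then show ?thesis using assms(1) by simp
  qed
  then show ?thesis using p q by (simp add: 1 2 vec_eq_iff)
qed

text \<open>Any target section through an available point can be given a time derivative that
  satisfies the equation for \<open>\<theta>'\<close>. Its preimage satisfies the source equation,
  so the section also satisfies the equation given by the direct calculation, and the two evolutions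
  agree. Openness of D offers a nonzero \<open>x0\<close> with two values of u over one
  \<open>t0\<close>, enough to separate the coefficients.\<close>

lemma target_unique:
  assumes D: "domain_txu D" and \<phi>: "\<And>z. z \<in> D \<Longrightarrow> \<phi> z = transf_point c1 c2 c3 c4 z" and c: "c1 * c4 \<noteq> 0"
    and maps: "maps_equation D \<phi> (F_II0 idx \<theta>) (F_II0 idx \<theta>')"
  shows "\<theta>' = transf_arb c1 c3 \<theta>"
proof -
  have oD: "open D" "D \<noteq> {}" using D by (auto simp: domain_txu_def)
  have nz: "c1 \<noteq> 0" "c4 \<noteq> 0" using c by auto
  obtain t0 x u where "(t0, x, u) \<in> D" using oD(2) by auto
  then obtain A B where AB: "open A" "open B" "t0 \<in> A" "(x, u) \<in> B" "A \<times> B \<subseteq> D"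
    using open_prod_elim[OF oD(1)] by (metis mem_Sigma_iff)
  then obtain B1 B2 where B: "open B1" "open B2" "x \<in> B1" "u \<in> B2" "B1 \<times> B2 \<subseteq> B"
    using open_prod_elim[OF AB(2,4)] by (metis mem_Sigma_iff)
  have pick: "\<exists>y. y \<in> C \<and> y \<noteq> e" if "open C" "C \<noteq> {}" for C and e :: real
    using that by (metis finite.emptyI finite_insert insertCI not_open_singleton subset_singleton_iff subsetI)
  obtain x0 where x0: "x0 \<in> B1" "x0 \<noteq> 0" using pick[OF B(1)] B(3) by blast
  obtain u' where u': "u' \<in> B2" "u' \<noteq> u" using pick[OF B(2)] B(4) by blast
  have inD: "(t0, x0, u) \<in> D" "(t0, x0, u') \<in> D" using AB(3,5) B(4,5) x0 u' by auto
  define l where "l = c4 * exp (c3 * t0)"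
  have l: "l \<noteq> 0" using nz by (simp add: l_def)
  let ?q = "(c1 * t0 + c2, l * x0)"
  have main: "evolution idx \<theta>' g (l * x0) = evolution idx (transf_arb c1 c3 \<theta>) g (l * x0)"
    if z: "(t0, x0, w) \<in> D" and g: "smooth_on UNIV g" "g (l * x0) = l / c1 * (w + c3 * x0)" for w g
  proof -
    define \<tau> where "\<tau> = evolution idx \<theta>' g (l * x0)"
    define v where "v = (\<lambda>y :: real \<times> real. g (snd y) + \<tau> * (fst y - (c1 * t0 + c2)))"
    \<comment> \<open>The preimage of \<open>v\<close>: the third component of the transformation
      solved for u.\<close>
    define us where "us = (\<lambda>y :: real \<times> real. c1 / c4 * exp (- c3 * fst y) *
      v (c1 * fst y + c2, c4 * exp (c3 * fst y) * snd y) - c3 * snd y)"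
    have sv: "smooth_on UNIV v"
      unfolding v_def by (intro smooth_intros open_UNIV smooth_on_compose[OF open_UNIV _ g(1) smooth_on_snd]) simp
    have sus: "smooth_on UNIV us"
      unfolding us_def by (intro smooth_intros open_UNIV smooth_on_compose[OF open_UNIV _ sv]) simp
    have usp: "us (t0, x0) = w"
      using nz l by (simp add: us_def v_def g(2) flip: l_def) (simp add: l_def exp_minus field_simps)
    have tp: "transf_point c1 c2 c3 c4 (t, x, us (t, x)) = (c1 * t + c2, c4 * exp (c3 * t) * x,
        v (c1 * t + c2, c4 * exp (c3 * t) * x))" for t x
      using nz by (simp add: transf_point_def us_def exp_minus field_simps)
    have "maps_graph D \<phi> us (t0, x0) v ?q"
      unfolding maps_graph_def
    proof (intro conjI)
      show "smooth_near (t0, x0) us" "smooth_near ?q v" unfolding smooth_near_def using sus sv by blast+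
      show 1: "(fst (t0, x0), snd (t0, x0), us (t0, x0)) \<in> D" using z usp by simp
      then show "\<phi> (fst (t0, x0), snd (t0, x0), us (t0, x0)) = (fst ?q, snd ?q, v ?q)"
        using tp[of t0 x0] \<phi>[OF 1] by (simp add: l_def)
      have "smooth_on UNIV (\<lambda>w. (fst w, snd w, us w))" by (intro smooth_intros sus open_UNIV)
      from continuous_open_preimage[OF smooth_on_continuous[OF this] open_UNIV oD(1)]
      have "open ((\<lambda>w. (fst w, snd w, us w)) -` D)" by simp
      then have "\<forall>\<^sub>F w in nhds (t0, x0). w \<in> (\<lambda>w. (fst w, snd w, us w)) -` D"
        by (rule eventually_nhds_in_open) (use 1 in simp)
      then show "\<forall>\<^sub>F (t, x) in nhds (t0, x0). case \<phi> (t, x, us (t, x)) of (t', x', u') \<Rightarrow> u' = v (t', x')"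
      proof eventually_elim
        case (elim w)
        then show ?case using \<phi>[of "(fst w, snd w, us w)"] tp[of "fst w" "snd w"] by (cases w) simp
      qed
    qed
    note mg = this
    have vt: "deriv (\<lambda>s. v (s, l * x0)) (c1 * t0 + c2) = \<tau>"
      unfolding v_def by (rule DERIV_imp_deriv) (auto intro!: derivative_eq_intros)
    have vg: "(\<lambda>y. v (c1 * t0 + c2, y)) = g" by (simp add: v_def)
    have "F_II0 idx \<theta>' v ?q" unfolding F_II0_iff vt vg by (simp add: \<tau>_def)
    then have "F_II0 idx \<theta> us (t0, x0)" using maps mg unfolding maps_equation_def by blast
    then have "F_II0 idx (transf_arb c1 c3 \<theta>) v ?q"
      using transf_equation[OF oD(1) \<phi> c mg] by blast
    then show ?thesis unfolding F_II0_iff vt vg by (simp add: \<tau>_def)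
  qed
  show ?thesis
  proof (rule evolution_determines[of "l * x0" "l / c1 * (u + c3 * x0)" "l / c1 * (u' + c3 * x0)"])
    show "l * x0 \<noteq> 0" using l x0 by simp
    show "l / c1 * (u + c3 * x0) \<noteq> l / c1 * (u' + c3 * x0)" using l nz u' by simp
  qed (use main inD in auto)
qed

section \<open>The equivalence group and normalization\<close>

lemma F_II0_arb_eq: "F_II0_arb idx r = {\<theta>. fst \<theta> $ k \<noteq> 0}"
  using idx_less k unfolding F_II0_arb_def by (auto, metis nless_le)

lemma open_F_II0_arb: "open (F_II0_arb idx r)"
  unfolding F_II0_arb_eq by (intro open_Collect_neq continuous_intros)

lemma transf_arb_mem: "c1 \<noteq> 0 \<Longrightarrow> \<theta> \<in> F_II0_arb idx r \<Longrightarrow> transf_arb c1 c3 \<theta> \<in> F_II0_arb idx r"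
  by (cases \<theta>) (auto simp: F_II0_arb_eq transf_arb_def)

lemma family_is_equivalence:
  assumes D: "domain_txu D" and c: "c1 * c4 \<noteq> 0"
    and T: "\<And>w. w \<in> D \<times> F_II0_arb idx r \<Longrightarrow> T w = F_II0_transf c1 c2 c3 c4 w"
  shows "usual_equivalence_transformation (F_II0_arb idx r) (F_II0 idx) D T"
proof -
  have oD: "open D" using D by (simp add: domain_txu_def)
  have "diffeo_on (D \<times> F_II0_arb idx r) T"
    by (rule diffeo_onI[OF open_Times[OF oD open_F_II0_arb] smooth_F_II0_transf smooth_F_II0_transf F_II0_transf_inverse[OF c] T])
  moreover have "\<exists>\<phi>. (\<forall>z\<in>D. \<forall>\<theta>\<in>F_II0_arb idx r. fst (T (z, \<theta>)) = \<phi> z) \<and>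
      (\<forall>\<theta>\<in>F_II0_arb idx r. \<exists>\<theta>'\<in>F_II0_arb idx r. (\<forall>z\<in>D. snd (T (z, \<theta>)) = \<theta>') \<and>
         maps_equation D \<phi> (F_II0 idx \<theta>) (F_II0 idx \<theta>'))"
  proof (intro exI conjI ballI)
    fix \<theta> assume \<theta>: "\<theta> \<in> F_II0_arb idx r"
    show "fst (T (z, \<theta>)) = transf_point c1 c2 c3 c4 z" if "z \<in> D" for z
      using T[of "(z, \<theta>)"] that \<theta> by (simp add: F_II0_transf_eq)
    have "maps_equation D (transf_point c1 c2 c3 c4) (F_II0 idx \<theta>) (F_II0 idx (transf_arb c1 c3 \<theta>))"
      unfolding maps_equation_def using transf_equation[OF oD refl c] by blast
    moreover have "\<forall>z\<in>D. snd (T (z, \<theta>)) = transf_arb c1 c3 \<theta>" using T \<theta> by (simp add: F_II0_transf_eq)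
    moreover have "transf_arb c1 c3 \<theta> \<in> F_II0_arb idx r" using transf_arb_mem \<theta> c by auto
    ultimately show "\<exists>\<theta>'\<in>F_II0_arb idx r. (\<forall>z\<in>D. snd (T (z, \<theta>)) = \<theta>') \<and>
         maps_equation D (transf_point c1 c2 c3 c4) (F_II0 idx \<theta>) (F_II0 idx \<theta>')" by blast
  qed
  ultimately show ?thesis unfolding usual_equivalence_transformation_def using D by blast
qed

lemma admissible_form:
  assumes "point_map D \<phi>" "\<theta> \<in> F_II0_arb idx r" "\<theta>' \<in> F_II0_arb idx r"
    and maps: "maps_equation D \<phi> (F_II0 idx \<theta>) (F_II0 idx \<theta>')"
  obtains c1 c2 c3 c4 where "c1 * c4 \<noteq> 0" "\<And>z. z \<in> D \<Longrightarrow> \<phi> z = transf_point c1 c2 c3 c4 z"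
proof -
  interpret point_map D \<phi> by (rule assms(1))
  interpret equation_map D \<phi> r idx k "fst \<theta>" "fst \<theta>'" "fst (snd \<theta>)" "fst (snd \<theta>')" "snd (snd \<theta>)" "snd (snd \<theta>')"
    by unfold_locales (use assms(2,3) maps in \<open>simp_all add: F_II0_arb_eq\<close>)
  obtain c1 c2 c3 c4 where c: "c1 * c4 \<noteq> 0" and form: "\<And>t x u. (t, x, u) \<in> D \<Longrightarrow>
      \<phi> (t, x, u) = (c1 * t + c2, c4 * exp (c3 * t) * x, c4 * exp (c3 * t) / c1 * (u + c3 * x))"
    by (rule \<phi>_form) blast
  show thesis
  proof (rule that[OF c])
    show "\<phi> z = transf_point c1 c2 c3 c4 z" if "z \<in> D" for z
      using that by (cases z) (simp add: form transf_point_def)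
  qed
qed

text \<open>The (t, x, u)-part is common to all arbitrary elements, so the four constants can be
  determined from a single equation of the class. Uniqueness of the target then fixes the remaining
  components for each \<open>\<theta>\<close> separately, although the parameter set, with a_r
  nonzero, is disconnected.\<close>

lemma equivalence_is_family:
  assumes "usual_equivalence_transformation (F_II0_arb idx r) (F_II0 idx) D T"
  obtains c1 c2 c3 c4 where "c1 * c4 \<noteq> 0" "\<And>w. w \<in> D \<times> F_II0_arb idx r \<Longrightarrow> T w = F_II0_transf c1 c2 c3 c4 w"
proof -
  let ?S = "F_II0_arb idx r"
  have D: "domain_txu D" "open D" and diffeo: "diffeo_on (D \<times> ?S) T"
    using assms by (auto simp: usual_equivalence_transformation_def domain_txu_def)
  obtain \<phi> where \<phi>: "\<And>z \<theta>. z \<in> D \<Longrightarrow> \<theta> \<in> ?S \<Longrightarrow> fst (T (z, \<theta>)) = \<phi> z"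
    and ex: "\<And>\<theta>. \<theta> \<in> ?S \<Longrightarrow> \<exists>\<theta>'\<in>?S. (\<forall>z\<in>D. snd (T (z, \<theta>)) = \<theta>') \<and> maps_equation D \<phi> (F_II0 idx \<theta>) (F_II0 idx \<theta>')"
    using assms unfolding usual_equivalence_transformation_def by blast
  define \<theta>0 :: "'n arb" where "\<theta>0 = (\<chi> i. 1, 0, 0)"
  have \<theta>0: "\<theta>0 \<in> ?S" by (simp add: F_II0_arb_eq \<theta>0_def)
  obtain \<theta>1 where \<theta>1: "\<theta>1 \<in> ?S" "\<And>z. z \<in> D \<Longrightarrow> snd (T (z, \<theta>0)) = \<theta>1"
    "maps_equation D \<phi> (F_II0 idx \<theta>0) (F_II0 idx \<theta>1)" using ex[OF \<theta>0] by blast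
  have Teq: "T (z, \<theta>0) = (\<phi> z, \<theta>1)" if "z \<in> D" for z
    using \<phi>[OF that \<theta>0] \<theta>1(2)[OF that] by (simp add: prod_eq_iff)
  have sT: "smooth_on (D \<times> ?S) T" using diffeo by (simp add: diffeo_on_def)
  have "smooth_on D (\<lambda>z. T (z, \<theta>0))"
  proof (rule smooth_on_compose[OF D(2) _ sT])
    show "(\<lambda>z. (z, \<theta>0)) ` D \<subseteq> D \<times> ?S" using \<theta>0 by blast
  qed (intro smooth_intros D(2))
  from smooth_on_bounded_linear[OF bounded_linear_fst D(2) this]
  have s\<phi>: "smooth_on D \<phi>"
    by (rule smooth_on_cong[OF D(2), rotated]) (simp add: Teq)
  have "point_map D \<phi>"
  proof
    fix z h assume z: "z \<in> D" and h: "frechet_derivative \<phi> (at z) h = 0"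
    have zS: "(z, \<theta>0) \<in> D \<times> ?S" using z \<theta>0 by simp
    have "((\<lambda>z. (z, \<theta>0)) has_derivative (\<lambda>h. (h, 0))) (at z)" by (auto intro!: derivative_eq_intros)
    from has_derivative_compose[OF this smooth_on_has_derivative[OF sT zS]]
    have "((\<lambda>z. (\<phi> z, \<theta>1)) has_derivative (\<lambda>h. frechet_derivative T (at (z, \<theta>0)) (h, 0))) (at z)"
      by (rule has_derivative_transform_within_open[OF _ D(2) z]) (rule Teq)
    moreover have "((\<lambda>z. (\<phi> z, \<theta>1)) has_derivative (\<lambda>h. (frechet_derivative \<phi> (at z) h, 0))) (at z)"
      by (intro has_derivative_Pair smooth_on_has_derivative[OF s\<phi> z] has_derivative_const)
    ultimately have "(\<lambda>h. frechet_derivative T (at (z, \<theta>0)) (h, 0)) = (\<lambda>h. (frechet_derivative \<phi> (at z) h, 0))"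
      by (rule has_derivative_unique)
    \<comment> \<open>On D the \<open>\<theta>\<close>-component of the image of
      \<open>(z, \<theta>0)\<close> is constant, so a kernel vector \<open>h\<close> of the
      derivative of \<open>\<phi>\<close> gives the kernel vector \<open>(h, 0)\<close> of the
      derivative of \<open>T\<close>.\<close>
    from fun_cong[OF this, of h] have "frechet_derivative T (at (z, \<theta>0)) (h, 0) = 0" using h by (simp add: zero_prod_def)
    from diffeo_on_nondegenerate[OF diffeo zS this] show "h = 0" by (simp add: zero_prod_def)
  qed (use D s\<phi> in auto)
  then obtain c1 c2 c3 c4 where c: "c1 * c4 \<noteq> 0" and form: "\<And>z. z \<in> D \<Longrightarrow> \<phi> z = transf_point c1 c2 c3 c4 z"
    using admissible_form[OF _ \<theta>0 \<theta>1(1,3)] by metis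
  show thesis
  proof (rule that[OF c])
    fix w assume "w \<in> D \<times> ?S"
    then obtain z \<theta> where w: "w = (z, \<theta>)" "z \<in> D" "\<theta> \<in> ?S" by blast
    obtain \<theta>' where \<theta>': "snd (T (z, \<theta>)) = \<theta>'" "maps_equation D \<phi> (F_II0 idx \<theta>) (F_II0 idx \<theta>')"
      using ex[OF w(3)] w(2) by blast
    have "\<theta>' = transf_arb c1 c3 \<theta>" by (rule target_unique[OF D(1) form c \<theta>'(2)])
    then show "T w = F_II0_transf c1 c2 c3 c4 w"
      using \<phi>[OF w(2,3)] \<theta>'(1) form[OF w(2)] by (simp add: w(1) F_II0_transf_eq prod_eq_iff)
  qed
qed

text \<open>An admissible transformation has the form of the family with constants that make sense
  for every equation of the class, so the same constants define an equivalence transformation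
  generating it. Conversely, the members of the group are explicit, and their restrictions are
  diffeomorphisms of (t, x, u) that map equations as required.\<close>

lemma normalized: "normalized_usual (F_II0_arb idx r) (F_II0 idx)"
  unfolding normalized_usual_def
proof (intro set_eqI iffI)
  let ?S = "F_II0_arb idx r"
  fix y assume "y \<in> generated_admissible ?S (F_II0 idx)"
  then obtain \<theta> \<theta>' D \<phi> T where y: "y = (\<theta>, \<theta>', D, \<phi>)" "\<theta> \<in> ?S"
    and T: "usual_equivalence_transformation ?S (F_II0 idx) D T" "\<And>z. z \<in> D \<Longrightarrow> T (z, \<theta>) = (\<phi> z, \<theta>')"
    by (auto simp: generated_admissible_def)
  have D: "domain_txu D" "open D" "D \<noteq> {}"
    using T(1) by (auto simp: usual_equivalence_transformation_def domain_txu_def)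
  obtain c1 c2 c3 c4 where c: "c1 * c4 \<noteq> 0" and form: "\<And>w. w \<in> D \<times> ?S \<Longrightarrow> T w = F_II0_transf c1 c2 c3 c4 w"
    by (rule equivalence_is_family[OF T(1)]) blast
  have \<phi>: "\<phi> z = transf_point c1 c2 c3 c4 z" "\<theta>' = transf_arb c1 c3 \<theta>" if "z \<in> D" for z
    using T(2)[OF that] form[of "(z, \<theta>)"] that y(2) by (auto simp: F_II0_transf_eq)
  have "diffeo_on D \<phi>"
    by (rule diffeo_onI[OF D(2) smooth_transf_point[OF open_UNIV smooth_on_id] smooth_transf_point[OF open_UNIV smooth_on_id]
        transf_point_inverse[OF c] transf_point_inverse'[OF c] \<phi>(1)])
  \<comment> \<open>The target elements are read off at any point of D, which is nonempty.\<close>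
  moreover have "\<theta>' = transf_arb c1 c3 \<theta>" using \<phi>(2) D(3) by blast
  moreover from this have "\<theta>' \<in> ?S" using transf_arb_mem y(2) c by auto
  ultimately show "y \<in> equivalence_groupoid ?S (F_II0 idx)"
    using transf_equation[OF D(2) \<phi>(1) c] D(1) y
    by (auto simp: equivalence_groupoid_def point_transformation_def maps_equation_def)
next
  let ?S = "F_II0_arb idx r"
  fix y assume "y \<in> equivalence_groupoid ?S (F_II0 idx)"
  then obtain \<theta> \<theta>' D \<phi> where y: "y = (\<theta>, \<theta>', D, \<phi>)" "\<theta> \<in> ?S" "\<theta>' \<in> ?S"
    and \<phi>: "domain_txu D" "diffeo_on D \<phi>" and maps: "maps_equation D \<phi> (F_II0 idx \<theta>) (F_II0 idx \<theta>')"
    by (auto simp: equivalence_groupoid_def point_transformation_def)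
  have "point_map D \<phi>"
    using \<phi> diffeo_on_nondegenerate[OF \<phi>(2)] by unfold_locales (auto simp: diffeo_on_def)
  then obtain c1 c2 c3 c4 where c: "c1 * c4 \<noteq> 0" and form: "\<And>z. z \<in> D \<Longrightarrow> \<phi> z = transf_point c1 c2 c3 c4 z"
    using admissible_form[OF _ y(2,3) maps] by metis
  have "\<theta>' = transf_arb c1 c3 \<theta>" by (rule target_unique[OF \<phi>(1) form c maps])
  then have "\<forall>z\<in>D. F_II0_transf c1 c2 c3 c4 (z, \<theta>) = (\<phi> z, \<theta>')" using form by (simp add: F_II0_transf_eq)
  then show "y \<in> generated_admissible ?S (F_II0 idx)"
    using family_is_equivalence[OF \<phi>(1) c refl] y by (auto simp: generated_admissible_def)
qed

end

theorem proposition17: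
  fixes r :: nat and idx :: "'n::finite \<Rightarrow> nat"
  assumes "r \<ge> 2" and "bij_betw idx UNIV {2..r}"
  shows "normalized_usual (F_II0_arb idx r) (F_II0 idx) \<and>
    (\<forall>D T. usual_equivalence_transformation (F_II0_arb idx r) (F_II0 idx) D T \<longleftrightarrow>
       domain_txu D \<and>
       (\<exists>c1 c2 c3 c4. c1 * c4 \<noteq> 0 \<and>
          (\<forall>w \<in> D \<times> F_II0_arb idx r. T w = F_II0_transf c1 c2 c3 c4 w)))"
proof -
  obtain k where "idx k = r" using assms by (metis atLeastAtMost_iff bij_betw_iff_bijections order_refl)
  then interpret leading_index r idx k using assms by unfold_locales
  show ?thesis
  proof (intro conjI allI iffI normalized)
    fix D T assume eq: "usual_equivalence_transformation (F_II0_arb idx r) (F_II0 idx) D T"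
    then show "domain_txu D" by (simp add: usual_equivalence_transformation_def)
    show "\<exists>c1 c2 c3 c4. c1 * c4 \<noteq> 0 \<and> (\<forall>w \<in> D \<times> F_II0_arb idx r. T w = F_II0_transf c1 c2 c3 c4 w)"
      by (rule equivalence_is_family[OF eq]) blast
  next
    fix D T assume "domain_txu D \<and> (\<exists>c1 c2 c3 c4. c1 * c4 \<noteq> 0 \<and>
        (\<forall>w \<in> D \<times> F_II0_arb idx r. T w = F_II0_transf c1 c2 c3 c4 w))"
    then show "usual_equivalence_transformation (F_II0_arb idx r) (F_II0 idx) D T"
      using family_is_equivalence by blast
  qed
qed

end
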